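(* Let $\Omega\subset\mathbb{R}^n$ be a bounded, connected, open set, let $\lambda_N(\Omega)$ be a simple eigenvalue of the Dirichlet Laplacian in $\Omega$, and let $u_N$ be an $L^2(\Omega)$-normalized eigenfunction associated to $\lambda_N(\Omega)$. Let $(K_\varepsilon)_{\varepsilon>0}$ be a family of compact sets contained in $\Omega$ concentrating to a compact set $K\subset\Omega$ with $\mathrm{Cap}_\Omega(K)=0$. Then $$\lambda_N(\Omega\setminus K_\varepsilon)=\lambda_N(\Omega)+\mathrm{Cap}_\Omega(K_\varepsilon,u_N)+o\big(\mathrm{Cap}_\Omega(K_\varepsilon,u_N)\big)\quad\text{as }\varepsilon\to0^+.$$
   Context: For a bounded open set $D$, $\lambda_N(D)$ denotes the $N$-th eigenvalue (in increasing order, counted with multiplicity) of the Dirichlet Laplacian on $D$. For a compact set $K\subset\Omega$ and $u\in H^1_0(\Omega)$, the $u$-capacity of $K$ in $\Omega$ is $$\mathrm{Cap}_\Omega(K,u)=\inf\Big\{\int_\Omega|\nabla f|^2\,dx:\ f\in H^1_0(\Omega),\ f-u\in H^1_0(\Omega\setminus K)\Big\}.$$ The condenser capacity is $\mathrm{Cap}_\Omega(K)=\mathrm{Cap}_\Omega(K,\eta_K)$, where $\eta_K$ is any fixed smooth function with support in $\Omega$ and $\eta_K\equiv1$ in a neighborhood of $K$. A family $\{K_\varepsilon\}_{\varepsilon>0}$ of compact subsets of $\Omega$ is concentrating to a compact set $K\subset\Omega$ if for every open $U\subseteq\Omega$ with $U\supset K$ there exists $\varepsilon_U>0$ such that $K_\varepsilon\subset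 U$ for every $\varepsilon<\varepsilon_U$. *)

theory Defs
  imports "HOL-Analysis.Analysis" "HOL-Library.Landau_Symbols"
begin

section \<open>Smooth functions and test functions\<close>

primrec C_k :: "nat \<Rightarrow> ('a::euclidean_space \<Rightarrow> real) \<Rightarrow> bool" where
  "C_k 0 f \<longleftrightarrow> continuous_on UNIV f"
| "C_k (Suc k) f \<longleftrightarrow> f differentiable_on UNIV \<and>
     (\<forall>b\<in>Basis. C_k k (\<lambda>x. frechet_derivative f (at x) b))"

definition smooth :: "('a::euclidean_space \<Rightarrow> real) \<Rightarrow> bool" where
  "smooth f \<longleftrightarrow> (\<forall>k. C_k k f)"

definition test_functions :: "'a::euclidean_space set \<Rightarrow> ('a \<Rightarrow> real) set" where
  "test_functions D =
     {\<phi>. smooth \<phi> \<and> compact (closure {x. \<phi> x \<noteq> 0}) \<and> closure {x. \<phi> x \<noteq> 0} \<subseteq> D}"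

section \<open>Sobolev spaces\<close>

text \<open>Elements of Sobolev spaces are represented by Borel functions on the whole space; every
  notion below depends only on the class modulo almost-everywhere equality.\<close>

definition square_integrable :: "('a::euclidean_space \<Rightarrow> 'b::euclidean_space) \<Rightarrow> bool" where
  "square_integrable f \<longleftrightarrow>
     f \<in> borel_measurable lborel \<and> integrable lborel (\<lambda>x. (norm (f x))\<^sup>2)"

definition is_weak_gradient :: "('a::euclidean_space \<Rightarrow> real) \<Rightarrow> ('a \<Rightarrow> 'a) \<Rightarrow> bool" where
  "is_weak_gradient u g \<longleftrightarrow>
     (\<forall>\<phi>\<in>test_functions UNIV. \<forall>b\<in>Basis.
        (LINT x|lborel. u x * frechet_derivative \<phi> (at x) b) =
        - (LINT x|lborel. (g x \<bullet> b) * \<phi> x))"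

definition H1 :: "('a::euclidean_space \<Rightarrow> real) set" where
  "H1 = {u. square_integrable u \<and> (\<exists>g. square_integrable g \<and> is_weak_gradient u g)}"

text \<open>The weak gradient is determined only almost everywhere; \<^const>\<open>Eps\<close> picks a representative.\<close>

definition weak_grad :: "('a::euclidean_space \<Rightarrow> real) \<Rightarrow> 'a \<Rightarrow> 'a" where
  "weak_grad u = (SOME g. square_integrable g \<and> is_weak_gradient u g)"

definition H1_norm :: "('a::euclidean_space \<Rightarrow> real) \<Rightarrow> real" where
  "H1_norm u =
     sqrt ((LINT x|lborel. (u x)\<^sup>2) + (LINT x|lborel. (norm (weak_grad u x))\<^sup>2))"

text \<open>\<open>H10 D\<close> is $H^1_0(D)$, the closure of the test functions on the open set \<open>D\<close>, with every
  function extended by zero outside \<open>D\<close>. Thus \<open>H10 D' \<subseteq> H10 D\<close> for \<open>D' \<subseteq> D\<close>, which is the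
  identification used when one requires $f - u \in H^1_0(\Omega \setminus K)$ for $f, u$ defined
  on $\Omega$; in particular it forces $f = u$ almost everywhere on $K$.\<close>

definition H10 :: "'a::euclidean_space set \<Rightarrow> ('a \<Rightarrow> real) set" where
  "H10 D = {u \<in> H1. \<exists>\<phi>. (\<forall>k::nat. \<phi> k \<in> test_functions D) \<and>
                 (\<lambda>k. H1_norm (\<lambda>x. \<phi> k x - u x)) \<longlonglongrightarrow> 0}"

section \<open>Eigenvalues of the Dirichlet Laplacian\<close>

definition dirichlet_eigenspace ::
    "'a::euclidean_space set \<Rightarrow> real \<Rightarrow> ('a \<Rightarrow> real) set" where
  "dirichlet_eigenspace D \<mu> =
     {u \<in> H10 D. \<forall>v\<in>H10 D.
        (LINT x:D|lborel. weak_grad u x \<bullet> weak_grad v x) = \<mu> * (LINT x:D|lborel. u x * v x)}"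

text \<open>\<open>dirichlet_multiplicity D \<mu> m\<close>: modulo almost-everywhere equality, the eigenspace of \<open>\<mu>\<close> has
  a basis \<open>e 0, \<dots>, e (m - 1)\<close>. It holds with \<open>m = 0\<close> iff \<open>\<mu>\<close> is not an eigenvalue.\<close>

definition dirichlet_multiplicity :: "'a::euclidean_space set \<Rightarrow> real \<Rightarrow> nat \<Rightarrow> bool" where
  "dirichlet_multiplicity D \<mu> m \<longleftrightarrow>
     (\<exists>e :: nat \<Rightarrow> 'a \<Rightarrow> real.
        (\<forall>i<m. e i \<in> dirichlet_eigenspace D \<mu>) \<and>
        (\<forall>c. (AE x in lborel. (\<Sum>i<m. c i * e i x) = 0) \<longrightarrow> (\<forall>i<m. c i = 0)) \<and>
        (\<forall>u\<in>dirichlet_eigenspace D \<mu>. \<exists>c. AE x in lborel. u x = (\<Sum>i<m. c i * e i x)))"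

definition enumerates_dirichlet_spectrum ::
    "'a::euclidean_space set \<Rightarrow> (nat \<Rightarrow> real) \<Rightarrow> bool" where
  "enumerates_dirichlet_spectrum D l \<longleftrightarrow>
     mono l \<and> (\<forall>\<mu>. finite {k. l k = \<mu>} \<and> dirichlet_multiplicity D \<mu> (card {k. l k = \<mu>}))"

text \<open>Such an enumeration is unique if it exists, and it exists for every nonempty bounded open
  \<open>D\<close>. The argument \<open>N\<close> counts from 1.\<close>

definition dirichlet_eigenvalue :: "'a::euclidean_space set \<Rightarrow> nat \<Rightarrow> real" where
  "dirichlet_eigenvalue D N = (THE l. enumerates_dirichlet_spectrum D l) (N - 1)"

section \<open>Capacities\<close>

definition u_capacity :: "'a::euclidean_space set \<Rightarrow> 'a set \<Rightarrow> ('a \<Rightarrow> real) \<Rightarrow> real" where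
  "u_capacity \<Omega> K u =
     Inf {LINT x:\<Omega>|lborel. (norm (weak_grad f x))\<^sup>2 | f.
            f \<in> H10 \<Omega> \<and> (\<lambda>x. f x - u x) \<in> H10 (\<Omega> - K)}"

text \<open>The value does not depend on the choice of the cutoff function.\<close>

definition condenser_capacity :: "'a::euclidean_space set \<Rightarrow> 'a set \<Rightarrow> real" where
  "condenser_capacity \<Omega> K =
     u_capacity \<Omega> K
       (SOME \<eta>. \<eta> \<in> test_functions \<Omega> \<and> (\<exists>U. open U \<and> K \<subseteq> U \<and> (\<forall>x\<in>U. \<eta> x = 1)))"

definition concentrating ::
    "'a::euclidean_space set \<Rightarrow> (real \<Rightarrow> 'a set) \<Rightarrow> 'a set \<Rightarrow> bool" where
  "concentrating \<Omega> K K0 \<longleftrightarrow>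
     (\<forall>U. open U \<and> U \<subseteq> \<Omega> \<and> K0 \<subseteq> U \<longrightarrow>
        (\<exists>\<delta>>0. \<forall>\<epsilon>. 0 < \<epsilon> \<and> \<epsilon> < \<delta> \<longrightarrow> K \<epsilon> \<subseteq> U))"

end

theory Submission
  imports Defs "HOL-Computational_Algebra.Polynomial" "HOL-Library.Diagonal_Subsequence"
begin

text \<open>Let \<open>V\<close> be the minimizer defining the \<open>u\<close>-capacity \<open>C\<close> of \<open>K \<epsilon>\<close>, so that \<open>\<psi> = u - V\<close> lies in
  $H^1_0(\Omega \setminus K_\varepsilon)$ and \<open>V\<close> is orthogonal to that space for the Dirichlet form. Then
  \<open>\<psi>\<close> solves the eigenvalue equation on $\Omega \setminus K_\varepsilon$ up to the residual \<open>\<lambda> V\<close>, and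
  expanding it in eigenfunctions there (Kato--Temple) gives $\lambda_N(\Omega \setminus K_\varepsilon) - \lambda = C + o(C)$,
  provided that $\|V\|_{L^2}^2 = o(C)$, \<open>C\<close> tends to 0, and \<open>\<lambda>\<close> keeps a uniform distance from the other eigenvalues on
  $\Omega \setminus K_\varepsilon$. All three follow from one density statement: because \<open>K0\<close> has
  capacity zero, test functions supported off \<open>K0\<close> are dense in $H^1_0(\Omega)$, and each of them is
  eventually admissible on $\Omega \setminus K_\varepsilon$. Existence of the spectrum rests on Rellich compactness, obtained by
  comparing a test function with its averages over small cubes.\<close>

section \<open>Spectral theory of a pair of forms\<close>

text \<open>The remainder is \<open>o(C)\<close>, and not of the order of the square root of
  \<open>C\<close>, because the residual is tested only against \<open>V\<close> itself and against
  the components of \<open>\<psi>\<close> below and above the \<open>j\<close>-th eigenvector. The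
  gap makes these components as small as \<open>V\<close> in L2, so every error is of order
  \<open>b V V\<close>, apart from a term quadratic in \<open>C\<close>. All then depends on
  \<open>b V V \<le> \<eta> * a V V\<close> for arbitrary \<open>\<eta>\<close>. This holds because
  \<open>V\<close> is \<open>a\<close>-orthogonal to a space that nearly contains the first
  \<open>k\<close> eigenvectors: its coefficients along them are small, and what remains gains a
  factor \<open>1 / l k\<close>. The uniform gap has two sources: shrinking the domain cannot lower
  eigenvalues, which protects the gap above, while min-max with approximated eigenvectors stops the
  lower eigenvalues from rising into the gap below. An eigensystem records, in place of completeness
  of its vectors, a Rayleigh bound on the complement of the first \<open>k\<close> of them, so
  expansions are finite with a controlled remainder. This part is linear algebra over two
  semidefinite forms, energy \<open>a\<close> and L2 product \<open>b\<close>.\<close>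

lemma exists_nontrivial_kernel:
  fixes M :: "'i \<Rightarrow> 'j \<Rightarrow> real"
  assumes "finite I" "finite J" "card I < card J"
  shows "\<exists>c. (\<exists>j\<in>J. c j \<noteq> 0) \<and> (\<forall>i\<in>I. (\<Sum>j\<in>J. c j * M i j) = 0)"
  using assms
proof (induction I arbitrary: M J rule: finite_induct)
  case empty
  then have "J \<noteq> {}" by auto
  then show ?case by (intro exI[of _ "\<lambda>_. 1"]) auto
next
  case (insert k I)
  show ?case
  proof (cases "\<forall>j\<in>J. M k j = 0")
    case True
    have "card I < card J" using insert by simp
    from insert.IH[OF insert.prems(1) this, of M] True show ?thesis by auto
  next
    case False
    then obtain p where p: "p \<in> J" "M k p \<noteq> 0" by auto
    let ?J = "J - {p}"
    have "card I < card ?J" using insert p by (simp add: card_Diff_singleton)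
    with insert.IH[of ?J "\<lambda>i j. M i j - M k j / M k p * M i p"] insert.prems(1)
    obtain c where c: "\<exists>j\<in>?J. c j \<noteq> 0"
      "\<forall>i\<in>I. (\<Sum>j\<in>?J. c j * (M i j - M k j / M k p * M i p)) = 0" by blast
    \<comment> \<open>Equation \<open>k\<close> is the pivot: it determines the coefficient of
      \<open>p\<close> from the others, which is then substituted into the remaining
      equations.\<close>
    define d where "d = (\<lambda>j. if j = p then - (\<Sum>j\<in>?J. c j * (M k j / M k p)) else c j)"
    have d: "(\<Sum>j\<in>J. d j * M i j) = (\<Sum>j\<in>?J. c j * (M i j - M k j / M k p * M i p))" for i
    proof -
      have "(\<Sum>j\<in>J. d j * M i j) = d p * M i p + (\<Sum>j\<in>?J. d j * M i j)"
        using p insert.prems(1) by (simp add: sum.remove)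
      also have "(\<Sum>j\<in>?J. d j * M i j) = (\<Sum>j\<in>?J. c j * M i j)"
        by (intro sum.cong) (auto simp: d_def)
      finally show ?thesis
        by (simp add: d_def algebra_simps sum_subtractf sum_distrib_left sum_distrib_right)
    qed
    have "\<exists>j\<in>J. d j \<noteq> 0" using c(1) by (auto simp: d_def)
    moreover have "(\<Sum>j\<in>J. d j * M k j) = 0" unfolding d using p by simp
    ultimately show ?thesis using c(2) d by (intro exI[of _ d]) auto
  qed
qed

text \<open>The dimension count of the min-max principle: \<open>k + 1\<close> vectors have a
  combination orthogonal to \<open>k\<close> given ones, and unit coefficients give it
  \<open>b\<close>-norm 1 when the vectors are orthonormal.\<close>

lemma exists_normalized_kernel:
  fixes M :: "nat \<Rightarrow> nat \<Rightarrow> real"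
  shows "\<exists>c. (\<Sum>j\<le>k. (c j)\<^sup>2) = 1 \<and> (\<forall>i<k. (\<Sum>j\<le>k. c j * M i j) = 0)"
proof -
  obtain c where c: "\<exists>j\<le>k. c j \<noteq> 0" "\<forall>i<k. (\<Sum>j\<le>k. c j * M i j) = 0"
    using exists_nontrivial_kernel[of "{..<k}" "{..k}" M] by auto
  define s where "s = (\<Sum>j\<le>k. (c j)\<^sup>2)"
  have s: "s > 0" proof -
    obtain j where "j \<le> k" "c j \<noteq> 0" using c(1) by blast
    then show ?thesis unfolding s_def by (intro sum_pos2[of _ j]) auto
  qed
  have "(\<Sum>j\<le>k. (c j / sqrt s)\<^sup>2) = 1"
    using s by (simp add: power_divide flip: sum_divide_distrib s_def)
  moreover have "(\<Sum>j\<le>k. (c j / sqrt s) * M i j) = (\<Sum>j\<le>k. c j * M i j) / sqrt s" for i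
    by (simp add: sum_divide_distrib)
  ultimately show ?thesis using c(2) by (intro exI[of _ "\<lambda>j. c j / sqrt s"]) simp
qed

text \<open>Near \<open>t = 0\<close> a nonzero linear term would dominate and make the polynomial
  negative somewhere. Euler-Lagrange equations are read off from minimality this way.\<close>

lemma quadratic_nonneg_linear_zero:
  fixes p c :: real
  assumes "\<And>t. 0 \<le> 2 * t * p + t\<^sup>2 * c"
  shows "p = 0"
proof (rule ccontr)
  assume "p \<noteq> 0"
  \<comment> \<open>The test value is \<open>t = - p / d\<close>. The added 1 keeps \<open>d\<close>
    positive when \<open>c = 0\<close>, and \<open>c < d\<close> makes the quadratic term too weak
    to compensate.\<close>
  define d where "d = \<bar>c\<bar> + 1"
  have d: "d > 0" "c < d" unfolding d_def by auto
  have "2 * (- p / d) * p + (- p / d)\<^sup>2 * c = (p\<^sup>2 / d) * (c / d - 2)"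
    using d by (simp add: divide_simps power2_eq_square) (simp add: algebra_simps)
  moreover have "p\<^sup>2 / d > 0" using d \<open>p \<noteq> 0\<close> by simp
  moreover have "c / d - 2 < 0" using d by (simp add: field_simps)
  ultimately have "2 * (- p / d) * p + (- p / d)\<^sup>2 * c < 0"
    by (metis mult_pos_neg)
  then show False using assms[of "- p / d"] by linarith
qed

text \<open>Definiteness is left out because functions that agree almost everywhere stay distinct
  vectors in the application. Facts that would normally read \<open>x = 0\<close> therefore appear
  as \<open>q x x = 0\<close>.\<close>

locale psd_form =
  fixes q :: "'v::real_vector \<Rightarrow> 'v \<Rightarrow> real"
  assumes add_left: "q (x + y) z = q x z + q y z"
    and scale_left: "q (r *\<^sub>R x) y = r * q x y"
    and sym: "q x y = q y x"
    and nonneg: "0 \<le> q x x"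
begin

lemma add_right: "q z (x + y) = q z x + q z y" by (metis add_left sym)
lemma scale_right: "q y (r *\<^sub>R x) = r * q y x" by (metis scale_left sym)
lemma zero_left [simp]: "q 0 y = 0" using scale_left[of 0 0 y] by simp
lemma zero_right [simp]: "q y 0 = 0" by (metis zero_left sym)
lemma minus_left: "q (- x) y = - q x y" using scale_left[of "-1" x y] by simp
lemma minus_right: "q y (- x) = - q y x" by (metis minus_left sym)
lemma diff_left: "q (x - y) z = q x z - q y z"
  using add_left[of x "- y" z] by (simp add: minus_left)
lemma diff_right: "q z (x - y) = q z x - q z y" by (metis diff_left sym)
lemma sum_left: "q (\<Sum>i\<in>I. f i) y = (\<Sum>i\<in>I. q (f i) y)"
  by (induction I rule: infinite_finite_induct) (auto simp: add_left)
lemma sum_right: "q y (\<Sum>i\<in>I. f i) = (\<Sum>i\<in>I. q y (f i))"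
  by (induction I rule: infinite_finite_induct) (auto simp: add_right)

lemmas bilin = add_left add_right scale_left scale_right diff_left diff_right minus_left minus_right

lemma Cauchy_Schwarz: "(q x y)\<^sup>2 \<le> q x x * q y y"
proof (cases "q y y = 0")
  case True
  \<comment> \<open>A vector of length zero may be nonzero. Along it the quadratic degenerates to an
    affine function of \<open>t\<close>, and one that is bounded below is constant.\<close>
  have "0 \<le> 2 * t * q x y + t\<^sup>2 * 0 + q x x" for t
    using nonneg[of "x + t *\<^sub>R y"] True by (simp add: bilin sym[of y x] algebra_simps)
  then have *: "0 \<le> 2 * t * q x y + q x x" for t by simp
  have "q x y = 0"
  proof (rule ccontr)
    assume "q x y \<noteq> 0"
    then show False using *[of "- (q x x + 1) / (2 * q x y)"] by (simp add: field_simps)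
  qed
  then show ?thesis using True by simp
next
  case False
  then have pos: "q y y > 0" using nonneg[of y] by simp
  let ?t = "q x y / q y y"
  have "0 \<le> q (x - ?t *\<^sub>R y) (x - ?t *\<^sub>R y)" by (rule nonneg)
  also have "\<dots> = q x x - (q x y)\<^sup>2 / q y y"
    using False by (simp add: bilin sym[of y x] field_simps power2_eq_square)
  finally show ?thesis using pos by (simp add: field_simps)
qed

definition nrm :: "'v \<Rightarrow> real" where "nrm x = sqrt (q x x)"

lemma nrm_nonneg [simp]: "0 \<le> nrm x" by (simp add: nrm_def nonneg)
lemma nrm_sq: "(nrm x)\<^sup>2 = q x x" by (simp add: nrm_def nonneg)

lemma abs_le_nrm: "\<bar>q x y\<bar> \<le> nrm x * nrm y"
proof -
  have "sqrt ((q x y)\<^sup>2) \<le> sqrt (q x x * q y y)"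
    by (intro real_sqrt_le_mono Cauchy_Schwarz)
  then show ?thesis by (simp add: nrm_def real_sqrt_mult)
qed

lemma nrm_triangle: "nrm (x + y) \<le> nrm x + nrm y"
proof (rule power2_le_imp_le)
  have "(nrm (x + y))\<^sup>2 = q x x + 2 * q x y + q y y"
    by (simp add: nrm_sq bilin sym[of y x])
  also have "\<dots> \<le> (nrm x)\<^sup>2 + 2 * (nrm x * nrm y) + (nrm y)\<^sup>2"
    using abs_le_nrm[of x y] by (simp add: nrm_sq)
  finally show "(nrm (x + y))\<^sup>2 \<le> (nrm x + nrm y)\<^sup>2"
    by (simp add: power2_sum)
qed simp

lemma nrm_scale: "nrm (r *\<^sub>R x) = \<bar>r\<bar> * nrm x"
proof -
  have "q (r *\<^sub>R x) (r *\<^sub>R x) = r\<^sup>2 * q x x" by (simp add: bilin power2_eq_square)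
  then show ?thesis by (simp add: nrm_def real_sqrt_mult)
qed

lemma nrm_zero [simp]: "nrm 0 = 0" by (simp add: nrm_def)

lemma nrm_sum: "nrm (\<Sum>i\<in>I. f i) \<le> (\<Sum>i\<in>I. nrm (f i))"
proof (induction I rule: infinite_finite_induct)
  case (insert x F)
  then show ?case using nrm_triangle[of "f x" "sum f F"] by simp
qed auto

lemma parallelogram: "q (x - y) (x - y) = 2 * q x x + 2 * q y y - q (x + y) (x + y)"
  by (simp add: bilin)

lemma quad_add_le: "q (x + y) (x + y) \<le> 2 * q x x + 2 * q y y"
  using nonneg[of "x - y"] parallelogram[of x y] by simp

lemma quad_diff_commute: "q (x - y) (x - y) = q (y - x) (y - x)"
  by (simp add: bilin)

lemma tendsto_left:
  assumes "(\<lambda>n. q (x n - y) (x n - y)) \<longlonglongrightarrow> 0"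
  shows "(\<lambda>n. q (x n) v) \<longlonglongrightarrow> q y v"
proof -
  have "(\<lambda>n. nrm (x n - y)) \<longlonglongrightarrow> 0"
    unfolding nrm_def using tendsto_real_sqrt[OF assms] by simp
  then have "(\<lambda>n. nrm (x n - y) * nrm v) \<longlonglongrightarrow> 0" by (rule tendsto_mult_left_zero)
  then have "(\<lambda>n. q (x n) v - q y v) \<longlonglongrightarrow> 0"
    by (rule Lim_null_comparison[rotated]) (auto simp: abs_le_nrm simp flip: diff_left)
  then show ?thesis by (simp add: LIM_zero_iff)
qed

lemma tendsto_quad:
  assumes "(\<lambda>n. q (x n - y) (x n - y)) \<longlonglongrightarrow> 0"
  shows "(\<lambda>n. q (x n) (x n)) \<longlonglongrightarrow> q y y"
proof -
  have "q (x n) (x n) = q (x n - y) (x n - y) + 2 * q (x n) y - q y y" for n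
    by (simp add: bilin sym[of y "x n"])
  moreover have "(\<lambda>n. q (x n - y) (x n - y) + 2 * q (x n) y - q y y) \<longlonglongrightarrow> 0 + 2 * q y y - q y y"
    by (intro tendsto_intros assms tendsto_left)
  ultimately show ?thesis by simp
qed

end

locale form_pair = A: psd_form a + B: psd_form b
  for a b :: "'v::real_vector \<Rightarrow> 'v \<Rightarrow> real"
begin

text \<open>Cauchy sequences and limits refer to \<open>a\<close> alone; convergence in
  \<open>b\<close> follows from \<open>form_poincare\<close>, see \<open>tendsto_b\<close>.\<close>

definition form_complete :: "'v set \<Rightarrow> bool" where
  "form_complete T \<longleftrightarrow> (\<forall>x. (\<forall>n::nat. x n \<in> T) \<and>
     (\<forall>e>0. \<exists>M. \<forall>m\<ge>M. \<forall>n\<ge>M. a (x m - x n) (x m - x n) < e) \<longrightarrow>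
     (\<exists>y\<in>T. (\<lambda>n. a (x n - y) (x n - y)) \<longlonglongrightarrow> 0))"

text \<open>Rellich's property. It yields only \<open>b\<close>-Cauchy subsequences; limits come
  from \<open>form_complete\<close>.\<close>

definition form_compact :: "'v set \<Rightarrow> bool" where
  "form_compact T \<longleftrightarrow> (\<forall>x M. (\<forall>n::nat. x n \<in> T \<and> a (x n) (x n) \<le> M) \<longrightarrow>
     (\<exists>r::nat \<Rightarrow> nat. strict_mono r \<and>
       (\<forall>e>0. \<exists>M. \<forall>m\<ge>M. \<forall>n\<ge>M. b (x (r m) - x (r n)) (x (r m) - x (r n)) < e)))"

definition form_poincare :: "'v set \<Rightarrow> real \<Rightarrow> bool" where
  "form_poincare T C \<longleftrightarrow> C > 0 \<and> (\<forall>x\<in>T. b x x \<le> C * a x x)"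

text \<open>Guarantees that the successive choice of eigenvectors never runs out of
  candidates.\<close>

definition infinite_rank :: "'v set \<Rightarrow> bool" where
  "infinite_rank T \<longleftrightarrow> (\<forall>k. \<forall>e :: nat \<Rightarrow> 'v. \<exists>x\<in>T. (\<forall>i<k. b x (e i) = 0) \<and> b x x > 0)"

text \<open>The last clause takes the place of completeness of the eigenvectors: later expansions
  are cut off after finitely many terms, and it estimates the remainder.\<close>

definition eigensystem :: "'v set \<Rightarrow> (nat \<Rightarrow> 'v) \<Rightarrow> (nat \<Rightarrow> real) \<Rightarrow> bool" where
  "eigensystem T e l \<longleftrightarrow> mono l \<and> (\<forall>k. e k \<in> T) \<and>
     (\<forall>i j. b (e i) (e j) = (if i = j then 1 else 0)) \<and>
     (\<forall>k. \<forall>v\<in>T. a (e k) v = l k * b (e k) v) \<and>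
     (\<forall>k. \<forall>x\<in>T. (\<forall>i<k. b x (e i) = 0) \<longrightarrow> l k * b x x \<le> a x x)"

text \<open>Direct method: midpoints stay in \<open>T\<close>, so the parallelogram law makes a
  minimizing sequence for the distance to \<open>u\<close> an \<open>a\<close>-Cauchy sequence, and
  the first variation at its limit is the orthogonality.\<close>

lemma projection_exists:
  assumes T: "subspace T" "form_complete T"
  shows "\<exists>y\<in>T. \<forall>v\<in>T. a (u - y) v = 0"
proof -
  define J where "J = (\<lambda>x. a (u - x) (u - x))"
  define m where "m = Inf (J ` T)"
  have T0: "0 \<in> T" using T(1) by (rule subspace_0)
  have bdd: "bdd_below (J ` T)" unfolding J_def by (intro bdd_belowI[of _ 0]) (auto simp: A.nonneg)
  have m_le: "m \<le> J x" if "x \<in> T" for x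
    unfolding m_def using bdd that by (intro cInf_lower) auto
  have "\<exists>x\<in>T. J x < m + 1 / real (Suc n)" for n
    using cInf_lessD[of "J ` T" "m + 1 / real (Suc n)"] T0 unfolding m_def by auto
  then obtain x where x: "\<And>n. x n \<in> T" "\<And>n. J (x n) < m + 1 / real (Suc n)" by metis
  have par: "a (x i - x j) (x i - x j) \<le> 2 / real (Suc i) + 2 / real (Suc j)" for i j
  proof -
    let ?z = "(1/2) *\<^sub>R (x i + x j)"
    have "?z \<in> T" using x T(1) by (intro subspace_scale subspace_add)
    then have "m \<le> J ?z" by (rule m_le)
    moreover have "a (x i - x j) (x i - x j) = 2 * J (x i) + 2 * J (x j) - 4 * J ?z"
      unfolding J_def by (simp add: A.bilin A.sym algebra_simps)
    ultimately show ?thesis using x(2)[of i] x(2)[of j] by simp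
  qed
  have "\<exists>M. \<forall>i\<ge>M. \<forall>j\<ge>M. a (x i - x j) (x i - x j) < e" if e: "e > 0" for e
  proof -
    obtain M where M: "1 / real (Suc M) < e / 4" using nat_approx_posE[of "e/4"] e by auto
    show ?thesis
    proof (intro exI allI impI)
      fix i j assume ij: "i \<ge> M" "j \<ge> M"
      have "1 / real (Suc i) \<le> 1 / real (Suc M)" "1 / real (Suc j) \<le> 1 / real (Suc M)"
        using ij by (auto simp: field_simps)
      then show "a (x i - x j) (x i - x j) < e" using par[of i j] M by simp
    qed
  qed
  then obtain y where y: "y \<in> T" "(\<lambda>n. a (x n - y) (x n - y)) \<longlonglongrightarrow> 0"
    using T(2) x(1) unfolding form_complete_def by blast
  have "a (u - y) v = 0" if v: "v \<in> T" for v
  proof -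
    have "0 \<le> 2 * t * a (u - y) v + t\<^sup>2 * a v v" for t
    proof -
      have "0 \<le> 1 / real (Suc n) + (2 * t * (a u v - a (x n) v) + t\<^sup>2 * a v v)" for n
      proof -
        have "x n - t *\<^sub>R v \<in> T" using x v T(1) by (intro subspace_diff subspace_scale)
        then have "m \<le> J (x n - t *\<^sub>R v)" by (rule m_le)
        moreover have "J (x n - t *\<^sub>R v) = J (x n) + 2 * t * (a u v - a (x n) v) + t\<^sup>2 * a v v"
          unfolding J_def by (simp add: A.bilin A.sym algebra_simps power2_eq_square)
        ultimately show ?thesis using x(2)[of n] by linarith
      qed
      moreover have "(\<lambda>n. 1 / real (Suc n) + (2 * t * (a u v - a (x n) v) + t\<^sup>2 * a v v))
          \<longlonglongrightarrow> 0 + (2 * t * (a u v - a y v) + t\<^sup>2 * a v v)"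
        by (intro tendsto_intros A.tendsto_left y(2) LIMSEQ_Suc[OF lim_1_over_n])
      ultimately show ?thesis
        by (intro tendsto_lowerbound[where F = sequentially, of _ _ 0]) (auto simp: A.diff_left)
    qed
    then show ?thesis by (rule quadratic_nonneg_linear_zero)
  qed
  with y(1) show ?thesis by blast
qed

lemma tendsto_b:
  assumes P: "form_poincare T C" and T: "subspace T" and x: "\<And>n. x n \<in> T" "y \<in> T"
    and lim: "(\<lambda>n. a (x n - y) (x n - y)) \<longlonglongrightarrow> 0"
  shows "(\<lambda>n. b (x n - y) (x n - y)) \<longlonglongrightarrow> 0"
proof (rule tendsto_sandwich[OF _ _ tendsto_const])
  show "(\<lambda>n. C * a (x n - y) (x n - y)) \<longlonglongrightarrow> 0" using lim by (rule tendsto_mult_right_zero)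
  show "\<forall>\<^sub>F n in sequentially. b (x n - y) (x n - y) \<le> C * a (x n - y) (x n - y)"
    using P x T unfolding form_poincare_def by (intro always_eventually) (auto intro: subspace_diff)
qed (auto intro: always_eventually B.nonneg)

text \<open>Compactness makes a minimizing sequence only \<open>b\<close>-Cauchy. The parallelogram
  law, together with \<open>m * b x x \<le> a x x\<close> applied to sums of two members, upgrades
  this to \<open>a\<close>-Cauchy, and completeness then supplies the minimizer.\<close>

lemma rayleigh_minimizer_exists:
  assumes T: "subspace T" "form_complete T" "form_compact T" "form_poincare T C"
    and ex: "\<exists>x\<in>T. b x x > 0"
  shows "\<exists>e\<in>T. b e e = 1 \<and> (\<forall>x\<in>T. a e e * b x x \<le> a x x)"
proof -
  define R where "R = {a x x |x. x \<in> T \<and> b x x = 1}"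
  define m where "m = Inf R"
  have bdd: "bdd_below R" unfolding R_def by (intro bdd_belowI[of _ 0]) (auto simp: A.nonneg)
  have normal: "inverse (sqrt (b x x)) *\<^sub>R x \<in> T"
    "b (inverse (sqrt (b x x)) *\<^sub>R x) (inverse (sqrt (b x x)) *\<^sub>R x) = 1"
    "a (inverse (sqrt (b x x)) *\<^sub>R x) (inverse (sqrt (b x x)) *\<^sub>R x) = a x x / b x x"
    if "x \<in> T" "b x x > 0" for x
    using that T(1)
    by (auto simp: A.bilin B.bilin subspace_scale field_simps simp flip: power2_eq_square)
  have m_le: "m * b x x \<le> a x x" if x: "x \<in> T" for x
  proof (cases "b x x > 0")
    case True
    have "m \<le> a x x / b x x" unfolding m_def
      using normal[OF x True] by (intro cInf_lower bdd) (auto simp: R_def intro!: exI)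
    then show ?thesis using True by (simp add: field_simps)
  next
    case False
    then have "b x x = 0" using B.nonneg[of x] by simp
    then show ?thesis using A.nonneg by simp
  qed
  have "R \<noteq> {}" using ex normal unfolding R_def by blast
  then have "\<exists>x\<in>T. b x x = 1 \<and> a x x < m + 1 / real (Suc n)" for n
    using cInf_lessD[of R "m + 1 / real (Suc n)"] unfolding m_def R_def by auto
  then obtain x where x: "\<And>n. x n \<in> T" "\<And>n. b (x n) (x n) = 1"
    "\<And>n. a (x n) (x n) < m + 1 / real (Suc n)" by metis
  have "a (x n) (x n) \<le> m + 1" for n
  proof -
    have "1 / real (Suc n) \<le> 1" by simp
    then show ?thesis using x(3)[of n] by linarith
  qed
  then obtain r :: "nat \<Rightarrow> nat" where r: "strict_mono r"
    "\<And>e. e > 0 \<Longrightarrow> \<exists>M. \<forall>i\<ge>M. \<forall>j\<ge>M. b (x (r i) - x (r j)) (x (r i) - x (r j)) < e"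
    using T(3) x(1) unfolding form_compact_def by meson
  have m0: "m \<ge> 0" unfolding m_def using \<open>R \<noteq> {}\<close>
    by (intro cInf_greatest) (auto simp: R_def A.nonneg)
  have par: "a (x i - x j) (x i - x j)
      \<le> 2 * (1 / real (Suc i)) + 2 * (1 / real (Suc j)) + m * b (x i - x j) (x i - x j)" for i j
  proof -
    have "m * b (x i + x j) (x i + x j) \<le> a (x i + x j) (x i + x j)"
      using x T(1) by (intro m_le subspace_add)
    moreover have "b (x i + x j) (x i + x j) = 4 - b (x i - x j) (x i - x j)"
      using B.parallelogram[of "x i" "x j"] x(2) by simp
    ultimately have "4 * m - m * b (x i - x j) (x i - x j) \<le> a (x i + x j) (x i + x j)"
      by (simp add: algebra_simps)
    then show ?thesis using A.parallelogram[of "x i" "x j"] x(3)[of i] x(3)[of j] by simp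
  qed
  have "\<exists>M. \<forall>i\<ge>M. \<forall>j\<ge>M. a (x (r i) - x (r j)) (x (r i) - x (r j)) < e" if e: "e > 0" for e
  proof -
    obtain M where M: "1 / real (Suc M) < e / 8" using nat_approx_posE[of "e/8"] e by auto
    \<comment> \<open>The divisor uses \<open>m + 1\<close> because \<open>m\<close> may be zero;
      \<open>m\<close> times this bound is still at most \<open>e / 2\<close>.\<close>
    obtain M' where M': "\<forall>i\<ge>M'. \<forall>j\<ge>M'. b (x (r i) - x (r j)) (x (r i) - x (r j)) < e / (2 * (m + 1))"
      using r(2)[of "e / (2 * (m + 1))"] e m0 by auto
    show ?thesis
    proof (intro exI allI impI)
      fix i j assume ij: "i \<ge> max M M'" "j \<ge> max M M'"
      have "r i \<ge> M" "r j \<ge> M" using ij seq_suble[OF r(1), of i] seq_suble[OF r(1), of j] by auto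
      then have "1 / real (Suc (r i)) \<le> 1 / real (Suc M)" "1 / real (Suc (r j)) \<le> 1 / real (Suc M)"
        by (auto simp: field_simps)
      moreover have "m * b (x (r i) - x (r j)) (x (r i) - x (r j)) \<le> m * (e / (2 * (m + 1)))"
        using M' ij m0 by (intro mult_left_mono) (auto intro: less_imp_le)
      moreover have "m * (e / (2 * (m + 1))) \<le> e / 2" using m0 e by (simp add: field_simps)
      ultimately show "a (x (r i) - x (r j)) (x (r i) - x (r j)) < e"
        using par[of "r i" "r j"] M by linarith
    qed
  qed
  then obtain y where y: "y \<in> T" "(\<lambda>n. a (x (r n) - y) (x (r n) - y)) \<longlonglongrightarrow> 0"
    using T(2)[unfolded form_complete_def, rule_format, of "\<lambda>n. x (r n)"] x(1) by auto
  have "(\<lambda>n. b (x (r n)) (x (r n))) \<longlonglongrightarrow> b y y"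
    by (rule B.tendsto_quad, rule tendsto_b[OF T(4) T(1) x(1) y])
  then have by1: "b y y = 1" using x(2) LIMSEQ_unique[OF _ tendsto_const] by auto
  have "(\<lambda>n. a (x (r n)) (x (r n))) \<longlonglongrightarrow> a y y" by (rule A.tendsto_quad[OF y(2)])
  moreover have "(\<lambda>n. m + 1 / real (Suc (r n))) \<longlonglongrightarrow> m + 0"
    using LIMSEQ_subseq_LIMSEQ[OF LIMSEQ_Suc[OF lim_1_over_n] r(1)]
    by (intro tendsto_intros) (simp add: o_def)
  ultimately have "a y y \<le> m + 0"
    using x(3) by (intro tendsto_le[OF sequentially_bot]) (auto intro!: always_eventually less_imp_le)
  then have "a y y * b x x \<le> a x x" if "x \<in> T" for x
    using mult_right_mono[of "a y y" m "b x x"] m_le[OF that] B.nonneg[of x] by simp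
  then show ?thesis using y(1) by1 by blast
qed

text \<open>Orthogonality in \<open>b\<close> survives \<open>a\<close>-limits because the Poincare
  inequality turns them into \<open>b\<close>-limits. The next Rayleigh minimizer can thus be sought
  on the complement of the earlier ones.\<close>

lemma form_complete_orth:
  assumes T: "subspace T" "form_complete T" "form_poincare T C"
  shows "form_complete {x \<in> T. \<forall>i<k. b x (e i) = 0}"
  unfolding form_complete_def
proof (intro allI impI, elim conjE)
  fix x assume x: "\<forall>n::nat. x n \<in> {x \<in> T. \<forall>i<k. b x (e i) = 0}"
    and c: "\<forall>\<epsilon>>0. \<exists>M. \<forall>m\<ge>M. \<forall>n\<ge>M. a (x m - x n) (x m - x n) < \<epsilon>"
  then obtain y where y: "y \<in> T" "(\<lambda>n. a (x n - y) (x n - y)) \<longlonglongrightarrow> 0"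
    using T(2) unfolding form_complete_def by blast
  have "b y (e i) = 0" if "i < k" for i
  proof -
    have "(\<lambda>n. b (x n) (e i)) \<longlonglongrightarrow> b y (e i)"
      using x y T by (intro B.tendsto_left tendsto_b) auto
    then show ?thesis using x that LIMSEQ_unique[OF _ tendsto_const] by auto
  qed
  with y show "\<exists>y\<in>{x \<in> T. \<forall>i<k. b x (e i) = 0}. (\<lambda>n. a (x n - y) (x n - y)) \<longlonglongrightarrow> 0" by blast
qed

lemma eigensystem_exists:
  assumes T: "subspace T" "form_complete T" "form_compact T" "form_poincare T C" "infinite_rank T"
  shows "\<exists>e l. eigensystem T e l"
proof -
  define P where "P = (\<lambda>(f::nat \<Rightarrow> 'v) k r. r \<in> T \<and> (\<forall>i<k. b r (f i) = 0) \<and> b r r = 1 \<and>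
     (\<forall>x\<in>T. (\<forall>i<k. b x (f i) = 0) \<longrightarrow> a r r * b x x \<le> a x x))"
  \<comment> \<open>Each eigenvector is a Rayleigh minimizer on the \<open>b\<close>-complement of
    its predecessors, so the choice at stage \<open>k\<close> depends on all earlier
    choices.\<close>
  have "\<exists>f. \<forall>k. P f k (f k)"
  proof (rule dependent_wellorder_choice)
    fix r and f g :: "nat \<Rightarrow> 'v" and k assume "\<And>i. i < k \<Longrightarrow> f i = g i"
    then show "P f k r = P g k r" by (simp add: P_def)
  next
    fix k and f :: "nat \<Rightarrow> 'v"
    define U where "U = {x \<in> T. \<forall>i<k. b x (f i) = 0}"
    have "subspace U" using T(1) unfolding U_def subspace_def
      by (auto simp: B.bilin)
    moreover have "form_complete U" unfolding U_def using T by (intro form_complete_orth) auto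
    moreover have "form_compact U" using T(3) unfolding U_def form_compact_def by blast
    moreover have "form_poincare U C" using T(4) unfolding U_def form_poincare_def by blast
    moreover have "\<exists>x\<in>U. b x x > 0" using T(5) unfolding U_def infinite_rank_def by blast
    ultimately have "\<exists>e\<in>U. b e e = 1 \<and> (\<forall>x\<in>U. a e e * b x x \<le> a x x)"
      by (rule rayleigh_minimizer_exists)
    then show "\<exists>r. P f k r" unfolding P_def U_def by blast
  qed
  then obtain e where e: "\<And>k. P e k (e k)" by blast
  define l where "l = (\<lambda>k. a (e k) (e k))"
  have eT: "e k \<in> T" and e1: "b (e k) (e k) = 1" and eo: "i < k \<Longrightarrow> b (e k) (e i) = 0"
    and emin: "x \<in> T \<Longrightarrow> (\<forall>i<k. b x (e i) = 0) \<Longrightarrow> l k * b x x \<le> a x x" for i k x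
    using e[of k] by (auto simp: P_def l_def)
  have orth: "b (e i) (e j) = (if i = j then 1 else 0)" for i j
    using e1[of i] eo[of i j] eo[of j i] B.sym[of "e i" "e j"] by (cases i j rule: linorder_cases) auto
  have mono: "mono l"
  proof (rule mono_iff_le_Suc[THEN iffD2], intro allI)
    fix k show "l k \<le> l (Suc k)"
      using emin[of "e (Suc k)" k] eT eo[of _ "Suc k"] e1 by (auto simp: l_def)
  qed
  \<comment> \<open>Minimality gives the Euler-Lagrange equation only against vectors orthogonal to
    the earlier eigenvectors.\<close>
  have eig_tail: "a (e k) v = l k * b (e k) v" if v: "v \<in> T" "\<forall>i<k. b v (e i) = 0" for k v
  proof -
    have "0 \<le> 2 * t * (a (e k) v - l k * b (e k) v) + t\<^sup>2 * (a v v - l k * b v v)" for t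
    proof -
      have "l k * b (e k + t *\<^sub>R v) (e k + t *\<^sub>R v) \<le> a (e k + t *\<^sub>R v) (e k + t *\<^sub>R v)"
        using v eT eo T(1) by (intro emin subspace_add subspace_scale) (auto simp: B.bilin)
      moreover have "a (e k + t *\<^sub>R v) (e k + t *\<^sub>R v) = l k + 2 * t * a (e k) v + t\<^sup>2 * a v v"
        by (simp add: A.bilin A.sym[of v "e k"] l_def algebra_simps power2_eq_square)
      moreover have "b (e k + t *\<^sub>R v) (e k + t *\<^sub>R v) = 1 + 2 * t * b (e k) v + t\<^sup>2 * b v v"
        by (simp add: B.bilin B.sym[of v "e k"] e1 algebra_simps power2_eq_square)
      ultimately show ?thesis by (simp add: algebra_simps)
    qed
    then show ?thesis using quadratic_nonneg_linear_zero by fastforce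
  qed
  \<comment> \<open>Strong induction extends the equation to all of \<open>T\<close>: the part of
    \<open>v\<close> along an earlier \<open>e i\<close> contributes nothing, since the equation for
    \<open>e i\<close> and symmetry make \<open>e k\<close> and \<open>e i\<close> also
    \<open>a\<close>-orthogonal.\<close>
  have eig: "a (e k) v = l k * b (e k) v" if v: "v \<in> T" for k v
    using v
  proof (induction k arbitrary: v rule: less_induct)
    case (less k)
    define w where "w = v - (\<Sum>i<k. b v (e i) *\<^sub>R e i)"
    have "b w (e j) = 0" if "j < k" for j
      using that by (simp add: w_def B.bilin B.sum_left orth if_distrib[of "\<lambda>x. _ * x"] cong: if_cong)
    moreover have "w \<in> T" unfolding w_def
      using less.prems eT T(1) by (intro subspace_diff subspace_sum subspace_scale)
    ultimately have "a (e k) w = l k * b (e k) w" by (intro eig_tail) auto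
    moreover have "b (e k) w = b (e k) v"
      by (simp add: w_def B.bilin B.sum_right orth)
    moreover have "a (e k) w = a (e k) v"
    proof -
      have "a (e k) (e i) = 0" if "i < k" for i
        using less.IH[OF that eT, of k] that by (simp add: A.sym[of "e k"] orth)
      then show ?thesis by (simp add: w_def A.bilin A.sum_right)
    qed
    ultimately show ?case by simp
  qed
  show ?thesis unfolding eigensystem_def
    using mono eT orth eig emin by blast
qed

section \<open>Properties of an eigensystem\<close>

context
  fixes T e l assumes es: "eigensystem T e l"
begin

lemma eigensystem_mono: "i \<le> j \<Longrightarrow> l i \<le> l j"
  using es unfolding eigensystem_def by (auto dest: monoD)
lemma eigensystem_mem: "e k \<in> T" using es unfolding eigensystem_def by auto
lemma eigensystem_orth: "b (e i) (e j) = (if i = j then 1 else 0)"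
  using es unfolding eigensystem_def by auto
lemma eigensystem_eig: "v \<in> T \<Longrightarrow> a (e k) v = l k * b (e k) v"
  using es unfolding eigensystem_def by auto
lemma eigensystem_tail: "x \<in> T \<Longrightarrow> (\<And>i. i < k \<Longrightarrow> b x (e i) = 0) \<Longrightarrow> l k * b x x \<le> a x x"
  using es unfolding eigensystem_def by auto

lemma eigensystem_energy: "a (e i) (e j) = (if i = j then l i else 0)"
  using eigensystem_eig[OF eigensystem_mem, of i j] by (simp add: eigensystem_orth)

lemma eigensystem_positive:
  assumes "form_poincare T C" shows "l k > 0"
proof -
  have "1 \<le> C * l k"
    using assms eigensystem_mem[of k] unfolding form_poincare_def
    by (metis eigensystem_energy eigensystem_orth)
  moreover have "C > 0" using assms unfolding form_poincare_def by simp
  ultimately show ?thesis by (smt (verit) mult_nonneg_nonpos)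
qed

text \<open>Bounded eigenvalues would bound all \<open>e n\<close> in energy, yet distinct
  orthonormal vectors lie at squared \<open>b\<close>-distance 2, so no subsequence could be
  \<open>b\<close>-Cauchy.\<close>

lemma eigensystem_unbounded:
  assumes "form_compact T"
  shows "\<exists>k. l k > M"
proof (rule ccontr)
  assume "\<not> ?thesis"
  then have "\<forall>n. e n \<in> T \<and> a (e n) (e n) \<le> M"
    using eigensystem_mem eigensystem_energy by (simp add: not_less)
  then obtain r :: "nat \<Rightarrow> nat" where r: "strict_mono r"
    "\<And>\<epsilon>. \<epsilon> > 0 \<Longrightarrow> \<exists>M. \<forall>i\<ge>M. \<forall>j\<ge>M. b (e (r i) - e (r j)) (e (r i) - e (r j)) < \<epsilon>"
    using assms unfolding form_compact_def by meson
  from r(2)[of 1] obtain M where M: "\<forall>i\<ge>M. \<forall>j\<ge>M. b (e (r i) - e (r j)) (e (r i) - e (r j)) < 1"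
    by auto
  have "r M \<noteq> r (Suc M)" using r(1) by (simp add: strict_mono_eq)
  then have "b (e (r M) - e (r (Suc M))) (e (r M) - e (r (Suc M))) = 2"
    by (simp add: B.bilin eigensystem_orth)
  then show False using M[rule_format, of M "Suc M"] by simp
qed

lemma eigensystem_finite_fibre:
  assumes "form_compact T"
  shows "finite {k. l k = \<mu>}"
proof -
  obtain m where "l m > \<mu>" using eigensystem_unbounded[OF assms] by blast
  have "{k. l k = \<mu>} \<subseteq> {..m}"
  proof
    fix k assume "k \<in> {k. l k = \<mu>}"
    then have "\<not> m \<le> k" using \<open>l m > \<mu>\<close> eigensystem_mono[of m k] by auto
    then show "k \<in> {..m}" by simp
  qed
  then show ?thesis by (rule finite_subset) simp
qed

lemma eigensystem_eigenvector_orth: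
  assumes "x \<in> T" "\<And>v. v \<in> T \<Longrightarrow> a x v = \<mu> * b x v" "l k \<noteq> \<mu>"
  shows "b x (e k) = 0"
proof -
  have "l k * b x (e k) = \<mu> * b x (e k)"
    using assms(2)[OF eigensystem_mem[of k]] eigensystem_eig[OF assms(1), of k]
    by (metis A.sym B.sym)
  then show ?thesis using assms(3) by simp
qed

text \<open>Once its components in the fibre of \<open>\<mu>\<close> are removed, the vector still
  solves the equation and is \<open>b\<close>-orthogonal to every \<open>e k\<close>. The Rayleigh
  bound at an index with \<open>l m > \<mu>\<close> then forces its \<open>b\<close>-length to
  vanish.\<close>

lemma eigensystem_eigenspace_span:
  assumes T: "subspace T" "form_compact T"
    and x: "x \<in> T" "\<And>v. v \<in> T \<Longrightarrow> a x v = \<mu> * b x v"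
  defines "y \<equiv> x - (\<Sum>k\<in>{k. l k = \<mu>}. b x (e k) *\<^sub>R e k)"
  shows "b y y = 0"
proof -
  let ?I = "{k. l k = \<mu>}"
  have fin: "finite ?I" by (rule eigensystem_finite_fibre[OF T(2)])
  obtain m where m: "l m > \<mu>" using eigensystem_unbounded[OF T(2)] by blast
  have yT: "y \<in> T" unfolding y_def
    using x(1) eigensystem_mem T(1) by (intro subspace_diff subspace_sum subspace_scale)
  have "b y (e k) = 0" for k
  proof (cases "l k = \<mu>")
    case True
    then show ?thesis using fin
      by (simp add: y_def B.bilin B.sum_left eigensystem_orth if_distrib[of "\<lambda>x. _ * x"] cong: if_cong)
  next
    case False
    then have "b x (e k) = 0" using x by (intro eigensystem_eigenvector_orth) auto
    moreover have "(\<Sum>i\<in>?I. b (b x (e i) *\<^sub>R e i) (e k)) = 0"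
      using False by (intro sum.neutral) (auto simp: B.bilin eigensystem_orth)
    ultimately show ?thesis
      by (simp add: y_def B.bilin B.sum_left)
  qed
  then have "l m * b y y \<le> a y y" using yT by (intro eigensystem_tail) auto
  moreover have "a y v = \<mu> * b y v" if "v \<in> T" for v
    using that x(2) by (simp add: y_def A.bilin B.bilin A.sum_left B.sum_left eigensystem_eig
        algebra_simps sum_distrib_left)
  then have "a y y = \<mu> * b y y" using yT by blast
  ultimately have "(l m - \<mu>) * b y y \<le> 0" by (simp add: algebra_simps)
  then show ?thesis using m B.nonneg[of y] by (simp add: mult_le_0_iff)
qed

end
end

section \<open>Comparison of eigensystems, the Kato-Temple estimate and capacities\<close>

context form_pair
begin

lemma eigensystem_combination:
  assumes "eigensystem T e l" "finite I"
  shows "b (\<Sum>i\<in>I. c i *\<^sub>R e i) (\<Sum>i\<in>I. c i *\<^sub>R e i) = (\<Sum>i\<in>I. (c i)\<^sup>2)"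
    and "a (\<Sum>i\<in>I. c i *\<^sub>R e i) (\<Sum>i\<in>I. c i *\<^sub>R e i) = (\<Sum>i\<in>I. (c i)\<^sup>2 * l i)"
  using assms(2)
  by (simp_all add: A.sum_left B.sum_left A.sum_right B.sum_right A.bilin B.bilin
      eigensystem_orth[OF assms(1)] eigensystem_energy[OF assms(1)] if_distrib[of "\<lambda>x. _ * x"]
      power2_eq_square algebra_simps cong: if_cong)

text \<open>One half of min-max: a unit vector spanned by the first \<open>k + 1\<close>
  eigenvectors of \<open>T\<close> and orthogonal to the first \<open>k\<close> of \<open>S\<close>
  has energy at most \<open>l' k\<close>, and the Rayleigh bound of \<open>S\<close> applies to it
  because \<open>T \<subseteq> S\<close>.\<close>

lemma eigenvalue_antimono:
  assumes S: "eigensystem S e l" and T: "eigensystem T e' l'" "subspace T" "T \<subseteq> S"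
  shows "l k \<le> l' k"
proof -
  obtain c where c: "(\<Sum>j\<le>k. (c j)\<^sup>2) = 1" "\<forall>i<k. (\<Sum>j\<le>k. c j * b (e' j) (e i)) = 0"
    using exists_normalized_kernel[of k "\<lambda>i j. b (e' j) (e i)"] by auto
  define x where "x = (\<Sum>j\<le>k. c j *\<^sub>R e' j)"
  have "x \<in> T" unfolding x_def
    using T(2) eigensystem_mem[OF T(1)] by (intro subspace_sum subspace_scale)
  then have "l k * b x x \<le> a x x"
    using T(3) c(2) by (intro eigensystem_tail[OF S]) (auto simp: x_def B.sum_left B.bilin)
  also have "a x x = (\<Sum>j\<le>k. (c j)\<^sup>2 * l' j)"
    unfolding x_def by (simp add: eigensystem_combination[OF T(1)])
  also have "\<dots> \<le> (\<Sum>j\<le>k. (c j)\<^sup>2 * l' k)"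
    using eigensystem_mono[OF T(1)] by (intro sum_mono mult_left_mono) auto
  also have "\<dots> = l' k" using c(1) by (simp flip: sum_distrib_right)
  also have "b x x = 1" unfolding x_def by (simp add: eigensystem_combination[OF T(1)] c(1))
  finally show ?thesis by simp
qed

lemma poincare_nrm: "form_poincare S C \<Longrightarrow> x \<in> S \<Longrightarrow> B.nrm x \<le> sqrt C * A.nrm x"
  unfolding form_poincare_def B.nrm_def A.nrm_def by (simp flip: real_sqrt_mult)

text \<open>The opposite inequality with an error: the \<open>e i\<close> need not lie in
  \<open>T\<close>, so approximants \<open>f i\<close> replace them in the min-max argument, and
  \<open>s\<close> controls the energy distance between unit combinations of the two
  families.\<close>

lemma eigenvalue_upper_bound:
  assumes S: "eigensystem S e l" "subspace S" "form_poincare S C"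
    and T: "eigensystem T e' l'" "subspace T" "T \<subseteq> S"
    and f: "\<And>i. i \<le> k \<Longrightarrow> f i \<in> T"
    and s: "s = (\<Sum>i\<le>k. A.nrm (f i - e i))" "sqrt C * s < 1"
  shows "l' k * (1 - sqrt C * s)\<^sup>2 \<le> (sqrt (l k) + s)\<^sup>2"
proof -
  obtain c where c: "(\<Sum>j\<le>k. (c j)\<^sup>2) = 1" "\<forall>i<k. (\<Sum>j\<le>k. c j * b (f j) (e' i)) = 0"
    using exists_normalized_kernel[of k "\<lambda>i j. b (f j) (e' i)"] by auto
  \<comment> \<open>The coefficients make \<open>x\<close>, which lies in \<open>T\<close>,
    orthogonal to the first \<open>k\<close> eigenvectors of \<open>T\<close>. The same combination
    \<open>y\<close> of exact eigenvectors has \<open>b\<close>-norm 1 and energy at most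
    \<open>l k\<close>.\<close>
  define x where "x = (\<Sum>j\<le>k. c j *\<^sub>R f j)"
  define y where "y = (\<Sum>j\<le>k. c j *\<^sub>R e j)"
  have xT: "x \<in> T" unfolding x_def
    using T(2) f by (intro subspace_sum subspace_scale) auto
  have yS: "y \<in> S" unfolding y_def
    using S(2) eigensystem_mem[OF S(1)] by (intro subspace_sum subspace_scale) auto
  have C: "C > 0" using S(3) by (simp add: form_poincare_def)
  have xy: "x - y = (\<Sum>j\<le>k. c j *\<^sub>R (f j - e j))"
    by (simp add: x_def y_def scaleR_right_diff_distrib sum_subtractf)
  have cle: "\<bar>c j\<bar> \<le> 1" if "j \<le> k" for j
  proof -
    have "(c j)\<^sup>2 \<le> (\<Sum>j\<le>k. (c j)\<^sup>2)" using that by (intro member_le_sum) auto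
    then show ?thesis using c(1) by (simp add: abs_square_le_1)
  qed
  have d: "A.nrm (x - y) \<le> s"
  proof -
    have "A.nrm (x - y) \<le> (\<Sum>j\<le>k. \<bar>c j\<bar> * A.nrm (f j - e j))"
      unfolding xy using A.nrm_sum[of "\<lambda>j. c j *\<^sub>R (f j - e j)" "{..k}"] by (simp add: A.nrm_scale)
    also have "\<dots> \<le> (\<Sum>j\<le>k. 1 * A.nrm (f j - e j))"
      using cle by (intro sum_mono mult_right_mono) auto
    finally show ?thesis by (simp add: s(1))
  qed
  have "l' k * b x x \<le> a x x"
    using c(2) by (intro eigensystem_tail[OF T(1)] xT) (auto simp: x_def B.sum_left B.bilin)
  moreover have "a x x \<le> (sqrt (l k) + s)\<^sup>2"
  proof -
    have "a y y = (\<Sum>j\<le>k. (c j)\<^sup>2 * l j)"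
      unfolding y_def by (simp add: eigensystem_combination[OF S(1)])
    also have "\<dots> \<le> (\<Sum>j\<le>k. (c j)\<^sup>2 * l k)"
      using eigensystem_mono[OF S(1)] by (intro sum_mono mult_left_mono) auto
    finally have "a y y \<le> l k" using c(1) by (simp flip: sum_distrib_right)
    then have "A.nrm y \<le> sqrt (l k)" unfolding A.nrm_def by simp
    then have "A.nrm x \<le> sqrt (l k) + s"
      using A.nrm_triangle[of y "x - y"] d by simp
    then have "(A.nrm x)\<^sup>2 \<le> (sqrt (l k) + s)\<^sup>2" by (intro power_mono) auto
    then show ?thesis by (simp add: A.nrm_sq)
  qed
  moreover have "(1 - sqrt C * s)\<^sup>2 \<le> b x x"
  proof -
    have "B.nrm y = 1" unfolding B.nrm_def y_def by (simp add: eigensystem_combination[OF S(1)] c(1))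
    moreover have "B.nrm y \<le> B.nrm x + B.nrm (y - x)"
      using B.nrm_triangle[of x "y - x"] by simp
    moreover have "B.nrm (y - x) = B.nrm (x - y)"
      using B.nrm_scale[of "-1" "x - y"] by simp
    moreover have "B.nrm (x - y) \<le> sqrt C * A.nrm (x - y)"
      using xT T(3) yS S(2) by (intro poincare_nrm[OF S(3)] subspace_diff) auto
    moreover have "\<dots> \<le> sqrt C * s" using d C by (intro mult_left_mono) auto
    ultimately have "1 - sqrt C * s \<le> B.nrm x" by linarith
    then have "(1 - sqrt C * s)\<^sup>2 \<le> (B.nrm x)\<^sup>2" using s(2) by (intro power_mono) auto
    then show ?thesis by (simp add: B.nrm_sq)
  qed
  moreover have "l' k \<ge> 0"
    using eigensystem_energy[OF T(1), of k k] A.nonneg[of "e' k"] by simp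
  ultimately show ?thesis by (meson mult_left_mono order_trans)
qed

text \<open>Kato--Temple: \<open>\<psi> = u - V\<close> is split into its components below, at and above the \<open>j\<close>-th
  eigenvector; the residual \<open>\<mu> * b V\<close> controls the outer two because of the spectral gap.\<close>

lemma kato_temple:
  assumes S: "u \<in> S" "\<And>v. v \<in> S \<Longrightarrow> a u v = \<mu> * b u v" "b u u = 1" "\<mu> > 0"
    and T: "eigensystem T e l" "subspace T" "T \<subseteq> S"
    and V: "V \<in> S" "u - V \<in> T" "\<And>v. v \<in> T \<Longrightarrow> a V v = 0"
    and gap: "\<delta> > 0" "\<mu> + \<delta> \<le> l (Suc j)" "\<And>i. i < j \<Longrightarrow> l i \<le> \<mu> - \<delta>"
  shows "\<exists>s. \<bar>s * (l j - \<mu>) - a V V\<bar> \<le> (\<mu> + 2 * \<mu>\<^sup>2 / \<delta>) * b V V \<and>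
             \<bar>s - 1\<bar> \<le> 2 * a V V / \<mu> + (1 + 2 * \<mu>\<^sup>2 / \<delta>\<^sup>2) * b V V"
proof -
  define \<psi> where "\<psi> = u - V"
  define c where "c = (\<lambda>i. b \<psi> (e i))"
  define p where "p = (\<Sum>i<j. c i *\<^sub>R e i)"
  define r where "r = \<psi> - p - c j *\<^sub>R e j"
  define \<beta> where "\<beta> = B.nrm V"
  have \<beta>: "\<beta> \<ge> 0" "\<beta>\<^sup>2 = b V V" by (auto simp: \<beta>_def B.nrm_sq)
  note eT = eigensystem_mem[OF T(1)] and orth = eigensystem_orth[OF T(1)]
  have \<psi>T: "\<psi> \<in> T" using V(2) by (simp add: \<psi>_def)
  have pT: "p \<in> T" unfolding p_def using T(2) eT by (intro subspace_sum subspace_scale)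
  have rT: "r \<in> T" unfolding r_def using \<psi>T pT T(2) eT by (intro subspace_diff subspace_scale)
  \<comment> \<open>\<open>a V v\<close> vanishes on \<open>T\<close>, so \<open>\<psi>\<close>
    fails the equation for \<open>\<mu>\<close> only by the \<open>b\<close>-product with
    \<open>V\<close>.\<close>
  have res: "a \<psi> v - \<mu> * b \<psi> v = \<mu> * b V v" if "v \<in> T" for v
    using S(2)[of v] V(3)[OF that] that T(3) by (auto simp: \<psi>_def A.bilin B.bilin algebra_simps)
  \<comment> \<open>Orthogonality of \<open>V\<close> to \<open>u - V\<close> and the equation for
    \<open>u\<close> evaluate \<open>b u V\<close> exactly as \<open>a V V / \<mu>\<close>. Here the
    capacity enters the expansion to first order.\<close>
  have aVu: "a u V = a V V"
    using V(3)[OF V(2)] by (simp add: A.bilin A.sym[of V u])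
  then have bVu: "\<mu> * b u V = a V V" using S(2)[OF V(1)] by simp
  have b\<psi>: "b \<psi> \<psi> = 1 - 2 * a V V / \<mu> + b V V"
    using bVu S(3,4) by (simp add: \<psi>_def B.bilin B.sym[of V u] field_simps)
  have res\<psi>: "a \<psi> \<psi> - \<mu> * b \<psi> \<psi> = a V V - \<mu> * b V V"
    using res[OF \<psi>T] bVu by (simp add: \<psi>_def B.bilin B.sym[of V u] algebra_simps)
  have bpe: "b p (e i) = (if i < j then c i else 0)" for i
    by (simp add: p_def B.sum_left B.bilin orth if_distrib[of "\<lambda>x. _ * x"] cong: if_cong)
  have re: "b r (e i) = 0" if "i \<le> j" for i
    using that by (auto simp: r_def B.bilin bpe orth c_def)
  have are: "a r (e i) = 0" if "i \<le> j" for i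
    using eigensystem_eig[OF T(1) rT, of i] re[OF that] by (simp add: A.sym[of r] B.sym[of r])
  have brp: "b r p = 0" using re by (simp add: p_def B.sum_right B.bilin)
  have arp: "a r p = 0" using are by (simp add: p_def A.sum_right A.bilin)
  have bep: "b (e j) p = 0" "a (e j) p = 0"
    using eigensystem_eig[OF T(1) pT, of j] bpe[of j] by (auto simp: B.sym[of "e j" p])
  have \<psi>eq: "\<psi> = p + c j *\<^sub>R e j + r" by (simp add: r_def)
  have bpp: "b p p = (\<Sum>i<j. (c i)\<^sup>2)" and app: "a p p = (\<Sum>i<j. (c i)\<^sup>2 * l i)"
    unfolding p_def by (simp_all add: eigensystem_combination[OF T(1)])
  have bsum: "b \<psi> \<psi> = b p p + (c j)\<^sup>2 + b r r"
    unfolding \<psi>eq using re[of j] brp bep B.sym[of p r] B.sym[of p "e j"] B.sym[of "e j" r]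
    by (simp add: B.bilin orth power2_eq_square)
  have asum: "a \<psi> \<psi> = a p p + (c j)\<^sup>2 * l j + a r r"
    unfolding \<psi>eq using are[of j] arp bep A.sym[of p r] A.sym[of p "e j"] A.sym[of "e j" r]
    by (simp add: A.bilin eigensystem_energy[OF T(1)] power2_eq_square)
  have apsi: "a \<psi> p = a p p" "b \<psi> p = b p p" "a \<psi> r = a r r" "b \<psi> r = b r r"
    unfolding \<psi>eq using arp brp bep are[of j] re[of j] A.sym[of p r] B.sym[of p r]
      A.sym[of "e j" r] B.sym[of "e j" r]
    by (simp_all add: A.bilin B.bilin)
  \<comment> \<open>Meant for the outer components \<open>p\<close> and \<open>r\<close>, where the
    gap provides the premise. Cauchy-Schwarz bounds the component by a multiple of
    \<open>\<beta>\<close>, which in turn makes its product with the residual quadratic in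
    \<open>\<beta>\<close>.\<close>
  have gapbound: "B.nrm v \<le> \<mu> * \<beta> / \<delta> \<and> \<bar>\<mu> * b V v\<bar> \<le> \<mu>\<^sup>2 * \<beta>\<^sup>2 / \<delta>"
    if v: "\<delta> * b v v \<le> \<bar>\<mu> * b V v\<bar>" for v
  proof -
    have 1: "\<bar>\<mu> * b V v\<bar> \<le> \<mu> * (\<beta> * B.nrm v)"
      using B.abs_le_nrm[of V v] S(4) by (simp add: \<beta>_def abs_mult)
    then have "\<delta> * (B.nrm v * B.nrm v) \<le> \<mu> * \<beta> * B.nrm v"
      using v B.nrm_sq[of v] by (simp add: power2_eq_square)
    then have 2: "\<delta> * B.nrm v \<le> \<mu> * \<beta>"
    proof (cases "B.nrm v = 0")
      case False
      then have "B.nrm v > 0" using B.nrm_nonneg[of v] by linarith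
      moreover have "(\<delta> * B.nrm v) * B.nrm v \<le> (\<mu> * \<beta>) * B.nrm v"
        using \<open>\<delta> * (B.nrm v * B.nrm v) \<le> \<mu> * \<beta> * B.nrm v\<close> by (simp add: algebra_simps)
      ultimately show ?thesis by simp
    qed (use S(4) \<beta> in simp)
    then have 3: "B.nrm v \<le> \<mu> * \<beta> / \<delta>" using gap(1) by (simp add: field_simps)
    have "\<mu> * (\<beta> * B.nrm v) \<le> \<mu> * (\<beta> * (\<mu> * \<beta> / \<delta>))"
      using 3 S(4) \<beta>(1) by (intro mult_left_mono) auto
    also have "\<dots> = \<mu>\<^sup>2 * \<beta>\<^sup>2 / \<delta>" by (simp add: power2_eq_square)
    finally show ?thesis using 1 3 by simp
  qed
  have sq: "b v v \<le> \<mu>\<^sup>2 * \<beta>\<^sup>2 / \<delta>\<^sup>2" if "B.nrm v \<le> \<mu> * \<beta> / \<delta>" for v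
  proof -
    have "(B.nrm v)\<^sup>2 \<le> (\<mu> * \<beta> / \<delta>)\<^sup>2" using that by (intro power_mono) auto
    then show ?thesis by (simp add: B.nrm_sq power_mult_distrib power_divide)
  qed
  have p_gap: "a p p - \<mu> * b p p \<le> - (\<delta> * b p p)"
  proof -
    have "(\<Sum>i<j. (c i)\<^sup>2 * l i) \<le> (\<Sum>i<j. (c i)\<^sup>2 * (\<mu> - \<delta>))"
      using gap(3) by (intro sum_mono mult_left_mono) auto
    also have "\<dots> = (\<mu> - \<delta>) * (\<Sum>i<j. (c i)\<^sup>2)"
      by (simp add: sum_distrib_left mult.commute)
    finally show ?thesis unfolding app bpp by (simp add: algebra_simps)
  qed
  have Rp: "a p p - \<mu> * b p p = \<mu> * b V p" using res[OF pT] apsi by simp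
  have Rr: "a r r - \<mu> * b r r = \<mu> * b V r" using res[OF rT] apsi by simp
  have "l (Suc j) * b r r \<le> a r r"
    using re by (intro eigensystem_tail[OF T(1) rT]) auto
  moreover have "(\<mu> + \<delta>) * b r r \<le> l (Suc j) * b r r"
    using gap(2) B.nonneg by (intro mult_right_mono)
  ultimately have r_gap: "\<delta> * b r r \<le> a r r - \<mu> * b r r" by (simp add: algebra_simps)
  have 1: "B.nrm p \<le> \<mu> * \<beta> / \<delta> \<and> \<bar>\<mu> * b V p\<bar> \<le> \<mu>\<^sup>2 * \<beta>\<^sup>2 / \<delta>"
    using p_gap Rp by (intro gapbound) auto
  have 2: "B.nrm r \<le> \<mu> * \<beta> / \<delta> \<and> \<bar>\<mu> * b V r\<bar> \<le> \<mu>\<^sup>2 * \<beta>\<^sup>2 / \<delta>"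
    using r_gap Rr by (intro gapbound) auto
  \<comment> \<open>The factor \<open>s\<close> of the conclusion is \<open>(c j)\<^sup>2\<close>,
    the weight of \<open>\<psi>\<close> on the \<open>j\<close>-th eigenvector. Subtracting the
    contributions of \<open>p\<close> and \<open>r\<close> from the excess
    \<open>a - \<mu> b\<close> of \<open>\<psi>\<close> isolates it.\<close>
  have "(c j)\<^sup>2 * (l j - \<mu>) = a V V - \<mu> * b V V - \<mu> * b V p - \<mu> * b V r"
    using res\<psi> Rp Rr asum bsum by (simp add: algebra_simps)
  moreover have "\<mu> * b V V \<ge> 0" using S(4) B.nonneg by simp
  ultimately have "\<bar>(c j)\<^sup>2 * (l j - \<mu>) - a V V\<bar> \<le> \<mu> * b V V + \<mu>\<^sup>2 * \<beta>\<^sup>2 / \<delta> + \<mu>\<^sup>2 * \<beta>\<^sup>2 / \<delta>"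
    using 1 2 by linarith
  then have A: "\<bar>(c j)\<^sup>2 * (l j - \<mu>) - a V V\<bar> \<le> (\<mu> + 2 * \<mu>\<^sup>2 / \<delta>) * b V V"
    unfolding \<beta>(2) by (simp add: algebra_simps)
  have "(c j)\<^sup>2 - 1 = - (2 * a V V / \<mu>) + b V V - b p p - b r r"
    using b\<psi> bsum by simp
  moreover have "2 * a V V / \<mu> \<ge> 0" using S(4) A.nonneg by simp
  ultimately have "\<bar>(c j)\<^sup>2 - 1\<bar> \<le> 2 * a V V / \<mu> + b V V + \<mu>\<^sup>2 * \<beta>\<^sup>2 / \<delta>\<^sup>2 + \<mu>\<^sup>2 * \<beta>\<^sup>2 / \<delta>\<^sup>2"
    using sq[of p] sq[of r] 1 2 B.nonneg[of p] B.nonneg[of r] B.nonneg[of V] by linarith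
  then have "\<bar>(c j)\<^sup>2 - 1\<bar> \<le> 2 * a V V / \<mu> + (1 + 2 * \<mu>\<^sup>2 / \<delta>\<^sup>2) * b V V"
    unfolding \<beta>(2) by (simp add: algebra_simps)
  with A show ?thesis by blast
qed

definition form_capacity :: "'v set \<Rightarrow> 'v set \<Rightarrow> 'v \<Rightarrow> real" where
  "form_capacity S T u = Inf {a f f |f. f \<in> S \<and> f - u \<in> T}"

text \<open>Competitors differ by elements of \<open>T\<close>, so by Pythagoras the residual of
  projecting \<open>u\<close> onto \<open>T\<close> is the minimizer. The last clause bounds the
  capacity by the squared energy distance from \<open>u\<close> to any member of \<open>T\<close>;
  density makes it small through this.\<close>

lemma form_capacity_attained:
  assumes S: "subspace S" and T: "subspace T" "form_complete T" "T \<subseteq> S" and u: "u \<in> S"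
  obtains V where "V \<in> S" "u - V \<in> T" "\<And>v. v \<in> T \<Longrightarrow> a V v = 0" "form_capacity S T u = a V V"
    "\<And>f. f \<in> T \<Longrightarrow> a V V \<le> a (f - u) (f - u)"
proof -
  obtain y where y: "y \<in> T" "\<And>v. v \<in> T \<Longrightarrow> a (u - y) v = 0"
    using projection_exists[OF T(1,2)] by blast
  have min: "a (u - y) (u - y) \<le> a f f" if "f - u \<in> T" for f
  proof -
    have d: "f - (u - y) \<in> T" using subspace_add[OF T(1) that y(1)] by (simp add: algebra_simps)
    have "a f f = a (u - y) (u - y) + a (f - (u - y)) (f - (u - y))"
      using y(2)[OF d] A.sym[of f "u - y"] by (simp add: A.diff_right A.diff_left)
    then show ?thesis using A.nonneg[of "f - (u - y)"] by simp
  qed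
  have m: "u - y - u \<in> T" using subspace_neg[OF T(1) y(1)] by simp
  have uyS: "u - y \<in> S" using u y(1) T(3) S by (intro subspace_diff) auto
  have "form_capacity S T u = a (u - y) (u - y)" unfolding form_capacity_def
    using min m uyS by (intro cInf_eq_minimum) auto
  moreover have "a (u - y) (u - y) \<le> a (f - u) (f - u)" if "f \<in> T" for f
  proof -
    have "a (u - y) (u - y) \<le> a (u - f) (u - f)"
      using subspace_neg[OF T(1) that] by (intro min) simp
    then show ?thesis by (simp add: A.diff_left A.diff_right)
  qed
  ultimately show ?thesis using that[of "u - y"] y uyS by simp
qed

section \<open>Eigenvalue asymptotics along a family of approximating subspaces\<close>

context
  fixes S :: "'v set" and e l C F and T :: "'p \<Rightarrow> 'v set" and e' l'
  assumes S: "subspace S" "form_compact S" "form_poincare S C" "eigensystem S e l"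
    and T: "\<forall>\<^sub>F p in F. subspace (T p) \<and> T p \<subseteq> S \<and> form_complete (T p) \<and>
          eigensystem (T p) (e' p) (l' p)"
    and dense: "\<And>x \<eta>. x \<in> S \<Longrightarrow> \<eta> > 0 \<Longrightarrow> \<forall>\<^sub>F p in F. \<exists>f\<in>T p. a (f - x) (f - x) < \<eta>"
begin

lemma eventually_eigenvectors_approximated:
  assumes "\<eta> > 0"
  shows "\<forall>\<^sub>F p in F. \<exists>f. \<forall>i<k. f i \<in> T p \<and> A.nrm (f i - e i) < \<eta>"
proof -
  have "\<forall>\<^sub>F p in F. \<forall>i\<in>{..<k}. \<exists>f\<in>T p. a (f - e i) (f - e i) < \<eta>\<^sup>2"
    using assms by (intro eventually_ball_finite ballI dense eigensystem_mem[OF S(4)]) auto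
  then show ?thesis
  proof eventually_elim
    case (elim p)
    then obtain f where f: "\<forall>i\<in>{..<k}. f i \<in> T p \<and> a (f i - e i) (f i - e i) < \<eta>\<^sup>2" by metis
    have "sqrt x < \<eta>" if "x < \<eta>\<^sup>2" for x
      using that assms by (metis real_sqrt_less_iff real_sqrt_abs abs_of_pos)
    then show ?case using f unfolding A.nrm_def by (intro exI[of _ f]) auto
  qed
qed

lemma eventually_eigenvalue_le:
  assumes "\<delta> > 0"
  shows "\<forall>\<^sub>F p in F. l' p k \<le> l k + \<delta>"
proof -
  \<comment> \<open>\<open>s0 s < 0\<close> is what \<open>eigenvalue_upper_bound\<close> requires
    to give the claim. Since \<open>s0 0 = - \<delta>\<close>, continuity provides a range of
    admissible \<open>s\<close>.\<close>
  define s0 where "s0 = (\<lambda>s. (sqrt (l k) + s)\<^sup>2 - (l k + \<delta>) * (1 - sqrt C * s)\<^sup>2)"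
  have l: "l k > 0" by (rule eigensystem_positive[OF S(4,3)])
  have C: "C > 0" using S(3) by (simp add: form_poincare_def)
  have "(s0 \<longlongrightarrow> s0 0) (at_right 0)" unfolding s0_def
    by (intro tendsto_intros)
  moreover have "s0 0 < 0" using l assms by (simp add: s0_def)
  ultimately have "\<forall>\<^sub>F s in at_right 0. s0 s < 0" by (rule order_tendstoD)
  moreover have "((\<lambda>s. sqrt C * s) \<longlongrightarrow> sqrt C * 0) (at_right 0)"
    by (intro tendsto_intros)
  then have "\<forall>\<^sub>F s in at_right 0. sqrt C * s < 1"
    by (rule order_tendstoD) simp
  ultimately have "\<forall>\<^sub>F s in at_right 0. s0 s < 0 \<and> sqrt C * s < 1" by (rule eventually_conj)
  then obtain m where m: "m > 0" "\<And>s. 0 < s \<Longrightarrow> s < m \<Longrightarrow> s0 s < 0 \<and> sqrt C * s < 1"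
    unfolding eventually_at_right_field by auto
  \<comment> \<open>\<open>Suc k\<close> errors below \<open>\<eta>\<close> are to add up to less
    than \<open>m\<close>; the extra 1 makes this strict.\<close>
  define \<eta> where "\<eta> = m / (real (Suc k) + 1)"
  have \<eta>: "\<eta> > 0" using m by (simp add: \<eta>_def)
  from eventually_eigenvectors_approximated[OF \<eta>, of "Suc k"] T show ?thesis
  proof eventually_elim
    case (elim p)
    then obtain f where f: "\<And>i. i \<le> k \<Longrightarrow> f i \<in> T p" "\<And>i. i \<le> k \<Longrightarrow> A.nrm (f i - e i) < \<eta>"
      by (auto simp: less_Suc_eq_le)
    define s where "s = (\<Sum>i\<le>k. A.nrm (f i - e i))"
    have "s \<le> (\<Sum>i\<le>k. \<eta>)" unfolding s_def using f(2) by (intro sum_mono) (auto intro: less_imp_le)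
    also have "\<dots> = real (Suc k) * \<eta>" by simp
    also have "\<dots> < m" using m(1) unfolding \<eta>_def by (simp add: field_simps)
    finally have sm: "s < m" .
    have s_nn: "s \<ge> 0" unfolding s_def by (intro sum_nonneg) simp
    \<comment> \<open>A right neighbourhood of 0 omits the point itself, so exact approximation,
      \<open>s = 0\<close>, is a separate case.\<close>
    have s0: "s0 s < 0 \<and> sqrt C * s < 1"
    proof (cases "s = 0")
      case True
      then show ?thesis using \<open>s0 0 < 0\<close> by simp
    next
      case False
      then show ?thesis using m(2)[of s] s_nn sm by simp
    qed
    have "l' p k * (1 - sqrt C * s)\<^sup>2 \<le> (sqrt (l k) + s)\<^sup>2"
      using elim(2) f(1) s0
      by (intro eigenvalue_upper_bound[OF S(4,1,3), of "T p" "e' p" "l' p" k f s]) (auto simp: s_def)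
    also have "\<dots> < (l k + \<delta>) * (1 - sqrt C * s)\<^sup>2" using s0 by (simp add: s0_def)
    finally have "l' p k < l k + \<delta>"
      by (rule mult_right_less_imp_less) simp
    then show ?case by simp
  qed
qed

text \<open>On the \<open>a\<close>-orthogonal complement of \<open>T p\<close> the \<open>b\<close>-inner product with each of the
  first \<open>k\<close> eigenvectors is small, and the remaining part is controlled by \<open>1 / l k\<close>.\<close>

lemma eventually_orthogonal_small:
  assumes "\<eta> > 0"
  shows "\<forall>\<^sub>F p in F. \<forall>y\<in>S. (\<forall>v\<in>T p. a y v = 0) \<longrightarrow> b y y \<le> \<eta> * a y y"
proof -
  \<comment> \<open>Half of \<open>\<eta>\<close> pays for the part beyond the first
    \<open>k\<close> eigenvectors, half for the first \<open>k\<close> coefficients.\<close>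
  obtain k where k: "l k > 2 / \<eta>" using eigensystem_unbounded[OF S(4,2)] by blast
  have pos: "l i > 0" for i by (rule eigensystem_positive[OF S(4,3)])
  define M where "M = (\<Sum>i<k. 1 / (l i)\<^sup>2)"
  have M: "M \<ge> 0" unfolding M_def by (intro sum_nonneg) simp
  \<comment> \<open>Solves \<open>\<theta>\<^sup>2 * M \<le> \<eta> / 2\<close>; the added 1 covers
    \<open>M = 0\<close>.\<close>
  define \<theta> where "\<theta> = sqrt (\<eta> / (2 * (M + 1)))"
  have \<theta>: "\<theta> > 0" using assms M by (simp add: \<theta>_def)
  from eventually_eigenvectors_approximated[OF \<theta>, of k] show ?thesis
  proof eventually_elim
    case (elim p)
    then obtain f where f: "\<And>i. i < k \<Longrightarrow> f i \<in> T p" "\<And>i. i < k \<Longrightarrow> A.nrm (f i - e i) < \<theta>" by auto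
    show ?case
    proof (intro ballI impI)
      fix y assume y: "y \<in> S" "\<forall>v\<in>T p. a y v = 0"
      define z where "z = (\<Sum>i<k. b y (e i) *\<^sub>R e i)"
      have zS: "z \<in> S" unfolding z_def using S(1) eigensystem_mem[OF S(4)]
        by (intro subspace_sum subspace_scale) auto
      have wz: "b (y - z) (e i) = 0" if "i < k" for i
        using that by (simp add: z_def B.bilin B.sum_left eigensystem_orth[OF S(4)]
            if_distrib[of "\<lambda>x. _ * x"] cong: if_cong)
      have wS: "y - z \<in> S" using y zS S(1) by (intro subspace_diff) auto
      have awz: "a (y - z) (e i) = 0" if "i < k" for i
        using eigensystem_eig[OF S(4) wS, of i] wz[OF that] A.sym B.sym by (metis mult_zero_right)
      have bz0: "b (y - z) z = 0" unfolding z_def[of] B.sum_right using wz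
        by (intro sum.neutral) (auto simp: B.bilin z_def)
      have az0: "a (y - z) z = 0"
      proof -
        have "a (y - z) z = (\<Sum>i<k. b y (e i) * a (y - z) (e i))"
          by (subst (2) z_def) (simp add: A.sum_right A.scale_right)
        then show ?thesis using awz by simp
      qed
      have bdec: "b y y = b z z + b (y - z) (y - z)"
        using bz0 B.sym[of y z] by (simp add: B.diff_left B.diff_right)
      have adec: "a y y = a z z + a (y - z) (y - z)"
        using az0 A.sym[of y z] by (simp add: A.diff_left A.diff_right)
      have "l k * b (y - z) (y - z) \<le> a (y - z) (y - z)"
        using wz by (intro eigensystem_tail[OF S(4) wS]) auto
      also have "\<dots> \<le> a y y" using adec A.nonneg[of z] by simp
      finally have "b (y - z) (y - z) \<le> a y y / l k"
        using pos[of k] by (simp add: field_simps)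
      also have "\<dots> \<le> a y y * (\<eta> / 2)"
      proof -
        have "1 / l k \<le> \<eta> / 2" using k assms pos[of k] by (simp add: field_simps)
        then show ?thesis using A.nonneg[of y] mult_left_mono[of "1 / l k" "\<eta>/2" "a y y"] by simp
      qed
      finally have t1: "b (y - z) (y - z) \<le> a y y * (\<eta> / 2)" .
      have "(b y (e i))\<^sup>2 \<le> a y y * \<theta>\<^sup>2 * (1 / (l i)\<^sup>2)" if i: "i < k" for i
      proof -
        \<comment> \<open>Subtracting \<open>f i\<close> changes nothing since \<open>y\<close> is
          \<open>a\<close>-orthogonal to \<open>T p\<close>. The coefficient is thereby as small as
          the approximation error.\<close>
        have "l i * b y (e i) = a y (e i - f i)"
          using eigensystem_eig[OF S(4) y(1), of i] y(2) f(1)[OF i] A.sym[of y "e i"] B.sym[of y "e i"]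
          by (simp add: A.diff_right)
        then have "(l i * b y (e i))\<^sup>2 \<le> a y y * a (e i - f i) (e i - f i)"
          using A.Cauchy_Schwarz by simp
        also have "a (e i - f i) (e i - f i) = (A.nrm (f i - e i))\<^sup>2"
          by (simp add: A.nrm_sq A.diff_left A.diff_right)
        also have "\<dots> \<le> \<theta>\<^sup>2" using f(2)[OF i] by (intro power_mono) (auto intro: less_imp_le)
        finally have "(l i)\<^sup>2 * (b y (e i))\<^sup>2 \<le> a y y * \<theta>\<^sup>2"
          using A.nonneg[of y] by (simp add: power_mult_distrib mult_left_mono)
        then show ?thesis using pos[of i] by (simp add: field_simps)
      qed
      then have "(\<Sum>i<k. (b y (e i))\<^sup>2) \<le> (\<Sum>i<k. a y y * \<theta>\<^sup>2 * (1 / (l i)\<^sup>2))"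
        by (intro sum_mono) auto
      also have "\<dots> = a y y * (\<theta>\<^sup>2 * M)" by (simp add: M_def sum_distrib_left)
      also have "\<dots> \<le> a y y * (\<eta> / 2)"
        using assms M A.nonneg[of y] by (intro mult_left_mono) (auto simp: \<theta>_def field_simps)
      finally have t2: "b z z \<le> a y y * (\<eta> / 2)"
        unfolding z_def by (simp add: eigensystem_combination[OF S(4)])
      show "b y y \<le> \<eta> * a y y" using bdec t1 t2 by (simp add: algebra_simps)
    qed
  qed
qed

text \<open>\<open>kato_temple\<close> at each \<open>p\<close>, with constants independent of
  \<open>p\<close> because the gap \<open>\<delta>\<close> is uniform: eigenvalues above the
  \<open>j\<close>-th cannot drop below those of \<open>S\<close>, and the ones below it eventually
  rise by at most \<open>\<delta>\<close>.\<close>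

theorem eigenvalue_asymptotics:
  assumes simple: "\<And>k. l k = l j \<Longrightarrow> k = j"
    and u: "u \<in> S" "\<And>v. v \<in> S \<Longrightarrow> a u v = l j * b u v" "b u u = 1"
  shows "(\<lambda>p. l' p j - (l j + form_capacity S (T p) u)) \<in> o[F](\<lambda>p. form_capacity S (T p) u)"
proof (rule landau_o.smallI)
  fix \<kappa> :: real assume \<kappa>: "\<kappa> > 0"
  define \<mu> where "\<mu> = l j"
  have \<mu>: "\<mu> > 0" unfolding \<mu>_def by (rule eigensystem_positive[OF S(4,3)])
  have up: "l j < l (Suc j)"
    using eigensystem_mono[OF S(4), of j "Suc j"] simple[of "Suc j"] by (auto simp: less_le)
  \<comment> \<open>The factor 2 leaves a reserve: lower eigenvalues of \<open>T p\<close> may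
    exceed those of \<open>S\<close> by \<open>\<delta>\<close> and still lie
    \<open>\<delta>\<close> below \<open>\<mu>\<close>.\<close>
  have lo: "\<exists>d>0. \<forall>i<j. l i \<le> \<mu> - 2 * d"
  proof (cases j)
    case 0
    then show ?thesis by (intro exI[of _ 1]) auto
  next
    case (Suc i)
    have *: "l i < l j" using eigensystem_mono[OF S(4), of i j] simple[of i] Suc by (auto simp: less_le)
    have "l i' \<le> \<mu> - 2 * ((l j - l i) / 2)" if "i' < j" for i'
      using eigensystem_mono[OF S(4), of i' i] that Suc by (simp add: \<mu>_def field_simps)
    then show ?thesis using * by (intro exI[of _ "(l j - l i) / 2"]) simp
  qed
  then obtain d where d: "d > 0" "\<And>i. i < j \<Longrightarrow> l i \<le> \<mu> - 2 * d" by blast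
  define \<delta> where "\<delta> = min d (l (Suc j) - \<mu>)"
  have \<delta>: "\<delta> > 0" "\<And>i. i < j \<Longrightarrow> l i + \<delta> \<le> \<mu> - \<delta>" "\<mu> + \<delta> \<le> l (Suc j)"
    using d up by (force simp: \<delta>_def \<mu>_def min_def)+
  define M where "M = max (\<mu> + 2 * \<mu>\<^sup>2 / \<delta>) (1 + 2 * \<mu>\<^sup>2 / \<delta>\<^sup>2)"
  have M: "M > 0" "\<mu> + 2 * \<mu>\<^sup>2 / \<delta> \<le> M" "1 + 2 * \<mu>\<^sup>2 / \<delta>\<^sup>2 \<le> M"
    using \<mu> \<delta>(1) unfolding M_def by (auto simp: less_max_iff_disj add_pos_nonneg)
  \<comment> \<open>Makes the error \<open>M * (\<eta> * c)\<close> a quarter of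
    \<open>\<kappa> * c\<close>.\<close>
  define \<eta> where "\<eta> = \<kappa> / (4 * M)"
  have \<eta>: "\<eta> > 0" using \<kappa> M(1) by (simp add: \<eta>_def)
  define D where "D = 2 / \<mu> + M * \<eta>"
  have D: "D > 0" using \<mu> M(1) \<eta> by (simp add: D_def add_pos_pos)
  \<comment> \<open>For \<open>c < \<gamma>\<close> the first bound will give
    \<open>s \<ge> 1 / 2\<close> and the second
    \<open>\<bar>s - 1\<bar> \<le> \<kappa> / 4\<close>.\<close>
  define \<gamma> where "\<gamma> = min (1 / (2 * D)) (\<kappa> / (4 * D))"
  have \<gamma>: "\<gamma> > 0" using D \<kappa> by (simp add: \<gamma>_def)
  have below: "\<forall>\<^sub>F p in F. \<forall>i\<in>{..<j}. l' p i \<le> l i + \<delta>"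
    using \<delta>(1) by (intro eventually_ball_finite ballI eventually_eigenvalue_le) auto
  from T below eventually_orthogonal_small[OF \<eta>] dense[OF u(1) \<gamma>]
  show "\<forall>\<^sub>F p in F. norm (l' p j - (l j + form_capacity S (T p) u)) \<le> \<kappa> * norm (form_capacity S (T p) u)"
  proof eventually_elim
    case (elim p)
    then have Tp: "subspace (T p)" "T p \<subseteq> S" "form_complete (T p)" "eigensystem (T p) (e' p) (l' p)"
      by auto
    obtain V where V: "V \<in> S" "u - V \<in> T p" "\<And>v. v \<in> T p \<Longrightarrow> a V v = 0"
      "form_capacity S (T p) u = a V V" "\<And>f. f \<in> T p \<Longrightarrow> a V V \<le> a (f - u) (f - u)"
      using form_capacity_attained[OF S(1) Tp(1) Tp(3) Tp(2) u(1)] by blast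
    define c where "c = a V V"
    have c0: "c \<ge> 0" by (simp add: c_def A.nonneg)
    have small: "c < \<gamma>" using elim(4) V(5) unfolding c_def by fastforce
    have bV: "b V V \<le> \<eta> * c" using elim(3) V(1,3) unfolding c_def by blast
    have gap1: "\<mu> + \<delta> \<le> l' p (Suc j)"
      using \<delta>(3) eigenvalue_antimono[OF S(4) Tp(4,1,2), of "Suc j"] by simp
    have gap2: "l' p i \<le> \<mu> - \<delta>" if "i < j" for i
      using bspec[OF elim(2), of i] \<delta>(2)[OF that] that by simp
    obtain s where s: "\<bar>s * (l' p j - \<mu>) - c\<bar> \<le> (\<mu> + 2 * \<mu>\<^sup>2 / \<delta>) * b V V"
      "\<bar>s - 1\<bar> \<le> 2 * c / \<mu> + (1 + 2 * \<mu>\<^sup>2 / \<delta>\<^sup>2) * b V V"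
      using kato_temple[OF u(1,2,3) _ Tp(4,1,2) V(1,2,3) \<delta>(1) , of j] \<mu> gap1 gap2
      unfolding \<mu>_def c_def by blast
    have "(\<mu> + 2 * \<mu>\<^sup>2 / \<delta>) * b V V \<le> M * (\<eta> * c)"
      using M bV B.nonneg[of V] by (intro mult_mono) auto
    with s(1) have s1: "\<bar>s * (l' p j - \<mu>) - c\<bar> \<le> M * (\<eta> * c)" by simp
    have "(1 + 2 * \<mu>\<^sup>2 / \<delta>\<^sup>2) * b V V \<le> M * (\<eta> * c)"
      using M bV B.nonneg[of V] by (intro mult_mono) auto
    with s(2) have s2: "\<bar>s - 1\<bar> \<le> D * c" by (simp add: D_def algebra_simps)
    have "D * c \<le> D * (1 / (2 * D))" "D * c \<le> D * (\<kappa> / (4 * D))"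
      using small D by (intro mult_left_mono; simp add: \<gamma>_def)+
    then have Dc: "D * c \<le> 1 / 2" "D * c \<le> \<kappa> / 4" using D by simp_all
    have s_half: "s \<ge> 1 / 2" using s2 Dc(1) by linarith
    have "\<bar>s - 1\<bar> * c \<le> (\<kappa> / 4) * c" using s2 Dc c0 by (intro mult_right_mono) auto
    then have "\<bar>s - 1\<bar> * c \<le> \<kappa> * c / 4" by simp
    moreover have "M * (\<eta> * c) = \<kappa> * c / 4" using M(1) by (simp add: \<eta>_def)
    \<comment> \<open>Both terms on the right are at most \<open>\<kappa> * c / 4\<close>; dividing
      by \<open>s \<ge> 1 / 2\<close> then at most doubles their sum, to
      \<open>\<kappa> * c\<close>.\<close>
    moreover have "\<bar>s * (l' p j - (\<mu> + c))\<bar> \<le> \<bar>s * (l' p j - \<mu>) - c\<bar> + \<bar>s - 1\<bar> * c"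
    proof -
      have "s * (l' p j - (\<mu> + c)) = (s * (l' p j - \<mu>) - c) - (s - 1) * c" by (simp add: algebra_simps)
      then show ?thesis using c0 abs_triangle_ineq4[of "s * (l' p j - \<mu>) - c" "(s - 1) * c"]
        by (simp add: abs_mult)
    qed
    ultimately have "\<bar>s * (l' p j - (\<mu> + c))\<bar> \<le> \<kappa> * c / 2" using s1 by linarith
    then have "s * \<bar>l' p j - (\<mu> + c)\<bar> \<le> \<kappa> * c / 2" using s_half by (simp add: abs_mult)
    moreover have "1 / 2 * \<bar>l' p j - (\<mu> + c)\<bar> \<le> s * \<bar>l' p j - (\<mu> + c)\<bar>"
      using s_half by (intro mult_right_mono) auto
    ultimately have "\<bar>l' p j - (\<mu> + c)\<bar> \<le> \<kappa> * c" by simp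
    then show ?case using c0 by (simp add: V(4) c_def[symmetric] \<mu>_def)
  qed
qed

end
end

section \<open>Smooth cutoff functions\<close>

lemma frechet_derivative_eqI: "(f has_derivative f') (at x) \<Longrightarrow> frechet_derivative f (at x) = f'"
  by (metis frechet_derivative_at)

lemma C_k_continuous: "C_k k f \<Longrightarrow> continuous_on UNIV f"
  by (cases k) (auto simp: differentiable_imp_continuous_on)

lemma C_k_SucI:
  assumes "\<And>x. (f has_derivative f' x) (at x)" "\<And>b. b \<in> Basis \<Longrightarrow> C_k k (\<lambda>x. f' x b)"
  shows "C_k (Suc k) f"
proof -
  have "frechet_derivative f (at x) = f' x" for x using assms(1) by (rule frechet_derivative_eqI)
  moreover have "f differentiable_on UNIV"
    using assms(1) unfolding differentiable_on_def by (auto simp: differentiable_def)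
  ultimately show ?thesis using assms(2) by simp
qed

lemma C_k_Suc_has_derivative:
  "C_k (Suc k) f \<Longrightarrow> (f has_derivative frechet_derivative f (at x)) (at x)"
  by (auto simp: differentiable_on_def frechet_derivative_works)

lemma C_k_mono_Suc: "C_k (Suc k) f \<Longrightarrow> C_k k f"
proof (induction k arbitrary: f)
  case 0
  then show ?case by (simp add: differentiable_imp_continuous_on)
next
  case (Suc k)
  then show ?case by (subst C_k.simps, subst (asm) C_k.simps) blast
qed

lemma C_k_partial: "C_k (Suc k) f \<Longrightarrow> b \<in> Basis \<Longrightarrow> C_k k (\<lambda>x. frechet_derivative f (at x) b)"
  by simp

lemma C_k_const [simp]: "C_k k (\<lambda>x. c)"
  by (induction k arbitrary: c) auto

lemma C_k_add: "C_k k f \<Longrightarrow> C_k k g \<Longrightarrow> C_k k (\<lambda>x. f x + g x)"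
proof (induction k arbitrary: f g)
  case (Suc k)
  show ?case
    by (rule C_k_SucI[OF has_derivative_add[OF Suc.prems[THEN C_k_Suc_has_derivative]]])
       (use Suc in auto)
qed (auto intro: continuous_intros)

lemma C_k_mult: "C_k k f \<Longrightarrow> C_k k g \<Longrightarrow> C_k k (\<lambda>x. f x * g x)"
proof (induction k arbitrary: f g)
  case (Suc k)
  show ?case
    by (rule C_k_SucI[OF has_derivative_mult[OF Suc.prems[THEN C_k_Suc_has_derivative]]])
       (intro C_k_add Suc.IH Suc.prems[THEN C_k_mono_Suc] Suc.prems[THEN C_k_partial])
qed (auto intro: continuous_intros)

lemma C_k_minus: "C_k k f \<Longrightarrow> C_k k (\<lambda>x. - f x)"
  using C_k_mult[of k "\<lambda>_. -1" f] by simp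

lemma C_k_diff: "C_k k f \<Longrightarrow> C_k k g \<Longrightarrow> C_k k (\<lambda>x. f x - g x)"
  using C_k_add[OF _ C_k_minus, of k f g] by simp

lemma C_k_sum: "(\<And>i. i \<in> I \<Longrightarrow> C_k k (f i)) \<Longrightarrow> C_k k (\<lambda>x. \<Sum>i\<in>I. f i x)"
  by (induction I rule: infinite_finite_induct) (auto intro: C_k_add)

lemma C_k_inner: "C_k k (\<lambda>x. x \<bullet> v)"
proof (cases k)
  case (Suc m)
  show ?thesis unfolding Suc
    by (rule C_k_SucI[where f' = "\<lambda>x h. h \<bullet> v"])
       (auto intro: bounded_linear_imp_has_derivative bounded_linear_inner_left)
qed (auto intro: continuous_intros)

text \<open>The derivative is built from partial derivatives of \<open>g\<close> and from
  \<open>inverse g\<close> itself, required only at one order of smoothness less, so the induction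
  closes.\<close>

lemma C_k_inverse:
  assumes "\<And>x. g x \<noteq> 0" "C_k k g"
  shows "C_k k (\<lambda>x. inverse (g x))"
  using assms(2)
proof (induction k)
  case 0
  then show ?case using assms(1) by (auto intro: continuous_intros)
next
  case (Suc k)
  have "C_k k (\<lambda>x. inverse (g x))" using Suc C_k_mono_Suc by blast
  moreover have "C_k k (\<lambda>x. frechet_derivative g (at x) b)" if "b \<in> Basis" for b
    using Suc.prems that by simp
  ultimately show ?case
    by (intro C_k_SucI[OF Deriv.has_derivative_inverse[OF assms(1) C_k_Suc_has_derivative[OF Suc.prems]]]
        C_k_minus C_k_mult)
qed

text \<open>\<open>H\<close> is a whole chain of successive derivatives because the induction step
  at \<open>H n\<close> calls for the claim at \<open>H (Suc n)\<close>.\<close>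

lemma C_k_compose:
  fixes H :: "nat \<Rightarrow> real \<Rightarrow> real"
  assumes H: "\<And>n t. (H n has_real_derivative H (Suc n) t) (at t)"
    and "C_k k g"
  shows "C_k k (\<lambda>x. H n (g x))"
  using assms(2)
proof (induction k arbitrary: n)
  case 0
  have "continuous_on UNIV (H n)"
    using H DERIV_isCont by (blast intro: continuous_at_imp_continuous_on)
  then show ?case using 0 by (auto intro: continuous_on_compose2)
next
  case (Suc k)
  have "((\<lambda>x. H n (g x)) has_derivative (\<lambda>h. H (Suc n) (g x) * frechet_derivative g (at x) h)) (at x)"
    for x
    using has_derivative_compose[OF C_k_Suc_has_derivative[OF Suc.prems]
        H[THEN has_field_derivative_imp_has_derivative]] by simp
  then show ?case
    by (rule C_k_SucI) (intro C_k_mult Suc.IH Suc.prems[THEN C_k_mono_Suc] Suc.prems[THEN C_k_partial])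
qed

lemma smooth_imp_C_k: "smooth f \<Longrightarrow> C_k k f" by (simp add: smooth_def)

text \<open>The family \<open>flat p\<close> is closed under differentiation, which makes \<open>exp (- 1 / t)\<close> smooth at 0.\<close>

definition flat :: "real poly \<Rightarrow> real \<Rightarrow> real" where
  "flat p t = (if t > 0 then poly p (1 / t) * exp (- 1 / t) else 0)"

lemma poly_times_exp_tendsto_0: "((\<lambda>s. poly p s * exp (- s)) \<longlongrightarrow> 0) (at_top :: real filter)"
proof -
  have "((\<lambda>s::real. \<Sum>i\<le>degree p. coeff p i * (s ^ i / exp s)) \<longlongrightarrow> (\<Sum>i\<le>degree p. coeff p i * 0)) at_top"
    by (intro tendsto_intros tendsto_power_div_exp_0)
  then show ?thesis
    by (simp add: poly_altdef sum_distrib_right exp_minus divide_inverse mult.assoc)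
qed

text \<open>In the variable \<open>s = 1 / t\<close> differentiation produces the factor
  \<open>s\<^sup>2\<close>, which is \<open>monom 1 2\<close>; the exponential contributes
  \<open>p\<close> and the polynomial \<open>- pderiv p\<close>.\<close>

lemma has_derivative_flat:
  "(flat p has_real_derivative flat (monom 1 2 * (p - pderiv p)) t) (at t)"
proof (cases t "0::real" rule: linorder_cases)
  case less
  have "((\<lambda>_. 0) has_real_derivative 0) (at t)" by simp
  moreover have "eventually (\<lambda>x. x \<in> {..<0::real}) (nhds t)"
    using less by (intro eventually_nhds_in_open) auto
  then have "eventually (\<lambda>x. flat p x = 0) (nhds t)"
    by eventually_elim (simp add: flat_def)
  ultimately show ?thesis using less
    by (subst DERIV_cong_ev[OF refl _ refl, of _ "\<lambda>_. 0"]) (auto simp: flat_def)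
next
  case greater
  have "((\<lambda>t. poly p (1 / t) * exp (- 1 / t)) has_real_derivative
      (poly (pderiv p) (1 / t) * (- 1 / t\<^sup>2)) * exp (- 1 / t) +
      (exp (- 1 / t) * (1 / t\<^sup>2)) * poly p (1 / t)) (at t)"
    using greater
    by (auto intro!: derivative_eq_intros poly_DERIV[THEN DERIV_chain2] simp: power2_eq_square)
  moreover have "(poly (pderiv p) (1 / t) * (- 1 / t\<^sup>2)) * exp (- 1 / t) +
      (exp (- 1 / t) * (1 / t\<^sup>2)) * poly p (1 / t) = flat (monom 1 2 * (p - pderiv p)) t"
    using greater by (simp add: flat_def poly_monom field_simps)
  moreover have "eventually (\<lambda>x. x \<in> {0<..}) (nhds t)"
    using greater by (intro eventually_nhds_in_open) auto
  then have "eventually (\<lambda>x. flat p x = poly p (1 / x) * exp (- 1 / x)) (nhds t)"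
    by eventually_elim (simp add: flat_def)
  ultimately show ?thesis
    by (subst DERIV_cong_ev[OF refl _ refl, of _ "\<lambda>t. poly p (1 / t) * exp (- 1 / t)"]) auto
next
  case equal
  \<comment> \<open>\<open>pCons 0 p\<close> is \<open>p\<close> times the variable: the difference
    quotient at 0 only raises the degree in \<open>1 / h\<close> by one, and the exponential still
    wins.\<close>
  have "((\<lambda>h. poly (pCons 0 p) (inverse h) * exp (- inverse h)) \<longlongrightarrow> 0) (at_right 0)"
    using filterlim_compose[OF poly_times_exp_tendsto_0 filterlim_inverse_at_top_right] .
  moreover have "eventually (\<lambda>h::real. h \<in> {0<..}) (at_right 0)"
    by (simp add: eventually_at_right_less)
  then have "eventually (\<lambda>h. (flat p h - flat p 0) / h =
      poly (pCons 0 p) (inverse h) * exp (- inverse h)) (at_right 0)"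
    by eventually_elim (simp add: flat_def field_simps)
  ultimately have "((\<lambda>h. (flat p h - flat p 0) / h) \<longlongrightarrow> 0) (at_right 0)"
    by (simp add: tendsto_cong)
  moreover have "((\<lambda>h. (flat p h - flat p 0) / h) \<longlongrightarrow> 0) (at_left 0)"
    by (rule Lim_transform_eventually[OF tendsto_const])
       (auto simp: eventually_at_left_field flat_def intro!: exI[of _ "-1"])
  ultimately have "((\<lambda>h. (flat p h - flat p 0) / h) \<longlongrightarrow> 0) (at 0)"
    by (rule filterlim_split_at_real[rotated])
  then show ?thesis using equal by (simp add: DERIV_def flat_def)
qed

lemma C_k_flat_compose:
  assumes "C_k k g"
  shows "C_k k (\<lambda>x. flat p (g x))"
proof -
  define H where "H = (\<lambda>n. flat (((\<lambda>p. monom 1 2 * (p - pderiv p)) ^^ n) p))"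
  have "C_k k (\<lambda>x. H 0 (g x))"
    by (rule C_k_compose[OF _ assms]) (simp add: H_def has_derivative_flat)
  then show ?thesis by (simp add: H_def)
qed

lemma flat_1: "flat 1 t \<ge> 0" "flat 1 t > 0 \<longleftrightarrow> t > 0" "flat 1 t = 0 \<longleftrightarrow> t \<le> 0"
  by (auto simp: flat_def)

text \<open>A sum \<open>s\<close> of bumps over finitely many balls is at least some
  \<open>m > 0\<close> on \<open>K\<close>. The quotient of \<open>flat 1 s\<close> by
  \<open>flat 1 s + flat 1 (m / 2 - s)\<close> vanishes off the balls and is 1 wherever
  \<open>s > m / 2\<close>, an open neighbourhood of \<open>K\<close>.\<close>

lemma smooth_cutoff:
  fixes K U :: "'a::euclidean_space set"
  assumes "compact K" "open U" "K \<subseteq> U"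
  obtains \<eta> V where "\<eta> \<in> test_functions U" "\<And>x. 0 \<le> \<eta> x" "\<And>x. \<eta> x \<le> 1"
    "open V" "K \<subseteq> V" "\<And>x. x \<in> V \<Longrightarrow> \<eta> x = 1"
proof -
  have "\<exists>r>0. cball x r \<subseteq> U" if "x \<in> K" for x
    using assms that by (meson open_contains_cball subsetD)
  then obtain r where r: "\<And>x. x \<in> K \<Longrightarrow> r x > 0" "\<And>x. x \<in> K \<Longrightarrow> cball x (r x) \<subseteq> U" by metis
  obtain I where I: "I \<subseteq> K" "finite I" "K \<subseteq> (\<Union>x\<in>I. ball x (r x))"
    using compactE_image[OF assms(1), of K "\<lambda>x. ball x (r x)"] r(1) by force
  define s where "s = (\<lambda>y. \<Sum>x\<in>I. flat 1 ((r x)\<^sup>2 - (y - x) \<bullet> (y - x)))"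
  have ball_iff: "flat 1 ((r x)\<^sup>2 - (y - x) \<bullet> (y - x)) > 0 \<longleftrightarrow> y \<in> ball x (r x)" if "x \<in> I" for x y
  proof -
    have "r x > 0" using that I(1) r(1) by auto
    then have "(dist x y)\<^sup>2 < (r x)\<^sup>2 \<longleftrightarrow> dist x y < r x"
      by (metis less_imp_le power2_less_imp_less power_strict_mono zero_le_dist zero_less_numeral)
    then show ?thesis
      by (simp add: flat_1 dist_norm norm_minus_commute flip: power2_norm_eq_inner)
  qed
  have s_nonneg: "s y \<ge> 0" for y unfolding s_def by (intro sum_nonneg) (simp add: flat_1)
  have s_pos: "s y > 0 \<longleftrightarrow> y \<in> (\<Union>x\<in>I. ball x (r x))" for y
  proof -
    have "s y = 0 \<longleftrightarrow> (\<forall>x\<in>I. flat 1 ((r x)\<^sup>2 - (y - x) \<bullet> (y - x)) = 0)"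
      unfolding s_def using I(2) by (intro sum_nonneg_eq_0_iff) (auto simp: flat_1)
    then show ?thesis using s_nonneg[of y] ball_iff flat_1
      by (metis UN_iff less_le)
  qed
  have s_smooth: "C_k k s" for k
    unfolding s_def
  proof (intro C_k_sum C_k_flat_compose C_k_diff C_k_const)
    fix x :: 'a
    have "(\<lambda>y. (y - x) \<bullet> (y - x)) = (\<lambda>y. \<Sum>b\<in>Basis. (y \<bullet> b - x \<bullet> b) * (y \<bullet> b - x \<bullet> b))"
      by (subst euclidean_inner) (simp add: inner_diff_left)
    then show "C_k k (\<lambda>y. (y - x) \<bullet> (y - x))"
      by (simp only:) (intro C_k_sum C_k_mult C_k_diff C_k_inner C_k_const)
  qed
  have s_cont: "continuous_on A s" for A using C_k_continuous[OF s_smooth] continuous_on_subset by blast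
  obtain m where m: "m > 0" "\<And>y. y \<in> K \<Longrightarrow> s y \<ge> m"
  proof (cases "K = {}")
    case False
    then obtain z where z: "z \<in> K" "\<And>y. y \<in> K \<Longrightarrow> s z \<le> s y"
      using continuous_attains_inf[OF assms(1) False s_cont] by blast
    then show ?thesis using that[of "s z"] s_pos[of z] I(3) by blast
  qed (use that[of 1] in auto)
  define D where "D = (\<lambda>y. flat 1 (s y) + flat 1 (m / 2 - s y))"
  \<comment> \<open>At each point \<open>s y\<close> or \<open>m / 2 - s y\<close> is positive, so
    the denominator has no zero.\<close>
  have D: "D y > 0" for y
  proof (cases "s y > 0")
    case True
    then show ?thesis unfolding D_def by (simp add: add_pos_nonneg flat_1)
  next
    case False
    then show ?thesis unfolding D_def using m by (simp add: add_nonneg_pos flat_1)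
  qed
  define \<eta> where "\<eta> = (\<lambda>y. flat 1 (s y) * inverse (D y))"
  have smooth: "smooth \<eta>"
    unfolding smooth_def \<eta>_def
  proof (intro allI C_k_mult C_k_inverse C_k_flat_compose s_smooth)
    show "C_k k D" for k unfolding D_def
      by (intro C_k_add C_k_flat_compose C_k_diff s_smooth C_k_const)
    show "D x \<noteq> 0" for x using D[of x] by simp
  qed
  have "\<eta> y \<noteq> 0 \<Longrightarrow> y \<in> (\<Union>x\<in>I. cball x (r x))" for y
    using s_pos[of y] D[of y] flat_1(2)[of "s y"] flat_1(3)[of "s y"] unfolding \<eta>_def by fastforce
  then have "{y. \<eta> y \<noteq> 0} \<subseteq> (\<Union>x\<in>I. cball x (r x))" by blast
  moreover have cI: "compact (\<Union>x\<in>I. cball x (r x))" using I(2) by (intro compact_UN) auto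
  ultimately have cl: "closure {y. \<eta> y \<noteq> 0} \<subseteq> (\<Union>x\<in>I. cball x (r x))"
    by (intro closure_minimal compact_imp_closed)
  have "compact (closure {y. \<eta> y \<noteq> 0})"
    using cl cI by (metis closed_closure compact_Int_closed inf.absorb_iff2)
  moreover have "(\<Union>x\<in>I. cball x (r x)) \<subseteq> U" using r(2) I(1) by blast
  ultimately have "\<eta> \<in> test_functions U"
    using cl smooth unfolding test_functions_def by blast
  moreover have "0 \<le> \<eta> y" for y using D[of y] unfolding \<eta>_def by (simp add: flat_1)
  moreover have "\<eta> y \<le> 1" for y
    using D[of y] flat_1(1)[of "m / 2 - s y"] unfolding \<eta>_def by (simp add: field_simps D_def)
  moreover have "open {y. s y > m / 2}" using s_cont by (intro open_Collect_less continuous_intros) auto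
  moreover have "K \<subseteq> {y. s y > m / 2}" using m by force
  moreover have "\<eta> y = 1" if "y \<in> {y. s y > m / 2}" for y
  proof -
    have "flat 1 (m / 2 - s y) = 0" "flat 1 (s y) > 0"
      using that m(1) by (simp_all add: flat_1)
    then show ?thesis by (simp add: \<eta>_def D_def)
  qed
  ultimately show ?thesis using that[of \<eta> "{y. s y > m / 2}"] by blast
qed

section \<open>Gradients of test functions\<close>

definition grad :: "('a::euclidean_space \<Rightarrow> real) \<Rightarrow> 'a \<Rightarrow> 'a" where
  "grad f x = (\<Sum>b\<in>Basis. frechet_derivative f (at x) b *\<^sub>R b)"

lemma grad_inner_Basis: "b \<in> Basis \<Longrightarrow> grad f x \<bullet> b = frechet_derivative f (at x) b"
  by (simp add: grad_def inner_sum_left inner_Basis if_distrib[of "\<lambda>x. _ * x"] cong: if_cong)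

lemma frechet_derivative_eq_grad:
  assumes "f differentiable (at x)"
  shows "frechet_derivative f (at x) h = grad f x \<bullet> h"
proof -
  have lin: "linear (frechet_derivative f (at x))" by (rule linear_frechet_derivative[OF assms])
  have "frechet_derivative f (at x) h = frechet_derivative f (at x) (\<Sum>b\<in>Basis. (h \<bullet> b) *\<^sub>R b)"
    by (simp add: euclidean_representation)
  also have "\<dots> = (\<Sum>b\<in>Basis. (h \<bullet> b) * frechet_derivative f (at x) b)"
    by (simp add: linear_sum[OF lin] linear_scale[OF lin])
  also have "\<dots> = grad f x \<bullet> h"
    unfolding grad_def inner_sum_left by (intro sum.cong) (auto simp: inner_commute)
  finally show ?thesis .
qed

lemma C_k_has_derivative_grad:
  assumes "C_k (Suc k) f" shows "(f has_derivative (\<lambda>h. grad f x \<bullet> h)) (at x)"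
proof -
  have "(f has_derivative frechet_derivative f (at x)) (at x)" by (rule C_k_Suc_has_derivative[OF assms])
  moreover have "frechet_derivative f (at x) = (\<lambda>h. grad f x \<bullet> h)"
    using assms by (intro ext frechet_derivative_eq_grad) (simp add: differentiable_on_def)
  ultimately show ?thesis by simp
qed

lemma continuous_on_grad:
  assumes "C_k (Suc k) f" shows "continuous_on A (grad f)"
proof -
  have "continuous_on A (\<lambda>x. frechet_derivative f (at x) b)" if "b \<in> Basis" for b
    using C_k_continuous[OF C_k_partial[OF assms that]] by (rule continuous_on_subset) simp
  then show ?thesis unfolding grad_def[abs_def] by (intro continuous_on_sum continuous_on_scaleR) auto
qed

lemma grad_eqI:
  assumes "(f has_derivative (\<lambda>h. g \<bullet> h)) (at x)" shows "grad f x = g"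
  unfolding grad_def frechet_derivative_eqI[OF assms] by (simp add: euclidean_representation)

lemma grad_zero_on_open:
  assumes "open U" "x \<in> U" "\<And>y. y \<in> U \<Longrightarrow> f y = c"
  shows "grad f x = 0"
proof (rule grad_eqI)
  have "((\<lambda>_. c) has_derivative (\<lambda>h. 0)) (at x)" by simp
  then show "(f has_derivative (\<lambda>h. 0 \<bullet> h)) (at x)"
    unfolding inner_zero_left
    by (rule has_derivative_transform_within_open[OF _ assms(1,2)]) (use assms(3) in auto)
qed

lemma grad_mult:
  assumes "C_k (Suc k) f" "C_k (Suc k) g"
  shows "grad (\<lambda>x. f x * g x) x = f x *\<^sub>R grad g x + g x *\<^sub>R grad f x"
proof (rule grad_eqI)
  have "((\<lambda>x. f x * g x) has_derivative (\<lambda>h. f x * (grad g x \<bullet> h) + (grad f x \<bullet> h) * g x)) (at x)"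
    by (rule has_derivative_mult[OF assms[THEN C_k_has_derivative_grad]])
  then show "((\<lambda>x. f x * g x) has_derivative (\<lambda>h. (f x *\<^sub>R grad g x + g x *\<^sub>R grad f x) \<bullet> h)) (at x)"
    by (simp add: inner_add_left mult.commute)
qed

lemma grad_diff:
  assumes "C_k (Suc k) f" "C_k (Suc k) g"
  shows "grad (\<lambda>x. f x - g x) x = grad f x - grad g x"
proof (rule grad_eqI)
  show "((\<lambda>x. f x - g x) has_derivative (\<lambda>h. (grad f x - grad g x) \<bullet> h)) (at x)"
    unfolding inner_diff_left by (rule has_derivative_diff[OF assms[THEN C_k_has_derivative_grad]])
qed

lemma smoothI: "(\<And>k. C_k k f) \<Longrightarrow> smooth f" by (simp add: smooth_def)

lemma test_C_k: "\<phi> \<in> test_functions D \<Longrightarrow> C_k k \<phi>"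
  by (simp add: test_functions_def smooth_def)

lemma test_functions_mono: "D \<subseteq> D' \<Longrightarrow> test_functions D \<subseteq> test_functions D'"
  by (auto simp: test_functions_def)

lemma test_functionsI:
  assumes "smooth \<phi>" "compact K" "K \<subseteq> D" "\<And>x. \<phi> x \<noteq> 0 \<Longrightarrow> x \<in> K"
  shows "\<phi> \<in> test_functions D"
proof -
  have "closure {x. \<phi> x \<noteq> 0} \<subseteq> K"
    using assms(2,4) by (intro closure_minimal) (auto intro: compact_imp_closed)
  moreover from this have "compact (closure {x. \<phi> x \<noteq> 0})"
    using assms(2) by (metis closed_closure compact_Int_closed inf.absorb_iff2)
  ultimately show ?thesis using assms(1,3) unfolding test_functions_def by auto
qed

lemma test_functions_zero: "(\<lambda>x. 0) \<in> test_functions D"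
  by (rule test_functionsI[of _ "{}"]) (auto simp: smooth_def)

lemma test_functions_cmult:
  assumes "\<phi> \<in> test_functions D" shows "(\<lambda>x. c * \<phi> x) \<in> test_functions D"
proof (rule test_functionsI)
  show "compact (closure {x. \<phi> x \<noteq> 0})" "closure {x. \<phi> x \<noteq> 0} \<subseteq> D"
    using assms by (auto simp: test_functions_def)
  show "x \<in> closure {x. \<phi> x \<noteq> 0}" if "c * \<phi> x \<noteq> 0" for x
    using that closure_subset[of "{x. \<phi> x \<noteq> 0}"] by auto
qed (intro smoothI C_k_mult C_k_const test_C_k[OF assms])

lemma test_functions_add:
  assumes "\<phi> \<in> test_functions D" "\<psi> \<in> test_functions D"
  shows "(\<lambda>x. \<phi> x + \<psi> x) \<in> test_functions D"
proof (rule test_functionsI)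
  show "compact (closure {x. \<phi> x \<noteq> 0} \<union> closure {x. \<psi> x \<noteq> 0})"
    using assms by (intro compact_Un) (auto simp: test_functions_def)
  show "closure {x. \<phi> x \<noteq> 0} \<union> closure {x. \<psi> x \<noteq> 0} \<subseteq> D"
    using assms by (auto simp: test_functions_def)
  fix x assume "\<phi> x + \<psi> x \<noteq> 0"
  then have "x \<in> {x. \<phi> x \<noteq> 0} \<union> {x. \<psi> x \<noteq> 0}" by auto
  then show "x \<in> closure {x. \<phi> x \<noteq> 0} \<union> closure {x. \<psi> x \<noteq> 0}"
    using closure_subset[of "{x. \<phi> x \<noteq> 0}"] closure_subset[of "{x. \<psi> x \<noteq> 0}"] by blast
qed (intro smoothI C_k_add assms[THEN test_C_k])

lemma test_functions_diff:
  assumes "\<phi> \<in> test_functions D" "\<psi> \<in> test_functions D"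
  shows "(\<lambda>x. \<phi> x - \<psi> x) \<in> test_functions D"
proof -
  have "(\<lambda>x. \<phi> x - \<psi> x) = (\<lambda>x. \<phi> x + (- 1) * \<psi> x)" by auto
  then show ?thesis using test_functions_add[OF assms(1) test_functions_cmult[OF assms(2)]] by (simp only:)
qed

lemma test_functions_mult:
  assumes "\<phi> \<in> test_functions D" "smooth \<psi>"
  shows "(\<lambda>x. \<phi> x * \<psi> x) \<in> test_functions D"
proof (rule test_functionsI)
  show "compact (closure {x. \<phi> x \<noteq> 0})" "closure {x. \<phi> x \<noteq> 0} \<subseteq> D"
    using assms by (auto simp: test_functions_def)
  show "x \<in> closure {x. \<phi> x \<noteq> 0}" if "\<phi> x * \<psi> x \<noteq> 0" for x
    using that closure_subset[of "{x. \<phi> x \<noteq> 0}"] by auto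
qed (intro smoothI C_k_mult test_C_k[OF assms(1)] smooth_imp_C_k[OF assms(2)])

lemma test_support:
  assumes "\<phi> \<in> test_functions D" "x \<notin> closure {x. \<phi> x \<noteq> 0}"
  shows "\<phi> x = 0" "grad \<phi> x = 0"
proof -
  show "\<phi> x = 0" using assms(2) closure_subset[of "{x. \<phi> x \<noteq> 0}"] by auto
  show "grad \<phi> x = 0"
    using assms(2) closure_subset[of "{x. \<phi> x \<noteq> 0}"]
    by (intro grad_zero_on_open[of "- closure {x. \<phi> x \<noteq> 0}" _ _ 0]) auto
qed

lemma test_vanishes_outside:
  assumes "\<phi> \<in> test_functions D" "x \<notin> D" shows "\<phi> x = 0" "grad \<phi> x = 0"
proof -
  have "x \<notin> closure {x. \<phi> x \<noteq> 0}" using assms by (auto simp: test_functions_def)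
  then show "\<phi> x = 0" "grad \<phi> x = 0" by (rule test_support[OF assms(1)])+
qed

lemma test_bounded_support:
  assumes "\<phi> \<in> test_functions D"
  obtains R where "R > 0" "\<And>x. norm x \<ge> R \<Longrightarrow> \<phi> x = 0" "\<And>x. norm x \<ge> R \<Longrightarrow> grad \<phi> x = 0"
proof -
  have "bounded (closure {x. \<phi> x \<noteq> 0})"
    using assms by (auto simp: test_functions_def compact_imp_bounded)
  then obtain R where R: "R > 0" "\<And>x. x \<in> closure {x. \<phi> x \<noteq> 0} \<Longrightarrow> norm x \<le> R"
    by (auto simp: bounded_pos)
  have "x \<notin> closure {x. \<phi> x \<noteq> 0}" if "norm x \<ge> R + 1" for x using R(2)[of x] that by force
  then show ?thesis using that[of "R + 1"] R(1) test_support[OF assms] by (metis add_pos_pos zero_less_one)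
qed

section \<open>Integration by parts and translation estimates\<close>

lemma continuous_bounded_support_integrable:
  fixes g :: "'a::euclidean_space \<Rightarrow> 'b::{banach,second_countable_topology}"
  assumes "continuous_on UNIV g" "\<And>x. norm x \<ge> R \<Longrightarrow> g x = 0"
  shows "integrable lborel g"
proof -
  have "integrable lborel (\<lambda>x. indicator (cball 0 R) x *\<^sub>R g x)"
    using assms(1) by (intro borel_integrable_compact) (auto intro: continuous_on_subset)
  also have "(\<lambda>x. indicator (cball 0 R) x *\<^sub>R g x) = g"
    using assms(2) by (auto simp: indicator_def)
  finally show ?thesis .
qed

lemma test_square_integrable:
  assumes "\<phi> \<in> test_functions D"
  shows "square_integrable \<phi>" "square_integrable (grad \<phi>)"
proof -
  obtain R where R: "\<And>x. norm x \<ge> R \<Longrightarrow> \<phi> x = 0" "\<And>x. norm x \<ge> R \<Longrightarrow> grad \<phi> x = 0"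
    using test_bounded_support[OF assms] by metis
  have c: "continuous_on UNIV \<phi>" "continuous_on UNIV (grad \<phi>)"
    using test_C_k[OF assms] C_k_continuous continuous_on_grad by blast+
  show "square_integrable \<phi>" "square_integrable (grad \<phi>)"
    unfolding square_integrable_def
    using c R by (auto intro!: continuous_bounded_support_integrable[of _ R] borel_measurable_continuous_onI
        continuous_intros)
qed

lemma lborel_integral_translation:
  fixes f :: "'a::euclidean_space \<Rightarrow> 'b::{banach,second_countable_topology}"
  assumes [measurable]: "f \<in> borel_measurable borel"
  shows "(LINT x|lborel. f (x + c)) = (LINT x|lborel. f x)"
proof -
  have "(LINT x|lborel. f x) = (LINT x|distr lborel borel ((+) c). f x)"
    by (simp add: lborel_distr_plus)
  also have "\<dots> = (LINT x|lborel. f (c + x))" by (rule integral_distr) auto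
  finally show ?thesis by (simp add: add.commute)
qed

lemma lborel_nn_integral_translation:
  fixes c :: "'a::euclidean_space"
  assumes [measurable]: "f \<in> borel_measurable borel"
  shows "(\<integral>\<^sup>+x. f (x + c) \<partial>lborel) = (\<integral>\<^sup>+x. f x \<partial>lborel)"
proof -
  have "(\<integral>\<^sup>+x. f x \<partial>lborel) = (\<integral>\<^sup>+x. f x \<partial>distr lborel borel ((+) c))"
    by (simp add: lborel_distr_plus)
  also have "\<dots> = (\<integral>\<^sup>+x. f (c + x) \<partial>lborel)" by (rule nn_integral_distr) auto
  finally show ?thesis by (simp add: add.commute)
qed

lemma C1_increment:
  assumes "C_k (Suc k) f"
  shows "(LINT t|lborel. indicator {0..1} t *\<^sub>R (grad f (x + t *\<^sub>R w) \<bullet> w)) = f (x + w) - f x"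
proof -
  have "(LINT t|lborel. indicator {0..1} t *\<^sub>R (grad f (x + t *\<^sub>R w) \<bullet> w)) = f (x + 1 *\<^sub>R w) - f (x + 0 *\<^sub>R w)"
  proof (rule integral_FTC_Icc)
    fix t :: real
    have "((\<lambda>t. f (x + t *\<^sub>R w)) has_derivative (\<lambda>h. grad f (x + t *\<^sub>R w) \<bullet> (h *\<^sub>R w))) (at t)"
      by (rule has_derivative_compose[OF _ C_k_has_derivative_grad[OF assms]])
         (auto intro!: derivative_eq_intros)
    then show "((\<lambda>t. f (x + t *\<^sub>R w)) has_vector_derivative grad f (x + t *\<^sub>R w) \<bullet> w) (at t within {0..1})"
      by (simp add: has_vector_derivative_def has_derivative_at_withinI)
  next
    show "continuous_on {0..1} (\<lambda>t. grad f (x + t *\<^sub>R w) \<bullet> w)"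
      by (intro continuous_intros continuous_on_compose2[OF continuous_on_grad[OF assms, of UNIV]]) auto
  qed simp
  then show ?thesis by simp
qed

text \<open>By translation invariance \<open>f (x + w) - f x\<close> integrates to zero. Written as
  an integral of the derivative along the segment and exchanged by Fubini, it has slices that all
  share the same integral, which must therefore vanish.\<close>

lemma integral_partial_derivative_zero:
  fixes f :: "'a::euclidean_space \<Rightarrow> real"
  assumes C: "C_k (Suc k) f" and R: "\<And>x. norm x \<ge> R \<Longrightarrow> f x = 0" "\<And>x. norm x \<ge> R \<Longrightarrow> grad f x = 0"
  shows "(LINT x|lborel. grad f x \<bullet> w) = 0"
proof -
  define G where "G = (\<lambda>x (t::real). indicator {0..1} t *\<^sub>R (grad f (x + t *\<^sub>R w) \<bullet> w))"
  have cont: "continuous_on A (grad f)" for A by (rule continuous_on_grad[OF C])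
  have cf: "continuous_on UNIV f" using C by (rule C_k_continuous)
  \<comment> \<open>A compact set carrying the integrand: for \<open>t \<le> 1\<close> the shift by
    \<open>t *\<^sub>R w\<close> moves the support by at most \<open>norm w\<close>.\<close>
  let ?S = "cball 0 (R + norm w) \<times> {0..1::real}"
  have "integrable lborel (\<lambda>z. indicator ?S z *\<^sub>R (grad f (fst z + snd z *\<^sub>R w) \<bullet> w))"
    by (intro borel_integrable_compact compact_Times compact_cball compact_Icc continuous_intros
        continuous_on_compose2[OF cont[of UNIV]]) auto
  also have "(\<lambda>z. indicator ?S z *\<^sub>R (grad f (fst z + snd z *\<^sub>R w) \<bullet> w)) = case_prod G"
  proof (rule ext, clarify)
    fix x :: 'a and t :: real
    have "grad f (x + t *\<^sub>R w) = 0" if "norm x > R + norm w" "t \<in> {0..1}"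
    proof (rule R(2))
      have "norm x \<le> norm (x + t *\<^sub>R w) + norm (t *\<^sub>R w)" 
        using norm_triangle_ineq4[of "x + t *\<^sub>R w" "t *\<^sub>R w"] by simp
      moreover have "norm (t *\<^sub>R w) \<le> norm w" using that by (simp add: mult_left_le_one_le)
      ultimately show "R \<le> norm (x + t *\<^sub>R w)" using that(1) by linarith
    qed
    then show "indicator ?S (x, t) *\<^sub>R (grad f (fst (x, t) + snd (x, t) *\<^sub>R w) \<bullet> w) = G x t"
      by (auto simp: G_def indicator_def not_le)
  qed
  finally have int: "integrable (lborel \<Otimes>\<^sub>M lborel) (case_prod G)" by (simp add: lborel_prod)
  have [measurable]: "grad f \<in> borel_measurable borel" "f \<in> borel_measurable borel"
    using cont cf by (auto intro: borel_measurable_continuous_onI)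
  have "integrable lborel f" using cf R(1) by (rule continuous_bounded_support_integrable)
  moreover have "integrable lborel (\<lambda>x. f (x + w))"
  proof (rule continuous_bounded_support_integrable)
    show "continuous_on UNIV (\<lambda>x. f (x + w))"
      by (intro continuous_on_compose2[OF cf] continuous_intros) auto
    fix x :: 'a assume "norm x \<ge> R + norm w"
    then show "f (x + w) = 0" using norm_triangle_ineq4[of "x + w" w] by (intro R(1)) simp
  qed
  ultimately have "(LINT x|lborel. f (x + w) - f x) = 0"
    by (simp add: lborel_integral_translation)
  moreover have "(LINT x|lborel. f (x + w) - f x) = (LINT x|lborel. LINT t|lborel. G x t)"
    unfolding G_def C1_increment[OF C] ..
  moreover have "\<dots> = (LINT t|lborel. LINT x|lborel. G x t)"
    using lborel_pair.Fubini_integral[OF int] by simp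
  moreover have "(LINT x|lborel. G x t) = indicator {0..1} t *\<^sub>R (LINT x|lborel. grad f x \<bullet> w)" for t
    unfolding G_def using lborel_integral_translation[of "\<lambda>x. grad f x \<bullet> w" "t *\<^sub>R w"] by simp
  ultimately show ?thesis by simp
qed

text \<open>Integration by parts, from the vanishing integrals of the partial derivatives of the
  product of \<open>\<phi>\<close> and \<open>\<psi>\<close>.\<close>

lemma test_weak_gradient:
  assumes \<phi>: "\<phi> \<in> test_functions D"
  shows "is_weak_gradient \<phi> (grad \<phi>)"
  unfolding is_weak_gradient_def
proof (intro ballI)
  fix \<psi> :: "'a \<Rightarrow> real" and b :: 'a assume \<psi>: "\<psi> \<in> test_functions UNIV" and b: "b \<in> Basis"
  have \<phi>\<psi>: "(\<lambda>x. \<phi> x * \<psi> x) \<in> test_functions D"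
    using \<phi> \<psi> by (intro test_functions_mult) (auto simp: test_functions_def)
  obtain R where R: "\<And>x. norm x \<ge> R \<Longrightarrow> \<phi> x = 0" "\<And>x. norm x \<ge> R \<Longrightarrow> grad \<phi> x = 0"
    using test_bounded_support[OF \<phi>] by metis
  obtain R' where R': "\<And>x. norm x \<ge> R' \<Longrightarrow> \<phi> x * \<psi> x = 0" "\<And>x. norm x \<ge> R' \<Longrightarrow> grad (\<lambda>x. \<phi> x * \<psi> x) x = 0"
    using test_bounded_support[OF \<phi>\<psi>] by metis
  have cont: "continuous_on UNIV \<phi>" "continuous_on UNIV (grad \<phi>)" "continuous_on UNIV \<psi>" "continuous_on UNIV (grad \<psi>)"
    using test_C_k[OF \<phi>] test_C_k[OF \<psi>] C_k_continuous continuous_on_grad by blast+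
  have "(LINT x|lborel. grad (\<lambda>x. \<phi> x * \<psi> x) x \<bullet> b) = 0"
    by (rule integral_partial_derivative_zero[OF test_C_k[OF \<phi>\<psi>] R'])
  moreover have "grad (\<lambda>x. \<phi> x * \<psi> x) x \<bullet> b = \<phi> x * (grad \<psi> x \<bullet> b) + (grad \<phi> x \<bullet> b) * \<psi> x" for x
    by (simp add: grad_mult[OF test_C_k[OF \<phi>] test_C_k[OF \<psi>]] inner_add_left algebra_simps)
  moreover have "integrable lborel (\<lambda>x. \<phi> x * (grad \<psi> x \<bullet> b))" "integrable lborel (\<lambda>x. (grad \<phi> x \<bullet> b) * \<psi> x)"
    using R cont by (auto intro!: continuous_bounded_support_integrable[of _ R] continuous_intros)
  ultimately show "(LINT x|lborel. \<phi> x * frechet_derivative \<psi> (at x) b) = - (LINT x|lborel. (grad \<phi> x \<bullet> b) * \<psi> x)"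
    using b by (simp add: grad_inner_Basis)
qed

text \<open>Jensen on the unit interval: the squared deviation from the mean \<open>m\<close> has a
  nonnegative integral.\<close>

lemma square_integral_unit_le:
  fixes g :: "real \<Rightarrow> real"
  assumes "continuous_on {0..1} g"
  shows "(LINT t|lborel. indicator {0..1} t *\<^sub>R g t)\<^sup>2 \<le> (LINT t|lborel. indicator {0..1} t *\<^sub>R (g t)\<^sup>2)"
proof -
  let ?I = "\<lambda>g::real\<Rightarrow>real. LINT t|lborel. indicator {0..1} t *\<^sub>R g t"
  define m where "m = ?I g"
  have int: "integrable lborel (\<lambda>t. indicator {0..1::real} t *\<^sub>R h t)" if "continuous_on {0..1} h" for h :: "real \<Rightarrow> real"
    using that by (intro borel_integrable_compact) auto
  have "0 \<le> ?I (\<lambda>t. (g t - m)\<^sup>2)" by (intro Bochner_Integration.integral_nonneg) auto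
  also have "?I (\<lambda>t. (g t - m)\<^sup>2) = (LINT t|lborel. indicator {0..1} t *\<^sub>R (g t)\<^sup>2 - 2 * m * (indicator {0..1} t *\<^sub>R g t) + m\<^sup>2 * (indicator {0..1} t *\<^sub>R 1))"
    by (intro Bochner_Integration.integral_cong) (auto simp: power2_eq_square algebra_simps)
  also have "\<dots> = ?I (\<lambda>t. (g t)\<^sup>2) - 2 * m * ?I g + m\<^sup>2 * ?I (\<lambda>t. 1)"
    using int[of "\<lambda>t. (g t)\<^sup>2"] int[OF assms] int[of "\<lambda>_. 1"] assms
    by (simp add: continuous_intros)
  also have "?I (\<lambda>t. 1) = 1" by simp
  finally show ?thesis by (simp add: m_def power2_eq_square)
qed

text \<open>Jensen along the segment from \<open>x\<close> to \<open>x + w\<close>, then an exchange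
  of integrals; translation invariance removes the parameter \<open>t\<close>. Nonnegative integrals
  reduce the exchange to measurability. Both Poincare and Rellich rest on this.\<close>

lemma translation_estimate:
  assumes C: "C_k (Suc k) f"
  shows "(\<integral>\<^sup>+x. ennreal ((f (x + w) - f x)\<^sup>2) \<partial>lborel) \<le> ennreal ((norm w)\<^sup>2) * (\<integral>\<^sup>+x. ennreal ((norm (grad f x))\<^sup>2) \<partial>lborel)"
proof -
  have cont: "continuous_on A (grad f)" for A by (rule continuous_on_grad[OF C])
  have [measurable]: "grad f \<in> borel_measurable borel"
    using cont by (auto intro: borel_measurable_continuous_onI)
  let ?g = "\<lambda>x t. indicator {0..1::real} t * ennreal ((norm w)\<^sup>2) * ennreal ((norm (grad f (x + t *\<^sub>R w)))\<^sup>2)"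
  have "ennreal ((f (x + w) - f x)\<^sup>2) \<le> (\<integral>\<^sup>+t. ?g x t \<partial>lborel)" for x
  proof -
    have c: "continuous_on {0..1} (\<lambda>t. grad f (x + t *\<^sub>R w))"
      by (intro continuous_intros continuous_on_compose2[OF cont[of UNIV]]) auto
    have i: "integrable lborel (\<lambda>t. indicator {0..1::real} t *\<^sub>R (grad f (x + t *\<^sub>R w) \<bullet> w)\<^sup>2)"
      "integrable lborel (\<lambda>t. indicator {0..1::real} t *\<^sub>R ((norm w)\<^sup>2 * (norm (grad f (x + t *\<^sub>R w)))\<^sup>2))"
      by (intro borel_integrable_compact continuous_intros c compact_Icc)+
    have "(f (x + w) - f x)\<^sup>2 \<le> (LINT t|lborel. indicator {0..1} t *\<^sub>R (grad f (x + t *\<^sub>R w) \<bullet> w)\<^sup>2)"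
      unfolding C1_increment[OF C, symmetric] using c
      by (intro square_integral_unit_le continuous_intros)
    also have "\<dots> \<le> (LINT t|lborel. indicator {0..1} t *\<^sub>R ((norm w)\<^sup>2 * (norm (grad f (x + t *\<^sub>R w)))\<^sup>2))"
    proof (intro integral_mono i)
      fix t
      have "(grad f (x + t *\<^sub>R w) \<bullet> w)\<^sup>2 \<le> (norm w)\<^sup>2 * (norm (grad f (x + t *\<^sub>R w)))\<^sup>2"
        using Cauchy_Schwarz_ineq[of "grad f (x + t *\<^sub>R w)" w] by (simp add: power2_norm_eq_inner mult.commute)
      then show "indicator {0..1} t *\<^sub>R (grad f (x + t *\<^sub>R w) \<bullet> w)\<^sup>2
        \<le> indicator {0..1} t *\<^sub>R ((norm w)\<^sup>2 * (norm (grad f (x + t *\<^sub>R w)))\<^sup>2)"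
        by (auto simp: indicator_def)
    qed
    finally have "ennreal ((f (x + w) - f x)\<^sup>2) \<le> ennreal (LINT t|lborel. indicator {0..1} t *\<^sub>R ((norm w)\<^sup>2 * (norm (grad f (x + t *\<^sub>R w)))\<^sup>2))"
      by (rule ennreal_leI)
    also have "\<dots> = (\<integral>\<^sup>+t. ennreal (indicator {0..1} t *\<^sub>R ((norm w)\<^sup>2 * (norm (grad f (x + t *\<^sub>R w)))\<^sup>2)) \<partial>lborel)"
      by (rule nn_integral_eq_integral[symmetric, OF i(2)]) auto
    also have "\<dots> = (\<integral>\<^sup>+t. ?g x t \<partial>lborel)"
      by (intro nn_integral_cong) (auto simp: indicator_def ennreal_mult)
    finally show ?thesis .
  qed
  then have "(\<integral>\<^sup>+x. ennreal ((f (x + w) - f x)\<^sup>2) \<partial>lborel) \<le> (\<integral>\<^sup>+x. \<integral>\<^sup>+t. ?g x t \<partial>lborel \<partial>lborel)"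
    by (intro nn_integral_mono)
  also have "\<dots> = (\<integral>\<^sup>+t. \<integral>\<^sup>+x. ?g x t \<partial>lborel \<partial>lborel)"
    by (rule lborel_pair.Fubini'[symmetric]) measurable
  also have "\<dots> = (\<integral>\<^sup>+t. indicator {0..1::real} t * (ennreal ((norm w)\<^sup>2) * (\<integral>\<^sup>+x. ennreal ((norm (grad f x))\<^sup>2) \<partial>lborel)) \<partial>lborel)"
  proof (intro nn_integral_cong)
    fix t :: real
    have "(\<integral>\<^sup>+x. ?g x t \<partial>lborel) = indicator {0..1::real} t * ennreal ((norm w)\<^sup>2) * (\<integral>\<^sup>+x. ennreal ((norm (grad f (x + t *\<^sub>R w)))\<^sup>2) \<partial>lborel)"
      by (intro nn_integral_cmult) measurable
    also have "(\<integral>\<^sup>+x. ennreal ((norm (grad f (x + t *\<^sub>R w)))\<^sup>2) \<partial>lborel) = (\<integral>\<^sup>+x. ennreal ((norm (grad f x))\<^sup>2) \<partial>lborel)"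
      by (rule lborel_nn_integral_translation[of "\<lambda>x. ennreal ((norm (grad f x))\<^sup>2)"]) measurable
    finally show "(\<integral>\<^sup>+x. ?g x t \<partial>lborel) = indicator {0..1::real} t * (ennreal ((norm w)\<^sup>2) * (\<integral>\<^sup>+x. ennreal ((norm (grad f x))\<^sup>2) \<partial>lborel))"
      by (simp add: mult.assoc)
  qed
  also have "\<dots> = ennreal ((norm w)\<^sup>2) * (\<integral>\<^sup>+x. ennreal ((norm (grad f x))\<^sup>2) \<partial>lborel)"
    by (simp add: nn_integral_multc)
  finally show ?thesis .
qed

section \<open>Square integrable functions\<close>

lemma square_integrable_measurable: "square_integrable f \<Longrightarrow> f \<in> borel_measurable borel"
  by (simp add: square_integrable_def)

lemma square_integrableD: "square_integrable f \<Longrightarrow> integrable lborel (\<lambda>x. (norm (f x))\<^sup>2)"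
  by (simp add: square_integrable_def)

lemma norm_add_sq_le: "(norm (x + y))\<^sup>2 \<le> 2 * (norm x)\<^sup>2 + 2 * (norm (y::'b::real_normed_vector))\<^sup>2"
proof -
  have "(norm (x + y))\<^sup>2 \<le> (norm x + norm y)\<^sup>2" by (intro power_mono norm_triangle_ineq) auto
  also have "\<dots> \<le> 2 * (norm x)\<^sup>2 + 2 * (norm y)\<^sup>2"
    using sum_squares_bound[of "norm x" "norm y"] by (simp add: power2_sum)
  finally show ?thesis .
qed

lemma square_integrable_add:
  assumes "square_integrable f" "square_integrable g"
  shows "square_integrable (\<lambda>x. f x + g x)"
proof -
  have [measurable]: "f \<in> borel_measurable borel" "g \<in> borel_measurable borel"
    using assms by (auto intro: square_integrable_measurable)
  have "integrable lborel (\<lambda>x. 2 * (norm (f x))\<^sup>2 + 2 * (norm (g x))\<^sup>2)"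
    using assms by (auto simp: square_integrable_def)
  then have "integrable lborel (\<lambda>x. (norm (f x + g x))\<^sup>2)"
    by (rule Bochner_Integration.integrable_bound) (auto intro!: AE_I2 norm_add_sq_le)
  then show ?thesis unfolding square_integrable_def by simp
qed

lemma square_integrable_scale:
  assumes "square_integrable f" shows "square_integrable (\<lambda>x. c *\<^sub>R f x)"
  using assms unfolding square_integrable_def by (auto simp: power_mult_distrib)

lemma square_integrable_diff:
  assumes "square_integrable f" "square_integrable g"
  shows "square_integrable (\<lambda>x. f x - g x)"
proof -
  have "(\<lambda>x. f x - g x) = (\<lambda>x. f x + (- 1) *\<^sub>R g x)" by auto
  then show ?thesis using square_integrable_add[OF assms(1) square_integrable_scale[OF assms(2)]] by (simp only:)
qed

lemma square_integrable_component:
  assumes "square_integrable f" shows "square_integrable (\<lambda>x. f x \<bullet> b)"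
proof -
  have [measurable]: "f \<in> borel_measurable borel" using assms by (rule square_integrable_measurable)
  have "integrable lborel (\<lambda>x. (norm b)\<^sup>2 * (norm (f x))\<^sup>2)"
    using assms by (auto simp: square_integrable_def)
  then have "integrable lborel (\<lambda>x. (f x \<bullet> b)\<^sup>2)"
    by (rule Bochner_Integration.integrable_bound)
       (use Cauchy_Schwarz_ineq[of "f _" b] in \<open>auto intro!: AE_I2 simp: power2_norm_eq_inner mult.commute\<close>)
  then show ?thesis unfolding square_integrable_def by simp
qed

lemma square_integrable_inner:
  assumes "square_integrable f" "square_integrable g"
  shows "integrable lborel (\<lambda>x. f x \<bullet> g x)"
proof -
  have [measurable]: "f \<in> borel_measurable borel" "g \<in> borel_measurable borel"
    using assms by (auto intro: square_integrable_measurable)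
  have "integrable lborel (\<lambda>x. (norm (f x))\<^sup>2 + (norm (g x))\<^sup>2)"
    using assms by (auto simp: square_integrable_def)
  then show ?thesis
  proof (rule Bochner_Integration.integrable_bound)
    have "\<bar>f x \<bullet> g x\<bar> \<le> (norm (f x))\<^sup>2 + (norm (g x))\<^sup>2" for x
    proof -
      have "\<bar>f x \<bullet> g x\<bar> \<le> norm (f x) * norm (g x)" by (rule Cauchy_Schwarz_ineq2)
      also have "\<dots> \<le> (norm (f x))\<^sup>2 + (norm (g x))\<^sup>2"
      proof -
        have "0 \<le> norm (f x) * norm (g x)" by simp
        then show ?thesis
          using sum_squares_bound[of "norm (f x)" "norm (g x)"] unfolding mult.assoc by linarith
      qed
      finally show ?thesis .
    qed
    then show "AE x in lborel. norm (f x \<bullet> g x) \<le> norm ((norm (f x))\<^sup>2 + (norm (g x))\<^sup>2)"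
      by (intro AE_I2) auto
  qed measurable
qed

lemma square_integrable_mult:
  fixes f g :: "'a::euclidean_space \<Rightarrow> real"
  assumes "square_integrable f" "square_integrable g"
  shows "integrable lborel (\<lambda>x. f x * g x)"
  using square_integrable_inner[OF assms] by simp

lemma integral_sq_eq_0_AE:
  assumes "square_integrable f" "(LINT x|lborel. (norm (f x))\<^sup>2) = 0"
  shows "AE x in lborel. f x = 0"
  using assms integral_nonneg_eq_0_iff_AE[OF square_integrableD[OF assms(1)]] by simp

text \<open>A subsequence with $\|f_{r(k+1)} - f_{r(k)}\|^2 < 8^{-k}$ has
  $\sum_k 4^k |f_{r(k+1)} - f_{r(k)}|^2 < \infty$ almost everywhere, hence converges there geometrically.\<close>

lemma L2_complete:
  fixes f :: "nat \<Rightarrow> 'a::euclidean_space \<Rightarrow> 'b::euclidean_space"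
  assumes f: "\<And>n. square_integrable (f n)"
    and cauchy: "\<And>e. e > 0 \<Longrightarrow> \<exists>M. \<forall>m\<ge>M. \<forall>n\<ge>M. (LINT x|lborel. (norm (f m x - f n x))\<^sup>2) < e"
  shows "\<exists>g. square_integrable g \<and> (\<lambda>n. LINT x|lborel. (norm (f n x - g x))\<^sup>2) \<longlonglongrightarrow> 0"
proof -
  have [measurable]: "f n \<in> borel_measurable borel" for n using f by (rule square_integrable_measurable)
  have "\<exists>r. \<forall>k. (\<forall>m\<ge>r k. \<forall>n\<ge>r k. (LINT x|lborel. (norm (f m x - f n x))\<^sup>2) < (1/8)^k) \<and> r k < r (Suc k)"
  proof (intro dependent_nat_choice)
    show "\<exists>M. \<forall>m\<ge>M. \<forall>n\<ge>M. (LINT x|lborel. (norm (f m x - f n x))\<^sup>2) < (1/8)^0"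
      using cauchy[of 1] by simp
    fix x k
    obtain M where "\<forall>m\<ge>M. \<forall>n\<ge>M. (LINT x|lborel. (norm (f m x - f n x))\<^sup>2) < (1/8)^Suc k"
      using cauchy[of "(1/8)^Suc k"] by auto
    then show "\<exists>y. (\<forall>m\<ge>y. \<forall>n\<ge>y. (LINT x|lborel. (norm (f m x - f n x))\<^sup>2) < (1/8)^Suc k) \<and> x < y"
      by (intro exI[of _ "max M (Suc x)"]) auto
  qed
  then obtain r where r: "\<And>k m n. m \<ge> r k \<Longrightarrow> n \<ge> r k \<Longrightarrow> (LINT x|lborel. (norm (f m x - f n x))\<^sup>2) < (1/8)^k"
    "strict_mono r" by (auto simp: strict_mono_Suc_iff)
  define d where "d = (\<lambda>k x. norm (f (r (Suc k)) x - f (r k) x))"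
  have [measurable]: "d k \<in> borel_measurable borel" for k unfolding d_def by measurable
  have int_d: "(\<integral>\<^sup>+x. ennreal ((d k x)\<^sup>2) \<partial>lborel) \<le> ennreal ((1/8)^k)" for k
  proof -
    have "(\<integral>\<^sup>+x. ennreal ((d k x)\<^sup>2) \<partial>lborel) = ennreal (LINT x|lborel. (d k x)\<^sup>2)"
      unfolding d_def using square_integrableD[OF square_integrable_diff[OF f f]]
      by (intro nn_integral_eq_integral) auto
    also have "\<dots> \<le> ennreal ((1/8)^k)"
      using r(1)[of k "r (Suc k)" "r k"] strict_mono_leD[OF r(2), of k "Suc k"]
      unfolding d_def by (intro ennreal_leI) auto
    finally show ?thesis .
  qed
  have "(\<integral>\<^sup>+x. (\<Sum>k. ennreal (4^k * (d k x)\<^sup>2)) \<partial>lborel) = (\<Sum>k. \<integral>\<^sup>+x. ennreal (4^k * (d k x)\<^sup>2) \<partial>lborel)"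
    by (intro nn_integral_suminf) measurable
  also have "\<dots> \<le> (\<Sum>k. ennreal ((1/2)^k))"
  proof (intro suminf_le)
    fix k
    have "(\<integral>\<^sup>+x. ennreal (4^k * (d k x)\<^sup>2) \<partial>lborel) = ennreal (4^k) * (\<integral>\<^sup>+x. ennreal ((d k x)\<^sup>2) \<partial>lborel)"
      by (subst nn_integral_cmult[symmetric]) (auto simp: ennreal_mult)
    also have "\<dots> \<le> ennreal (4^k) * ennreal ((1/8)^k)" by (intro mult_left_mono int_d) auto
    also have "\<dots> = ennreal (4^k * (1/8)^k)" by (rule ennreal_mult[symmetric]) auto
    also have "4^k * (1/8::real)^k = (1/2)^k" by (simp flip: power_mult_distrib)
    finally show "(\<integral>\<^sup>+x. ennreal (4^k * (d k x)\<^sup>2) \<partial>lborel) \<le> ennreal ((1/2)^k)" .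
  qed auto
  also have "\<dots> = ennreal (\<Sum>k. (1/2)^k)"
    by (intro suminf_ennreal2) (auto intro: summable_geometric)
  also have "\<dots> < \<infinity>" by simp
  finally have "(\<integral>\<^sup>+x. (\<Sum>k. ennreal (4^k * (d k x)\<^sup>2)) \<partial>lborel) \<noteq> \<infinity>" by (rule less_imp_neq)
  then have "AE x in lborel. (\<Sum>k. ennreal (4^k * (d k x)\<^sup>2)) \<noteq> \<infinity>"
    by (intro nn_integral_noteq_infinite) measurable
  then have conv: "AE x in lborel. convergent (\<lambda>k. f (r k) x)"
  proof eventually_elim
    case (elim x)
    \<comment> \<open>Each term of the series is at most its finite sum \<open>B\<close>; the square
      root turns the weight \<open>4^k\<close> into the decay \<open>(1/2)^k\<close>.\<close>
    define B where "B = enn2real (\<Sum>k. ennreal (4^k * (d k x)\<^sup>2))"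
    have dB: "d k x \<le> sqrt B * (1/2)^k" for k
    proof -
      have "ennreal (4^k * (d k x)\<^sup>2) \<le> (\<Sum>k. ennreal (4^k * (d k x)\<^sup>2))"
      proof -
        have "(\<Sum>k\<in>{k}. ennreal (4^k * (d k x)\<^sup>2)) \<le> (\<Sum>k. ennreal (4^k * (d k x)\<^sup>2))"
          by (rule sum_le_suminf) auto
        then show ?thesis by simp
      qed
      also have "\<dots> = ennreal B" unfolding B_def using elim by (simp add: less_top)
      finally have "4^k * (d k x)\<^sup>2 \<le> B" by (simp add: B_def)
      then have "(2^k * d k x)\<^sup>2 \<le> B"
        by (simp add: power_mult_distrib power_mult[symmetric] mult.commute[of k 2] power_mult[of 2 2 k])
      then have "2^k * d k x \<le> sqrt B" by (rule real_le_rsqrt)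
      then show ?thesis by (simp add: field_simps power_divide)
    qed
    have "summable (\<lambda>k. f (r (Suc k)) x - f (r k) x)"
    proof (rule summable_comparison_test)
      show "\<exists>N. \<forall>n\<ge>N. norm (f (r (Suc n)) x - f (r n) x) \<le> sqrt B * (1/2)^n"
        using dB unfolding d_def by blast
      show "summable (\<lambda>k. sqrt B * (1/2::real)^k)" by (intro summable_mult summable_geometric) simp
    qed
    then have "convergent (\<lambda>n. \<Sum>k<n. f (r (Suc k)) x - f (r k) x)"
      by (simp add: summable_iff_convergent)
    then have "convergent (\<lambda>n. f (r n) x - f (r 0) x)" by (simp add: sum_lessThan_telescope[of "\<lambda>n. f (r n) x"])
    then show ?case by (simp add: convergent_diff_const_right_iff)
  qed
  define g where "g = (\<lambda>x. lim (\<lambda>k. f (r k) x))"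
  have [measurable]: "g \<in> borel_measurable borel" unfolding g_def by measurable
  have lim: "AE x in lborel. (\<lambda>k. f (r k) x) \<longlonglongrightarrow> g x"
    using conv unfolding g_def by eventually_elim (simp add: convergent_LIMSEQ_iff)
  \<comment> \<open>The second index in the Cauchy bound runs to infinity along \<open>r\<close>,
    which carries the bound to the pointwise limit for every late member of the original
    sequence.\<close>
  have fatou: "(\<integral>\<^sup>+x. ennreal ((norm (f n x - g x))\<^sup>2) \<partial>lborel) \<le> ennreal e"
    if e: "e > 0" and M: "\<forall>m\<ge>M. \<forall>n\<ge>M. (LINT x|lborel. (norm (f m x - f n x))\<^sup>2) < e" "n \<ge> M" for e M n
  proof -
    have "(\<integral>\<^sup>+x. ennreal ((norm (f n x - g x))\<^sup>2) \<partial>lborel)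
        = (\<integral>\<^sup>+x. liminf (\<lambda>k. ennreal ((norm (f n x - f (r k) x))\<^sup>2)) \<partial>lborel)"
    proof (intro nn_integral_cong_AE)
      show "AE x in lborel. ennreal ((norm (f n x - g x))\<^sup>2) = liminf (\<lambda>k. ennreal ((norm (f n x - f (r k) x))\<^sup>2))"
        using lim
      proof eventually_elim
        case (elim x)
        then have "(\<lambda>k. ennreal ((norm (f n x - f (r k) x))\<^sup>2)) \<longlonglongrightarrow> ennreal ((norm (f n x - g x))\<^sup>2)"
          by (intro tendsto_intros tendsto_ennrealI)
        then show ?case by (rule lim_imp_Liminf[OF sequentially_bot, symmetric])
      qed
    qed
    also have "\<dots> \<le> liminf (\<lambda>k. \<integral>\<^sup>+x. ennreal ((norm (f n x - f (r k) x))\<^sup>2) \<partial>lborel)"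
      by (intro nn_integral_liminf) measurable
    also have "\<dots> \<le> liminf (\<lambda>k::nat. ennreal e)"
    proof (intro Liminf_mono eventually_sequentiallyI[of M])
      fix k assume "k \<ge> M"
      then have "r k \<ge> M" using seq_suble[OF r(2), of k] by simp
      have "(\<integral>\<^sup>+x. ennreal ((norm (f n x - f (r k) x))\<^sup>2) \<partial>lborel) = ennreal (LINT x|lborel. (norm (f n x - f (r k) x))\<^sup>2)"
        using square_integrableD[OF square_integrable_diff[OF f f]]
        by (intro nn_integral_eq_integral) auto
      also have "\<dots> \<le> ennreal e" using M \<open>r k \<ge> M\<close> by (intro ennreal_leI) (auto intro: less_imp_le)
      finally show "(\<integral>\<^sup>+x. ennreal ((norm (f n x - f (r k) x))\<^sup>2) \<partial>lborel) \<le> ennreal e" .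
    qed
    also have "\<dots> = ennreal e" by (simp add: Liminf_const)
    finally show ?thesis .
  qed
  have diff: "square_integrable (\<lambda>x. f n x - g x) \<and> (LINT x|lborel. (norm (f n x - g x))\<^sup>2) \<le> e"
    if e: "e > 0" and M: "\<forall>m\<ge>M. \<forall>n\<ge>M. (LINT x|lborel. (norm (f m x - f n x))\<^sup>2) < e" "n \<ge> M" for e M n
  proof -
    have *: "(\<integral>\<^sup>+x. ennreal ((norm (f n x - g x))\<^sup>2) \<partial>lborel) \<le> ennreal e" by (rule fatou[OF that])
    have i: "integrable lborel (\<lambda>x. (norm (f n x - g x))\<^sup>2)"
      using * by (intro integrableI_nonneg) (auto simp: less_top[symmetric] top_unique)
    then have "ennreal (LINT x|lborel. (norm (f n x - g x))\<^sup>2) \<le> ennreal e"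
      using * by (simp add: nn_integral_eq_integral)
    then show ?thesis using i e by (simp add: square_integrable_def)
  qed
  have "square_integrable g"
  proof -
    obtain M where "\<forall>m\<ge>M. \<forall>n\<ge>M. (LINT x|lborel. (norm (f m x - f n x))\<^sup>2) < 1" using cauchy[of 1] by auto
    then have "square_integrable (\<lambda>x. f M x - g x)" using diff[of 1 M M] by auto
    from square_integrable_diff[OF f[of M] this] show ?thesis by simp
  qed
  moreover have "(\<lambda>n. LINT x|lborel. (norm (f n x - g x))\<^sup>2) \<longlonglongrightarrow> 0"
  proof (rule LIMSEQ_I)
    fix e :: real assume "e > 0"
    then obtain M where M: "\<forall>m\<ge>M. \<forall>n\<ge>M. (LINT x|lborel. (norm (f m x - f n x))\<^sup>2) < e/2" using cauchy[of "e/2"] by auto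
    have "norm ((LINT x|lborel. (norm (f n x - g x))\<^sup>2) - 0) < e" if "n \<ge> M" for n
      using diff[of "e/2" M n] M that \<open>e > 0\<close> by auto
    then show "\<exists>M. \<forall>n\<ge>M. norm ((LINT x|lborel. (norm (f n x - g x))\<^sup>2) - 0) < e" by blast
  qed
  ultimately show ?thesis by blast
qed

text \<open>Fundamental lemma of the calculus of variations. Cutoffs shrinking to a compact set show
  that \<open>d\<close> integrates to zero over it; a compact set of positive measure on which
  \<open>d\<close> has a strict sign would contradict this.\<close>

lemma AE_zero_if_orthogonal_to_test_functions:
  fixes d :: "'a::euclidean_space \<Rightarrow> real"
  assumes d: "square_integrable d" and orth: "\<And>\<phi>. \<phi> \<in> test_functions UNIV \<Longrightarrow> (LINT x|lborel. d x * \<phi> x) = 0"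
  shows "AE x in lborel. d x = 0"
proof -
  have compact_zero: "(LINT x|lborel. d x * indicator T x) = 0" if T: "compact T" for T :: "'a set"
  proof (cases "T = {}")
    case False
    define U where "U = (\<lambda>n. {x. infdist x T < 1 / real (Suc n)})"
    have "\<exists>\<eta>. \<eta> \<in> test_functions (U n) \<and> (\<forall>x. 0 \<le> \<eta> x \<and> \<eta> x \<le> 1) \<and> (\<forall>x\<in>T. \<eta> x = 1)" for n
    proof -
      have "open (U n)" unfolding U_def by (intro open_Collect_less continuous_intros)
      moreover have "T \<subseteq> U n" unfolding U_def by auto
      ultimately show ?thesis using smooth_cutoff[OF T, of "U n"] by (metis subsetD)
    qed
    then obtain \<eta> where \<eta>: "\<And>n. \<eta> n \<in> test_functions (U n)" "\<And>n x. 0 \<le> \<eta> n x \<and> \<eta> n x \<le> 1"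
      "\<And>n x. x \<in> T \<Longrightarrow> \<eta> n x = 1" by metis
    have [measurable]: "\<eta> n \<in> borel_measurable borel" for n
      using test_square_integrable(1)[OF \<eta>(1)] by (rule square_integrable_measurable)
    have [measurable]: "d \<in> borel_measurable borel" using d by (rule square_integrable_measurable)
    have Tm[measurable]: "T \<in> sets borel" using T by (simp add: borel_compact)
    obtain R where R: "\<And>x. x \<in> T \<Longrightarrow> norm x \<le> R" using compact_imp_bounded[OF T] by (auto simp: bounded_iff)
    have out: "\<eta> n x = 0" if "norm x > R + 1" for n x
    proof (rule test_vanishes_outside(1)[OF \<eta>(1)])
      have "infdist x T \<ge> 1"
        unfolding infdist_notempty[OF False] using False
      proof (intro cINF_greatest)
        fix y assume "y \<in> T"
        then show "1 \<le> dist x y" using R[of y] that norm_triangle_ineq2[of x y] by (simp add: dist_norm)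
      qed
      moreover have "1 / real (Suc n) \<le> 1" by simp
      ultimately have "1 / real (Suc n) \<le> infdist x T" by linarith
      then show "x \<notin> U n" unfolding U_def by (simp add: not_less)
    qed
    \<comment> \<open>The cutoffs live in a common ball, where
      \<open>\<bar>d x\<bar> \<le> (d x)\<^sup>2 + 1\<close> provides the integrable
      majorant.\<close>
    have "(\<lambda>n. LINT x|lborel. d x * \<eta> n x) \<longlonglongrightarrow> (LINT x|lborel. d x * indicator T x)"
    proof (rule integral_dominated_convergence[where w = "\<lambda>x. (d x)\<^sup>2 + indicator (cball 0 (R + 1)) x"])
      have "integrable lborel (\<lambda>x. (norm (d x))\<^sup>2)" by (rule square_integrableD[OF d])
      moreover have "integrable lborel (indicator (cball 0 (R + 1)) :: 'a \<Rightarrow> real)"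
        using emeasure_bounded_finite[OF bounded_cball, of 0 "R + 1"] by (intro integrable_real_indicator) auto
      ultimately show "integrable lborel (\<lambda>x. (d x)\<^sup>2 + indicator (cball 0 (R + 1)) x)" by simp
      show "AE x in lborel. norm (d x * \<eta> n x) \<le> (d x)\<^sup>2 + indicator (cball 0 (R + 1)) x" for n
      proof (intro AE_I2)
        fix x
        show "norm (d x * \<eta> n x) \<le> (d x)\<^sup>2 + indicator (cball 0 (R + 1)) x"
        proof (cases "norm x > R + 1")
          case False
          have "\<bar>d x\<bar> * \<eta> n x \<le> \<bar>d x\<bar> * 1" using \<eta>(2) by (intro mult_left_mono) auto
          also have "\<dots> \<le> (d x)\<^sup>2 + 1" using sum_squares_bound[of "\<bar>d x\<bar>" 1] by simp
          finally show ?thesis using \<eta>(2)[of n x] False by (simp add: abs_mult indicator_def)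
        qed (simp add: out)
      qed
      show "AE x in lborel. (\<lambda>n. d x * \<eta> n x) \<longlonglongrightarrow> d x * indicator T x"
      proof (intro AE_I2 tendsto_mult_left)
        fix x
        show "(\<lambda>n. \<eta> n x) \<longlonglongrightarrow> indicator T x"
        proof (cases "x \<in> T")
          case False
          have "infdist x T > 0"
            using False \<open>T \<noteq> {}\<close> T by (simp add: infdist_pos_not_in_closed compact_imp_closed)
          then obtain N where N: "1 / real (Suc N) < infdist x T" using nat_approx_posE by blast
          have "\<eta> n x = 0" if "n \<ge> N" for n
          proof (rule test_vanishes_outside(1)[OF \<eta>(1)])
            have "1 / real (Suc n) \<le> 1 / real (Suc N)" using that by (simp add: field_simps)
            then show "x \<notin> U n" using N by (auto simp: U_def)
          qed
          then show ?thesis using False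
            by (intro tendsto_eventually eventually_sequentiallyI[of N]) auto
        qed (simp add: \<eta>(3))
      qed
    qed measurable
    moreover have "(LINT x|lborel. d x * \<eta> n x) = 0" for n
      using \<eta>(1)[of n] test_functions_mono[of "U n" UNIV] by (intro orth) auto
    ultimately show ?thesis using LIMSEQ_unique[OF _ tendsto_const] by simp
  qed simp
  have half: "AE x in lborel. \<not> s * d x > 0" if s: "s \<in> {-1, 1}" for s :: real
  proof (rule ccontr)
    assume neg: "\<not> ?thesis"
    have [measurable]: "d \<in> borel_measurable borel" using d by (rule square_integrable_measurable)
    \<comment> \<open>Cutting with balls gives finite measure and makes closed subsets
      compact.\<close>
    define S where "S = (\<lambda>n::nat. {x. s * d x > 0} \<inter> cball 0 (real n))"
    have [measurable]: "S n \<in> sets borel" for n unfolding S_def by measurable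
    have "\<exists>n. emeasure lborel (S n) \<noteq> 0"
    proof (rule ccontr)
      assume "\<nexists>n. emeasure lborel (S n) \<noteq> 0"
      then have "S n \<in> null_sets lborel" for n by (auto simp: null_sets_def)
      then have "AE x in lborel. \<forall>n. x \<notin> S n" by (intro AE_all_countable[THEN iffD2] allI AE_not_in)
      then have "AE x in lborel. \<not> s * d x > 0"
      proof eventually_elim
        case (elim x)
        obtain n :: nat where "norm x \<le> n" using real_arch_simple by blast
        then show ?case using elim[rule_format, of n] by (auto simp: S_def)
      qed
      with neg show False by simp
    qed
    then obtain n where n: "emeasure lborel (S n) \<noteq> 0" by blast
    have fin: "emeasure lborel (S n) < \<infinity>"
      by (rule emeasure_bounded_finite) (auto simp: S_def intro: bounded_subset[OF bounded_cball])
    obtain e where e: "e > 0" "emeasure lborel (S n) = ennreal e"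
      using n fin by (cases "emeasure lborel (S n)") (auto simp: zero_less_iff_neq_zero less_le)
    have Sn_leb: "S n \<in> sets lebesgue" by (intro sets_completionI_sets) simp
    \<comment> \<open>The tolerance is the full measure \<open>e\<close> of \<open>S n\<close>, just
      enough to leave \<open>T\<close> with positive measure.\<close>
    obtain T where T: "closed T" "T \<subseteq> S n" "emeasure lebesgue (S n - T) < ennreal e"
      using sets_lebesgue_inner_closed[OF Sn_leb e(1)] by (metis e(2))
    have cT: "compact T" using T(1,2) unfolding S_def
      by (meson bounded_cball bounded_subset compact_eq_bounded_closed inf.boundedE)
    then have [measurable]: "T \<in> sets borel" by (simp add: borel_compact)
    have T0: "emeasure lborel T \<noteq> 0"
    proof
      assume z: "emeasure lborel T = 0"
      have "emeasure lborel (S n) = emeasure lborel T + emeasure lborel (S n - T)"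
        using T(2) by (subst plus_emeasure) (auto intro!: arg_cong[of _ _ "emeasure lborel"])
      then show False using T(3) e(2) z by (simp add: emeasure_completion)
    qed
    have int: "integrable lborel (\<lambda>x. s * d x * indicator T x)"
    proof -
      have "square_integrable (indicator T :: 'a \<Rightarrow> real)"
      proof -
        have sq: "(\<lambda>x. (norm (indicator T x :: real))\<^sup>2) = indicator T" by (auto simp: indicator_def)
        show ?thesis unfolding square_integrable_def sq
          using emeasure_bounded_finite[OF compact_imp_bounded[OF cT]]
          by (auto intro!: integrable_real_indicator)
      qed
      from square_integrable_mult[OF d this] show ?thesis by (simp add: mult.assoc)
    qed
    have "(LINT x|lborel. s * d x * indicator T x) = s * (LINT x|lborel. d x * indicator T x)"
      by (simp add: mult.assoc)
    then have "(LINT x|lborel. s * d x * indicator T x) = 0" using compact_zero[OF cT] by simp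
    then have "AE x in lborel. s * d x * indicator T x = 0"
    proof (subst (asm) integral_nonneg_eq_0_iff_AE[OF int])
      show "AE x in lborel. 0 \<le> s * d x * indicator T x"
        using T(2) by (intro AE_I2) (auto simp: S_def indicator_def intro: less_imp_le)
    qed
    then have "AE x in lborel. x \<notin> T"
      by eventually_elim (use T(2) in \<open>auto simp: S_def indicator_def split: if_splits\<close>)
    then have "emeasure lborel T = 0" by (subst (asm) AE_iff_measurable[of T]) auto
    with T0 show False by simp
  qed
  from half[of 1] half[of "-1"] show ?thesis
    by (simp, elim AE_mp) (auto intro!: AE_I2)
qed

section \<open>Poincare inequality and Rellich compactness\<close>

text \<open>Translating by a vector longer than the diameter of \<open>D\<close> makes the supports disjoint, so the
  translation estimate bounds $2\|\phi\|^2$.\<close>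

lemma poincare_test_functions:
  fixes D :: "'a::euclidean_space set"
  assumes "bounded D"
  shows "\<exists>C>0. \<forall>\<phi>\<in>test_functions D.
    (LINT x|lborel. (\<phi> x)\<^sup>2) \<le> C * (LINT x|lborel. (norm (grad \<phi> x))\<^sup>2)"
proof -
  obtain R where R: "R > 0" "\<And>x. x \<in> D \<Longrightarrow> norm x < R"
  proof -
    obtain B where "B > 0" "\<forall>x\<in>D. norm x \<le> B" using assms unfolding bounded_pos by blast
    then show ?thesis using that[of "B + 1"] by force
  qed
  obtain b :: 'a where b: "b \<in> Basis" using nonempty_Basis by blast
  \<comment> \<open>\<open>D\<close> lies in the open ball of radius \<open>R\<close>, so
    \<open>x\<close> and \<open>x + w\<close> cannot both belong to it.\<close>
  define w where "w = (2 * R) *\<^sub>R b"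
  have nw: "norm w = 2 * R" using b R(1) by (simp add: w_def)
  have "(LINT x|lborel. (\<phi> x)\<^sup>2) \<le> 2 * R\<^sup>2 * (LINT x|lborel. (norm (grad \<phi> x))\<^sup>2)"
    if \<phi>: "\<phi> \<in> test_functions D" for \<phi>
  proof -
    note sq = test_square_integrable[OF \<phi>]
    have [measurable]: "\<phi> \<in> borel_measurable borel" using sq by (auto intro: square_integrable_measurable)
    have "(\<phi> (x + w) - \<phi> x)\<^sup>2 = (\<phi> (x + w))\<^sup>2 + (\<phi> x)\<^sup>2" for x
    proof (cases "\<phi> x = 0")
      case False
      then have "x \<in> D" using test_vanishes_outside(1)[OF \<phi>] by blast
      have "norm (x + w) \<ge> norm w - norm x" using norm_triangle_ineq4[of "x + w" x] by simp
      then have "x + w \<notin> D" using R(2)[of x] R(2)[of "x + w"] \<open>x \<in> D\<close> nw by auto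
      then show ?thesis using test_vanishes_outside(1)[OF \<phi>] by simp
    qed simp
    then have "(\<integral>\<^sup>+x. ennreal ((\<phi> (x + w) - \<phi> x)\<^sup>2) \<partial>lborel)
        = (\<integral>\<^sup>+x. ennreal ((\<phi> (x + w))\<^sup>2) + ennreal ((\<phi> x)\<^sup>2) \<partial>lborel)"
      by (simp add: ennreal_plus)
    also have "\<dots> = (\<integral>\<^sup>+x. ennreal ((\<phi> (x + w))\<^sup>2) \<partial>lborel) + (\<integral>\<^sup>+x. ennreal ((\<phi> x)\<^sup>2) \<partial>lborel)"
      by (intro nn_integral_add) measurable
    also have "(\<integral>\<^sup>+x. ennreal ((\<phi> (x + w))\<^sup>2) \<partial>lborel) = (\<integral>\<^sup>+x. ennreal ((\<phi> x)\<^sup>2) \<partial>lborel)"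
      by (rule lborel_nn_integral_translation[of "\<lambda>x. ennreal ((\<phi> x)\<^sup>2)"]) measurable
    finally have "(\<integral>\<^sup>+x. ennreal ((\<phi> x)\<^sup>2) \<partial>lborel) + (\<integral>\<^sup>+x. ennreal ((\<phi> x)\<^sup>2) \<partial>lborel)
        \<le> ennreal ((norm w)\<^sup>2) * (\<integral>\<^sup>+x. ennreal ((norm (grad \<phi> x))\<^sup>2) \<partial>lborel)"
      using translation_estimate[OF test_C_k[OF \<phi>], of w] by simp
    moreover have "(\<integral>\<^sup>+x. ennreal ((\<phi> x)\<^sup>2) \<partial>lborel) = ennreal (LINT x|lborel. (\<phi> x)\<^sup>2)"
      using square_integrableD[OF sq(1)] by (intro nn_integral_eq_integral) auto
    moreover have "(\<integral>\<^sup>+x. ennreal ((norm (grad \<phi> x))\<^sup>2) \<partial>lborel) = ennreal (LINT x|lborel. (norm (grad \<phi> x))\<^sup>2)"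
      using square_integrableD[OF sq(2)] by (intro nn_integral_eq_integral) auto
    moreover have "ennreal ((LINT x|lborel. (\<phi> x)\<^sup>2) + (LINT x|lborel. (\<phi> x)\<^sup>2))
        = ennreal (LINT x|lborel. (\<phi> x)\<^sup>2) + ennreal (LINT x|lborel. (\<phi> x)\<^sup>2)"
      by (intro ennreal_plus Bochner_Integration.integral_nonneg zero_le_power2)
    moreover have "ennreal ((norm w)\<^sup>2 * (LINT x|lborel. (norm (grad \<phi> x))\<^sup>2))
        = ennreal ((norm w)\<^sup>2) * ennreal (LINT x|lborel. (norm (grad \<phi> x))\<^sup>2)"
      by (intro ennreal_mult Bochner_Integration.integral_nonneg zero_le_power2)
    ultimately have "ennreal ((LINT x|lborel. (\<phi> x)\<^sup>2) + (LINT x|lborel. (\<phi> x)\<^sup>2))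
        \<le> ennreal ((norm w)\<^sup>2 * (LINT x|lborel. (norm (grad \<phi> x))\<^sup>2))"
      by (simp only:)
    then have "2 * (LINT x|lborel. (\<phi> x)\<^sup>2) \<le> (norm w)\<^sup>2 * (LINT x|lborel. (norm (grad \<phi> x))\<^sup>2)"
      by (subst (asm) ennreal_le_iff) auto
    then show ?thesis by (simp add: nw power_mult_distrib)
  qed
  moreover have "2 * R\<^sup>2 > 0" using R(1) by simp
  ultimately show ?thesis by blast
qed

text \<open>For \<open>M > 0\<close> this is the half-open grid cube of side \<open>1 / M\<close>
  around \<open>x\<close>. Naming a cube by any of its points replaces an index set of cubes, and
  floors make it jointly measurable in both points.\<close>

definition cell :: "nat \<Rightarrow> 'a::euclidean_space \<Rightarrow> 'a set" where
  "cell M x = {y. \<forall>b\<in>Basis. \<lfloor>real M * (y \<bullet> b)\<rfloor> = \<lfloor>real M * (x \<bullet> b)\<rfloor>}"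

text \<open>The prefactor is the reciprocal of the cell volume; as a function of \<open>x\<close>
  the average is constant on each cell.\<close>

definition cell_average :: "nat \<Rightarrow> ('a::euclidean_space \<Rightarrow> real) \<Rightarrow> 'a \<Rightarrow> real" where
  "cell_average M f x = real M ^ DIM('a) * (LINT y|lborel. indicator (cell M x) y * f y)"

lemma cell_self: "x \<in> cell M x" by (simp add: cell_def)

lemma cell_cong: "y \<in> cell M x \<Longrightarrow> cell M y = cell M x"
  by (auto simp: cell_def)

text \<open>A cell is half-open; an open and a closed box with the same corners enclose it and give
  its volume and coordinate bounds.\<close>

lemma cell_box:
  fixes x :: "'a::euclidean_space"
  assumes "M > 0"
  obtains a c where "box a c \<subseteq> cell M x" "cell M x \<subseteq> cbox a c"
    "\<And>b. b \<in> Basis \<Longrightarrow> (c - a) \<bullet> b = 1 / real M"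
proof
  let ?a = "\<Sum>b\<in>Basis. (of_int \<lfloor>real M * (x \<bullet> b)\<rfloor> / real M) *\<^sub>R b"
  let ?c = "\<Sum>b\<in>Basis. ((of_int \<lfloor>real M * (x \<bullet> b)\<rfloor> + 1) / real M) *\<^sub>R b"
  have *: "\<lfloor>real M * (y \<bullet> b)\<rfloor> = \<lfloor>real M * (x \<bullet> b)\<rfloor> \<longleftrightarrow>
     of_int \<lfloor>real M * (x \<bullet> b)\<rfloor> / real M \<le> y \<bullet> b \<and> y \<bullet> b < (of_int \<lfloor>real M * (x \<bullet> b)\<rfloor> + 1) / real M" for y b
    using assms unfolding floor_eq_iff by (simp add: field_simps)
  show "box ?a ?c \<subseteq> cell M x" unfolding cell_def * by (auto simp: mem_box less_imp_le)
  show "cell M x \<subseteq> cbox ?a ?c" unfolding cell_def * by (auto simp: mem_box less_imp_le)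
  show "(?c - ?a) \<bullet> b = 1 / real M" if "b \<in> Basis" for b
    using that by (simp add: inner_diff_left diff_divide_distrib[symmetric])
qed

lemma cell_measurable [measurable]: "cell M x \<in> sets borel"
proof -
  have "cell M x = (\<Inter>b\<in>Basis. {y. real_of_int \<lfloor>real M * (y \<bullet> b)\<rfloor> = real_of_int \<lfloor>real M * (x \<bullet> b)\<rfloor>})"
    by (auto simp: cell_def)
  also have "\<dots> \<in> sets borel"
    by (intro sets.finite_INT) (auto simp del: of_int_eq_iff)
  finally show ?thesis .
qed

text \<open>The indicator is a finite product of comparisons of floors, one per coordinate. Joint
  measurability is what makes \<open>cell_average\<close> measurable in \<open>x\<close>.\<close>

lemma cell_indicator_measurable [measurable]:
  "(\<lambda>(x, y). indicator (cell M x) y :: real) \<in> borel_measurable (borel \<Otimes>\<^sub>M borel)"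
proof -
  have "(\<lambda>(x, y). indicator (cell M x) y :: real) = (\<lambda>z::'a \<times> 'a. \<Prod>b\<in>Basis.
      if real_of_int \<lfloor>real M * (snd z \<bullet> b)\<rfloor> = real_of_int \<lfloor>real M * (fst z \<bullet> b)\<rfloor> then 1 else 0)"
    by (auto simp: cell_def indicator_def prod_eq_1_iff fun_eq_iff intro!: prod_zero)
  also have "\<dots> \<in> borel_measurable (borel \<Otimes>\<^sub>M borel)" by measurable
  finally show ?thesis .
qed

lemma emeasure_cell:
  fixes x :: "'a::euclidean_space"
  assumes "M > 0"
  shows "emeasure lborel (cell M x) = ennreal ((1 / real M) ^ DIM('a))"
proof -
  obtain a c where ac: "box a c \<subseteq> cell M x" "cell M x \<subseteq> cbox a c"
    "\<And>b. b \<in> Basis \<Longrightarrow> (c - a) \<bullet> b = 1 / real M" using cell_box[OF assms] by blast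
  have le: "a \<bullet> b \<le> c \<bullet> b" if "b \<in> Basis" for b
    using ac(3)[OF that] assms by (simp add: inner_diff_left) (metis diff_ge_0_iff_ge of_nat_0_le_iff zero_le_divide_1_iff)
  have "(\<Prod>b\<in>Basis. (c - a) \<bullet> b) = (\<Prod>b\<in>(Basis::'a set). 1 / real M)" using ac(3) by (intro prod.cong) auto
  then have p: "(\<Prod>b\<in>Basis. (c - a) \<bullet> b) = (1 / real M) ^ DIM('a)" by simp
  have "emeasure lborel (box a c) = ennreal ((1 / real M) ^ DIM('a))"
    "emeasure lborel (cbox a c) = ennreal ((1 / real M) ^ DIM('a))"
    using le p by (simp_all add: emeasure_lborel_box emeasure_lborel_cbox)
  moreover have "emeasure lborel (box a c) \<le> emeasure lborel (cell M x)"
    "emeasure lborel (cell M x) \<le> emeasure lborel (cbox a c)"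
    using ac by (auto intro!: emeasure_mono)
  ultimately show ?thesis by simp
qed

lemma cell_diff:
  assumes "M > 0" "y \<in> cell M x" "b \<in> Basis"
  shows "\<bar>(y - x) \<bullet> b\<bar> \<le> 1 / real M"
proof -
  obtain a c where ac: "cell M x \<subseteq> cbox a c" "(c - a) \<bullet> b = 1 / real M"
    using cell_box[OF assms(1)] assms(3) by metis
  then have "a \<bullet> b \<le> y \<bullet> b" "y \<bullet> b \<le> c \<bullet> b" "a \<bullet> b \<le> x \<bullet> b" "x \<bullet> b \<le> c \<bullet> b"
    using assms(2,3) cell_self[of x M] by (auto simp: mem_box)
  then show ?thesis using ac(2) by (simp add: inner_diff_left)
qed

lemma integrable_cell:
  fixes f :: "'a::euclidean_space \<Rightarrow> real"
  assumes "M > 0" and [measurable]: "f \<in> borel_measurable borel" and B: "\<And>y. \<bar>f y\<bar> \<le> B"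
  shows "integrable lborel (\<lambda>y. indicator (cell M x) y * f y)"
proof -
  have "integrable lborel (\<lambda>y. B * indicator (cell M x) y)"
    using emeasure_cell[OF assms(1), of x] by (intro integrable_mult_right integrable_real_indicator) auto
  then show ?thesis
    by (rule Bochner_Integration.integrable_bound)
       (use B in \<open>auto intro!: AE_I2 simp: indicator_def intro: order_trans[OF _ abs_ge_self]\<close>)
qed

lemma integral_cell_indicator:
  "M > 0 \<Longrightarrow> (LINT y|lborel. indicator (cell M x) y) = (1 / real M) ^ DIM('a)"
  for x :: "'a::euclidean_space"
  by (simp add: measure_def emeasure_cell)

text \<open>The variance argument again, now on a cell; boundedness of \<open>f\<close> supplies
  integrability.\<close>

lemma cell_average_jensen:
  fixes f :: "'a::euclidean_space \<Rightarrow> real"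
  assumes M: "M > 0" and [measurable]: "f \<in> borel_measurable borel" and B: "\<And>y. \<bar>f y\<bar> \<le> B"
  shows "(cell_average M f x)\<^sup>2 \<le> cell_average M (\<lambda>y. (f y)\<^sup>2) x"
proof -
  let ?I = "\<lambda>f::'a \<Rightarrow> real. LINT y|lborel. indicator (cell M x) y * f y"
  define V where "V = (1 / real M) ^ DIM('a)"
  have V: "V > 0" "real M ^ DIM('a) = 1 / V" using M by (simp_all add: V_def power_one_over)
  define m where "m = ?I f / V"
  have i: "integrable lborel (\<lambda>y. indicator (cell M x) y * f y)"
    by (rule integrable_cell[OF M _ B]) measurable
  have "\<bar>(f y)\<^sup>2\<bar> \<le> B\<^sup>2" for y using B[of y] power_mono[of "\<bar>f y\<bar>" B 2] by simp
  then have i2: "integrable lborel (\<lambda>y. indicator (cell M x) y * (f y)\<^sup>2)"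
    by (intro integrable_cell[OF M]) measurable
  have i1: "integrable lborel (\<lambda>y. indicator (cell M x) y :: real)"
    using integrable_cell[OF M, of "\<lambda>_. 1" 1 x] by simp
  have "0 \<le> ?I (\<lambda>y. (f y - m)\<^sup>2)" by (intro Bochner_Integration.integral_nonneg) auto
  also have "?I (\<lambda>y. (f y - m)\<^sup>2) = (LINT y|lborel. indicator (cell M x) y * (f y)\<^sup>2
      - 2 * m * (indicator (cell M x) y * f y) + m\<^sup>2 * indicator (cell M x) y)"
    by (intro Bochner_Integration.integral_cong) (auto simp: power2_eq_square algebra_simps)
  also have "\<dots> = ?I (\<lambda>y. (f y)\<^sup>2) - 2 * m * ?I f + m\<^sup>2 * V"
    using i i2 i1 integral_cell_indicator[OF M, of x] by (simp add: V_def)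
  also have "?I f = m * V" using V by (simp add: m_def)
  also have "2 * m * (m * V) = 2 * (m\<^sup>2 * V)" by (simp add: power2_eq_square)
  finally have "m\<^sup>2 * V \<le> ?I (\<lambda>y. (f y)\<^sup>2)" by linarith
  then have "m\<^sup>2 \<le> ?I (\<lambda>y. (f y)\<^sup>2) / V" using V by (simp add: field_simps)
  then show ?thesis by (simp add: cell_average_def V(2) m_def)
qed

lemma cell_average_measurable [measurable]:
  fixes f :: "'a::euclidean_space \<Rightarrow> real"
  assumes [measurable]: "f \<in> borel_measurable borel"
  shows "cell_average M f \<in> borel_measurable borel"
proof -
  have "(\<lambda>(x, y). indicator (cell M x) y * f y) \<in> borel_measurable (borel \<Otimes>\<^sub>M lborel)"
    unfolding split_beta' using cell_indicator_measurable[of M, unfolded split_beta'] by measurable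
  then show ?thesis
    unfolding cell_average_def[abs_def]
    by (intro borel_measurable_times borel_measurable_const lborel.borel_measurable_lebesgue_integral)
qed

lemma test_bounded:
  assumes "\<phi> \<in> test_functions D" obtains B where "B > 0" "\<And>x. \<bar>\<phi> x\<bar> \<le> B" "\<And>x. norm (grad \<phi> x) \<le> B"
proof -
  obtain R where R: "\<And>x. norm x \<ge> R \<Longrightarrow> \<phi> x = 0" "\<And>x. norm x \<ge> R \<Longrightarrow> grad \<phi> x = 0"
    using test_bounded_support[OF assms] by metis
  have c: "continuous_on (cball 0 R) \<phi>" "continuous_on (cball 0 R) (grad \<phi>)"
    using continuous_on_subset[OF C_k_continuous[OF test_C_k[OF assms]]] continuous_on_grad[OF test_C_k[OF assms]]
    by auto
  then have "bounded (\<phi> ` cball 0 R)" "bounded (grad \<phi> ` cball 0 R)"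
    by (auto intro!: compact_imp_bounded compact_continuous_image)
  then obtain B1 B2 where B: "B1 > 0" "\<And>x. x \<in> cball 0 R \<Longrightarrow> norm (\<phi> x) \<le> B1"
    "\<And>x. x \<in> cball 0 R \<Longrightarrow> norm (grad \<phi> x) \<le> B2"
    unfolding bounded_pos ball_simps by metis
  have "\<bar>\<phi> x\<bar> \<le> max B1 B2 \<and> norm (grad \<phi> x) \<le> max B1 B2" for x
    using B(1) B(2,3)[of x] R[of x] by (cases "norm x \<le> R") (auto simp: le_max_iff_disj)
  then show ?thesis using that[of "max B1 B2"] B(1) by (auto simp: less_max_iff_disj)
qed

text \<open>Jensen reduces the deviation at \<open>x\<close> to squared increments of
  \<open>\<phi>\<close> by vectors \<open>w\<close> in one fixed cube \<open>W\<close>, wherever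
  \<open>x\<close> sits in its cell. Fubini and \<open>translation_estimate\<close> do the rest:
  \<open>2 ^ DIM('a)\<close> is the volume of \<open>W\<close> relative to a cell, and
  \<open>DIM('a) / (real M)\<^sup>2\<close> bounds the squared norm on \<open>W\<close>.\<close>

lemma cell_average_estimate:
  fixes \<phi> :: "'a::euclidean_space \<Rightarrow> real"
  assumes M: "M > 0" and \<phi>: "\<phi> \<in> test_functions D"
  shows "(\<integral>\<^sup>+x. ennreal ((\<phi> x - cell_average M \<phi> x)\<^sup>2) \<partial>lborel)
    \<le> ennreal (2 ^ DIM('a) * DIM('a) / (real M)\<^sup>2) * (\<integral>\<^sup>+x. ennreal ((norm (grad \<phi> x))\<^sup>2) \<partial>lborel)"
proof -
  note sq = test_square_integrable[OF \<phi>]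
  have [measurable]: "\<phi> \<in> borel_measurable borel" using sq by (auto intro: square_integrable_measurable)
  obtain B where B: "B > 0" "\<And>x. \<bar>\<phi> x\<bar> \<le> B" using test_bounded[OF \<phi>] by metis
  define W where "W = cbox (- (1 / real M) *\<^sub>R One) ((1 / real M) *\<^sub>R (One::'a))"
  let ?n = "DIM('a)"
  let ?c = "ennreal (real M ^ ?n)"
  let ?G = "\<integral>\<^sup>+x. ennreal ((norm (grad \<phi> x))\<^sup>2) \<partial>lborel"
  have pw: "ennreal ((\<phi> x - cell_average M \<phi> x)\<^sup>2) \<le> ?c * (\<integral>\<^sup>+w. indicator W w * ennreal ((\<phi> (x + w) - \<phi> x)\<^sup>2) \<partial>lborel)" for x
  proof -
    have b2: "\<bar>\<phi> x - \<phi> y\<bar> \<le> 2 * B" for y using B(2)[of x] B(2)[of y] by linarith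
    have b4: "\<bar>(\<phi> x - \<phi> y)\<^sup>2\<bar> \<le> (2 * B)\<^sup>2" for y
      using power_mono[OF b2[of y], of 2] by simp
    have "\<phi> x - cell_average M \<phi> x = cell_average M (\<lambda>y. \<phi> x - \<phi> y) x"
    proof -
      have "(LINT y|lborel. indicator (cell M x) y * (\<phi> x - \<phi> y)) =
          (LINT y|lborel. \<phi> x * indicator (cell M x) y - indicator (cell M x) y * \<phi> y)"
        by (intro Bochner_Integration.integral_cong) (auto simp: algebra_simps)
      also have "\<dots> = \<phi> x * (1 / real M) ^ ?n - (LINT y|lborel. indicator (cell M x) y * \<phi> y)"
        using integrable_cell[where f = \<phi> and x = x and B = B, OF M _ B(2)] integrable_cell[OF M, of "\<lambda>_. 1" 1 x]
          integral_cell_indicator[OF M, of x] by simp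
      finally show ?thesis using M by (simp add: cell_average_def field_simps power_one_over)
    qed
    then have "(\<phi> x - cell_average M \<phi> x)\<^sup>2 \<le> cell_average M (\<lambda>y. (\<phi> x - \<phi> y)\<^sup>2) x"
      using cell_average_jensen[where f = "\<lambda>y. \<phi> x - \<phi> y" and x = x and B = "2 * B", OF M _ b2] by simp
    then have "ennreal ((\<phi> x - cell_average M \<phi> x)\<^sup>2) \<le> ennreal (cell_average M (\<lambda>y. (\<phi> x - \<phi> y)\<^sup>2) x)"
      by (rule ennreal_leI)
    also have "\<dots> = ?c * ennreal (LINT y|lborel. indicator (cell M x) y * (\<phi> x - \<phi> y)\<^sup>2)"
      unfolding cell_average_def by (intro ennreal_mult Bochner_Integration.integral_nonneg) auto
    also have "ennreal (LINT y|lborel. indicator (cell M x) y * (\<phi> x - \<phi> y)\<^sup>2)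
        = (\<integral>\<^sup>+y. ennreal (indicator (cell M x) y * (\<phi> x - \<phi> y)\<^sup>2) \<partial>lborel)"
      by (intro nn_integral_eq_integral[symmetric] integrable_cell[OF M _ b4]) auto
    also have "\<dots> = (\<integral>\<^sup>+w. ennreal (indicator (cell M x) (w + x) * (\<phi> x - \<phi> (w + x))\<^sup>2) \<partial>lborel)"
      by (rule lborel_nn_integral_translation[symmetric, of "\<lambda>y. ennreal (indicator (cell M x) y * (\<phi> x - \<phi> y)\<^sup>2)"]) measurable
    also have "\<dots> \<le> (\<integral>\<^sup>+w. indicator W w * ennreal ((\<phi> (x + w) - \<phi> x)\<^sup>2) \<partial>lborel)"
    proof (intro nn_integral_mono)
      fix w
      have "w \<in> W" if "w + x \<in> cell M x"
        using cell_diff[OF M that] by (auto simp: W_def mem_box abs_le_iff minus_le_iff)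
      then show "ennreal (indicator (cell M x) (w + x) * (\<phi> x - \<phi> (w + x))\<^sup>2) \<le> indicator W w * ennreal ((\<phi> (x + w) - \<phi> x)\<^sup>2)"
        by (auto simp: indicator_def power2_commute add.commute)
    qed
    finally show ?thesis by (simp add: mult_left_mono)
  qed
  have "(\<integral>\<^sup>+x. ennreal ((\<phi> x - cell_average M \<phi> x)\<^sup>2) \<partial>lborel)
      \<le> (\<integral>\<^sup>+x. ?c * (\<integral>\<^sup>+w. indicator W w * ennreal ((\<phi> (x + w) - \<phi> x)\<^sup>2) \<partial>lborel) \<partial>lborel)"
    by (intro nn_integral_mono pw)
  also have "\<dots> = ?c * (\<integral>\<^sup>+x. \<integral>\<^sup>+w. indicator W w * ennreal ((\<phi> (x + w) - \<phi> x)\<^sup>2) \<partial>lborel \<partial>lborel)"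
    unfolding W_def by (intro nn_integral_cmult) measurable
  also have "(\<integral>\<^sup>+x. \<integral>\<^sup>+w. indicator W w * ennreal ((\<phi> (x + w) - \<phi> x)\<^sup>2) \<partial>lborel \<partial>lborel)
      = (\<integral>\<^sup>+w. \<integral>\<^sup>+x. indicator W w * ennreal ((\<phi> (x + w) - \<phi> x)\<^sup>2) \<partial>lborel \<partial>lborel)"
    unfolding W_def by (rule lborel_pair.Fubini'[symmetric]) measurable
  also have "\<dots> \<le> (\<integral>\<^sup>+w. indicator W w * (ennreal (?n / (real M)\<^sup>2) * ?G) \<partial>lborel)"
  proof (intro nn_integral_mono)
    fix w :: 'a
    have "(\<integral>\<^sup>+x. indicator W w * ennreal ((\<phi> (x + w) - \<phi> x)\<^sup>2) \<partial>lborel) = indicator W w * (\<integral>\<^sup>+x. ennreal ((\<phi> (x + w) - \<phi> x)\<^sup>2) \<partial>lborel)"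
      by (intro nn_integral_cmult) measurable
    also have "\<dots> \<le> indicator W w * (ennreal ((norm w)\<^sup>2) * ?G)"
      by (intro mult_left_mono translation_estimate[OF test_C_k[OF \<phi>]]) auto
    also have "\<dots> \<le> indicator W w * (ennreal (?n / (real M)\<^sup>2) * ?G)"
    proof (cases "w \<in> W")
      case True
      have "\<bar>w \<bullet> b\<bar> \<le> 1 / real M" if "b \<in> Basis" for b
        using True that by (auto simp: W_def mem_box abs_le_iff minus_le_iff)
      then have "(w \<bullet> b)\<^sup>2 \<le> (1 / real M)\<^sup>2" if "b \<in> Basis" for b
        using that power_mono[of "\<bar>w \<bullet> b\<bar>" "1 / real M" 2] by simp
      then have "(\<Sum>b\<in>Basis. (w \<bullet> b)\<^sup>2) \<le> (\<Sum>b\<in>(Basis::'a set). (1 / real M)\<^sup>2)" by (intro sum_mono) auto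
      then have "(norm w)\<^sup>2 \<le> ?n / (real M)\<^sup>2"
        by (simp add: power2_norm_eq_inner euclidean_inner[of w w] power_divide flip: power2_eq_square)
      then show ?thesis by (intro mult_left_mono mult_right_mono ennreal_leI) auto
    qed simp
    finally show "(\<integral>\<^sup>+x. indicator W w * ennreal ((\<phi> (x + w) - \<phi> x)\<^sup>2) \<partial>lborel) \<le> indicator W w * (ennreal (?n / (real M)\<^sup>2) * ?G)" .
  qed
  also have "\<dots> = emeasure lborel W * (ennreal (?n / (real M)\<^sup>2) * ?G)"
    unfolding W_def by (subst nn_integral_multc) auto
  also have "emeasure lborel W = ennreal ((2 / real M) ^ ?n)"
  proof -
    have "(\<Prod>b\<in>(Basis::'a set). ((1 / real M) *\<^sub>R One - - (1 / real M) *\<^sub>R One) \<bullet> b) = (\<Prod>b\<in>(Basis::'a set). 2 / real M)"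
      by (intro prod.cong) (auto simp: inner_diff_left inner_add_left)
    then show ?thesis unfolding W_def emeasure_lborel_cbox_eq by (auto simp: order_trans[of _ 0])
  qed
  also have "?c * (ennreal ((2 / real M) ^ ?n) * (ennreal (?n / (real M)\<^sup>2) * ?G)) = ennreal (2 ^ ?n * ?n / (real M)\<^sup>2) * ?G"
  proof -
    have "real M ^ ?n * ((2 / real M) ^ ?n * (?n / (real M)\<^sup>2)) = 2 ^ ?n * ?n / (real M)\<^sup>2"
      using M by (simp add: power_divide)
    then have "?c * (ennreal ((2 / real M) ^ ?n) * ennreal (?n / (real M)\<^sup>2)) = ennreal (2 ^ ?n * ?n / (real M)\<^sup>2)"
      by (simp flip: ennreal_mult)
    then show ?thesis by (simp add: mult.assoc[symmetric])
  qed
  finally show ?thesis by (simp add: mult_left_mono)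
qed

section \<open>Rellich compactness by averaging over cells\<close>

lemma diagonal_convergent_subsequence:
  fixes s :: "nat \<Rightarrow> nat \<Rightarrow> real"
  assumes "\<And>i. bounded (range (\<lambda>n. s n i))"
  shows "\<exists>r. strict_mono r \<and> (\<forall>i. convergent (\<lambda>n. s (r n) i))"
proof -
  interpret subseqs "\<lambda>i r. convergent (\<lambda>n. s (r n) i)"
  proof
    fix i and r :: "nat \<Rightarrow> nat" assume "strict_mono r"
    have "bounded (range (\<lambda>n. s (r n) i))" by (rule bounded_subset[OF assms[of i]]) auto
    then obtain l r' where "strict_mono r'" "((\<lambda>n. s (r n) i) \<circ> r') \<longlonglongrightarrow> l"
      using bounded_imp_convergent_subsequence by blast
    then show "\<exists>r'. strict_mono r' \<and> convergent (\<lambda>n. s ((r \<circ> r') n) i)"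
      by (auto simp: o_def convergent_def)
  qed
  have "convergent (\<lambda>n. s (diagseq n) i)" for i
  proof -
    have "convergent (\<lambda>n. s ((diagseq \<circ> (+) (Suc i)) n) i)"
    proof (rule diagseq_holds)
      fix r t :: "nat \<Rightarrow> nat" and n assume "strict_mono r" "convergent (\<lambda>m. s (t m) n)"
      then show "convergent (\<lambda>m. s ((t \<circ> r) m) n)"
        using convergent_subseq_convergent[of "\<lambda>m. s (t m) n" r] by (simp add: o_def)
    qed
    then obtain l where "(\<lambda>n. s (diagseq (n + Suc i)) i) \<longlonglongrightarrow> l"
      by (auto simp: convergent_def add.commute)
    then have "(\<lambda>n. s (diagseq n) i) \<longlonglongrightarrow> l" by (rule LIMSEQ_offset)
    then show ?thesis by (auto simp: convergent_def)
  qed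
  then show ?thesis using subseq_diagseq by blast
qed

text \<open>From \<open>\<bar>f y\<bar> \<le> 1 + (f y)\<^sup>2\<close> and a cell volume of at most
  1. The bound is crude but involves \<open>f\<close> only through its L2 norm.\<close>

lemma cell_integral_bound:
  fixes f :: "'a::euclidean_space \<Rightarrow> real"
  assumes M: "M > 0" and f: "square_integrable f"
  shows "\<bar>LINT y|lborel. indicator (cell M x) y * f y\<bar> \<le> 1 + (LINT y|lborel. (f y)\<^sup>2)"
proof -
  have [measurable]: "f \<in> borel_measurable borel" using f by (rule square_integrable_measurable)
  have i1: "integrable lborel (\<lambda>y. indicator (cell M x) y :: real)"
    using integrable_cell[OF M, of "\<lambda>_. 1" 1 x] by simp
  have i2: "integrable lborel (\<lambda>y. (f y)\<^sup>2)" using square_integrableD[OF f] by simp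
  have "\<bar>LINT y|lborel. indicator (cell M x) y * f y\<bar> \<le> (LINT y|lborel. indicator (cell M x) y + (f y)\<^sup>2)"
  proof (rule order_trans[OF integral_abs_bound integral_mono'])
    show "integrable lborel (\<lambda>y. indicator (cell M x) y + (f y)\<^sup>2)" using i1 i2 by simp
    fix y
    have "\<bar>f y\<bar> \<le> 1 + (f y)\<^sup>2" using sum_squares_bound[of "\<bar>f y\<bar>" 1] by simp
    then show "\<bar>indicator (cell M x) y * f y\<bar> \<le> indicator (cell M x) y + (f y)\<^sup>2"
      by (auto simp: indicator_def)
  qed auto
  also have "\<dots> = (1 / real M) ^ DIM('a) + (LINT y|lborel. (f y)\<^sup>2)"
    using i1 i2 integral_cell_indicator[OF M, of x] by simp
  also have "(1 / real M) ^ DIM('a) \<le> 1" using M by (intro power_le_one) auto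
  finally show ?thesis by simp
qed

lemma cell_average_split:
  fixes \<phi> :: "'a::euclidean_space \<Rightarrow> real"
  assumes M: "M > 0" and \<phi>: "\<phi> \<in> test_functions D"
    and i: "integrable lborel (\<lambda>x. (cell_average M \<phi> x)\<^sup>2)"
  shows "(LINT x|lborel. (\<phi> x)\<^sup>2) \<le> 2 * (2 ^ DIM('a) * DIM('a) / (real M)\<^sup>2) * (LINT x|lborel. (norm (grad \<phi> x))\<^sup>2)
    + 2 * (LINT x|lborel. (cell_average M \<phi> x)\<^sup>2)"
proof -
  note sq = test_square_integrable[OF \<phi>]
  let ?A = "cell_average M \<phi>" and ?K = "2 ^ DIM('a) * DIM('a) / (real M)\<^sup>2"
  have [measurable]: "\<phi> \<in> borel_measurable borel" using sq by (auto intro: square_integrable_measurable)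
  have A: "square_integrable ?A" using i by (simp add: square_integrable_def)
  have D: "integrable lborel (\<lambda>x. (\<phi> x - ?A x)\<^sup>2)"
    using square_integrableD[OF square_integrable_diff[OF sq(1) A]] by simp
  have "ennreal (LINT x|lborel. (\<phi> x - ?A x)\<^sup>2) = (\<integral>\<^sup>+x. ennreal ((\<phi> x - ?A x)\<^sup>2) \<partial>lborel)"
    by (rule nn_integral_eq_integral[symmetric, OF D]) auto
  also have "\<dots> \<le> ennreal ?K * (\<integral>\<^sup>+x. ennreal ((norm (grad \<phi> x))\<^sup>2) \<partial>lborel)"
    by (rule cell_average_estimate[OF M \<phi>])
  also have "(\<integral>\<^sup>+x. ennreal ((norm (grad \<phi> x))\<^sup>2) \<partial>lborel) = ennreal (LINT x|lborel. (norm (grad \<phi> x))\<^sup>2)"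
    by (rule nn_integral_eq_integral[OF square_integrableD[OF sq(2)]]) auto
  also have "ennreal ?K * \<dots> = ennreal (?K * (LINT x|lborel. (norm (grad \<phi> x))\<^sup>2))"
    by (intro ennreal_mult[symmetric] Bochner_Integration.integral_nonneg) auto
  finally have 1: "(LINT x|lborel. (\<phi> x - ?A x)\<^sup>2) \<le> ?K * (LINT x|lborel. (norm (grad \<phi> x))\<^sup>2)"
    by (subst (asm) ennreal_le_iff) (auto intro!: mult_nonneg_nonneg Bochner_Integration.integral_nonneg)
  have "(LINT x|lborel. (\<phi> x)\<^sup>2) \<le> (LINT x|lborel. 2 * (\<phi> x - ?A x)\<^sup>2 + 2 * (?A x)\<^sup>2)"
  proof (rule integral_mono)
    show "integrable lborel (\<lambda>x. (\<phi> x)\<^sup>2)" using square_integrableD[OF sq(1)] by simp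
    show "(\<phi> x)\<^sup>2 \<le> 2 * (\<phi> x - ?A x)\<^sup>2 + 2 * (?A x)\<^sup>2" for x
      using norm_add_sq_le[of "\<phi> x - ?A x" "?A x"] by simp
  qed (use D i in auto)
  also have "\<dots> = 2 * (LINT x|lborel. (\<phi> x - ?A x)\<^sup>2) + 2 * (LINT x|lborel. (?A x)\<^sup>2)"
    using D i by simp
  finally show ?thesis using 1 by simp
qed

lemma cell_bounded_distance:
  fixes x :: "'a::euclidean_space"
  assumes "M > 0" "y \<in> cell M x" shows "norm (y - x) \<le> DIM('a)"
proof -
  have "norm (y - x) \<le> (\<Sum>b\<in>Basis. \<bar>(y - x) \<bullet> b\<bar>)" by (rule norm_le_l1)
  also have "\<dots> \<le> (\<Sum>b\<in>(Basis::'a set). 1)"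
  proof (intro sum_mono)
    fix b :: 'a assume "b \<in> Basis"
    then have "\<bar>(y - x) \<bullet> b\<bar> \<le> 1 / real M" by (rule cell_diff[OF assms])
    also have "\<dots> \<le> 1" using assms(1) by simp
    finally show "\<bar>(y - x) \<bullet> b\<bar> \<le> 1" .
  qed
  finally show ?thesis by simp
qed

text \<open>The L2 bound makes the averages uniformly bounded, and they vanish outside a common
  ball, so dominated convergence applies.\<close>

lemma cell_averages_tendsto_L2:
  fixes f :: "nat \<Rightarrow> 'a::euclidean_space \<Rightarrow> real"
  assumes M: "M > 0" and D: "bounded D" and f: "\<And>n. f n \<in> test_functions D"
    and bd: "\<And>n. (LINT x|lborel. (f n x)\<^sup>2) \<le> B"
    and lim: "\<And>x. (\<lambda>n. cell_average M (f n) x) \<longlonglongrightarrow> 0"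
  shows "integrable lborel (\<lambda>x. (cell_average M (f n) x)\<^sup>2)"
    and "(\<lambda>n. LINT x|lborel. (cell_average M (f n) x)\<^sup>2) \<longlonglongrightarrow> 0"
proof -
  obtain R where R: "\<And>x. x \<in> D \<Longrightarrow> norm x \<le> R" using D by (auto simp: bounded_iff)
  have [measurable]: "f n \<in> borel_measurable borel" for n
    using test_square_integrable(1)[OF f] by (rule square_integrable_measurable)
  define c where "c = real M ^ DIM('a) * (1 + B)"
  have bound: "\<bar>cell_average M (f n) x\<bar> \<le> c" for n x
  proof -
    have "\<bar>LINT y|lborel. indicator (cell M x) y * f n y\<bar> \<le> 1 + B"
      using cell_integral_bound[OF M test_square_integrable(1)[OF f], of x n] bd[of n] by simp
    then show ?thesis unfolding cell_average_def c_def abs_mult by (intro mult_mono) auto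
  qed
  have zero: "cell_average M (f n) x = 0" if x: "norm x > R + DIM('a)" for n x
  proof -
    have "indicator (cell M x) y * f n y = 0" for y
    proof (cases "y \<in> cell M x")
      case True
      have "y \<notin> D" using cell_bounded_distance[OF M True] R[of y] x norm_triangle_ineq4[of y "y - x"] by auto
      then show ?thesis using test_vanishes_outside(1)[OF f] by simp
    qed simp
    then have "(\<lambda>y. indicator (cell M x) y * f n y) = (\<lambda>y. 0)" by blast
    then show ?thesis unfolding cell_average_def by (simp only:) simp
  qed
  let ?w = "\<lambda>x::'a. c\<^sup>2 * indicator (cball 0 (R + DIM('a))) x"
  have w: "integrable lborel ?w"
    using emeasure_bounded_finite[OF bounded_cball, of "0::'a" "R + DIM('a)"]
    by (intro integrable_mult_right integrable_real_indicator) auto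
  have le: "norm ((cell_average M (f n) x)\<^sup>2) \<le> ?w x" for n x
  proof (cases "norm x > R + DIM('a)")
    case False
    have "\<bar>cell_average M (f n) x\<bar>\<^sup>2 \<le> c\<^sup>2" using bound by (intro power_mono) auto
    then show ?thesis using False by (simp add: indicator_def)
  qed (simp add: zero)
  show "integrable lborel (\<lambda>x. (cell_average M (f n) x)\<^sup>2)"
    by (rule Bochner_Integration.integrable_bound[OF w])
       (use le in \<open>auto intro!: AE_I2 intro: order_trans[OF _ abs_ge_self]\<close>)
  have "(\<lambda>n. LINT x|lborel. (cell_average M (f n) x)\<^sup>2) \<longlonglongrightarrow> integral\<^sup>L lborel (\<lambda>x::'a. 0 :: real)"
  proof (rule integral_dominated_convergence[where w = ?w])
    show "AE x in lborel. (\<lambda>n. (cell_average M (f n) x)\<^sup>2) \<longlonglongrightarrow> 0"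
      using tendsto_power[OF lim, of _ 2] by (intro AE_I2) simp
    show "AE x in lborel. norm ((cell_average M (f n) x)\<^sup>2) \<le> ?w x" for n
      by (intro AE_I2 le)
  qed (use w in auto)
  then show "(\<lambda>n. LINT x|lborel. (cell_average M (f n) x)\<^sup>2) \<longlonglongrightarrow> 0" by simp
qed

lemma cell_average_diff:
  fixes f g :: "'a::euclidean_space \<Rightarrow> real"
  assumes M: "M > 0" and f: "f \<in> test_functions D" "g \<in> test_functions D"
  shows "cell_average M (\<lambda>x. f x - g x) x = cell_average M f x - cell_average M g x"
proof -
  have int: "integrable lborel (\<lambda>y. indicator (cell M x) y * h y)" if h: "h \<in> test_functions D" for h
  proof -
    have [measurable]: "h \<in> borel_measurable borel"
      using test_square_integrable(1)[OF h] by (rule square_integrable_measurable)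
    obtain B where "\<And>x. \<bar>h x\<bar> \<le> B" using test_bounded[OF h] by metis
    then show ?thesis by (intro integrable_cell[OF M]) auto
  qed
  show ?thesis unfolding cell_average_def right_diff_distrib
    using int[OF f(1)] int[OF f(2)] by (simp add: right_diff_distrib)
qed

text \<open>An average depends only on \<open>M\<close> and the cell, and each cell contains a point
  of a countable dense set. Countably many bounded sequences thus determine all averages, and a
  diagonal subsequence serves them at once.\<close>

lemma convergent_cell_averages_subsequence:
  fixes \<phi> :: "nat \<Rightarrow> 'a::euclidean_space \<Rightarrow> real"
  assumes \<phi>: "\<And>n. \<phi> n \<in> test_functions D" and bd: "\<And>n. (LINT x|lborel. (\<phi> n x)\<^sup>2) \<le> B"
  shows "\<exists>r. strict_mono r \<and> (\<forall>M>0. \<forall>x. convergent (\<lambda>n. cell_average M (\<phi> (r n)) x))"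
proof -
  obtain X :: "'a set" where X: "countable X" "\<And>Y. open Y \<Longrightarrow> Y \<noteq> {} \<Longrightarrow> \<exists>d\<in>X. d \<in> Y"
    using countable_dense_setE by metis
  define I where "I = (UNIV :: nat set) \<times> X"
  have I: "countable I" "I \<noteq> {}" using X(1) X(2)[of UNIV] unfolding I_def by auto
  \<comment> \<open>\<open>Suc\<close> turns the first component of an enumerated pair into a
    positive \<open>M\<close>; the pair \<open>(M - 1, d)\<close> later undoes this shift.\<close>
  define s where "s = (\<lambda>n i. cell_average (Suc (fst (from_nat_into I i))) (\<phi> n) (snd (from_nat_into I i)))"
  have "bounded (range (\<lambda>n. s n i))" for i
    unfolding bounded_iff
  proof (intro exI ballI)
    fix y assume "y \<in> range (\<lambda>n. s n i)"
    then obtain n where n: "y = s n i" by auto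
    let ?M = "Suc (fst (from_nat_into I i))" and ?x = "snd (from_nat_into I i)"
    have "\<bar>LINT y|lborel. indicator (cell ?M ?x) y * \<phi> n y\<bar> \<le> 1 + B"
      using cell_integral_bound[OF _ test_square_integrable(1)[OF \<phi>], of ?M ?x n] bd[of n] by simp
    then show "norm y \<le> real ?M ^ DIM('a) * (1 + B)"
      unfolding n s_def cell_average_def real_norm_def abs_mult by (intro mult_mono) auto
  qed
  then obtain r where r: "strict_mono r" "\<And>i. convergent (\<lambda>n. s (r n) i)"
    using diagonal_convergent_subsequence by metis
  have "convergent (\<lambda>n. cell_average M (\<phi> (r n)) x)" if M: "M > 0" for M x
  proof -
    obtain a c where ac: "box a c \<subseteq> cell M x" "\<And>b. b \<in> Basis \<Longrightarrow> (c - a) \<bullet> b = 1 / real M"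
      using cell_box[OF M] by metis
    have "box a c \<noteq> {}"
    proof -
      have "a \<bullet> b < c \<bullet> b" if "b \<in> Basis" for b
      proof -
        have "c \<bullet> b - a \<bullet> b > 0" using ac(2)[OF that] M by (simp add: inner_diff_left)
        then show ?thesis by simp
      qed
      then show ?thesis by (simp add: box_ne_empty)
    qed
    then obtain d where d: "d \<in> X" "d \<in> box a c" using X(2)[of "box a c"] by auto
    then have "cell M d = cell M x" using ac(1) by (intro cell_cong) auto
    moreover obtain i where "from_nat_into I i = (M - 1, d)"
      using from_nat_into_surj[OF I(1), of "(M - 1, d)"] d(1) by (auto simp: I_def)
    ultimately have "s (r n) i = cell_average M (\<phi> (r n)) x" for n
      using M by (simp add: s_def cell_average_def)
    then show ?thesis using r(2)[of i] by simp
  qed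
  with r(1) show ?thesis by blast
qed

text \<open>Take a subsequence with convergent averages. Were it not L2-Cauchy, there would be
  differences \<open>f N\<close> with bounded gradients and averages tending to 0, but L2 norms
  bounded below. A fine grid makes the deviation from the averages small, and then a late
  \<open>N\<close> the averages themselves.\<close>

theorem rellich_test_functions:
  fixes \<phi> :: "nat \<Rightarrow> 'a::euclidean_space \<Rightarrow> real"
  assumes D: "bounded D" and \<phi>: "\<And>n. \<phi> n \<in> test_functions D"
    and bd: "\<And>n. (LINT x|lborel. (norm (grad (\<phi> n) x))\<^sup>2) \<le> B"
  shows "\<exists>r::nat \<Rightarrow> nat. strict_mono r \<and>
    (\<forall>e>0. \<exists>N. \<forall>m\<ge>N. \<forall>n\<ge>N. (LINT x|lborel. (\<phi> (r m) x - \<phi> (r n) x)\<^sup>2) < e)"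
proof -
  obtain C where C: "C > 0" "\<And>\<phi>. \<phi> \<in> test_functions D \<Longrightarrow> (LINT x|lborel. (\<phi> x)\<^sup>2) \<le> C * (LINT x|lborel. (norm (grad \<phi> x))\<^sup>2)"
    using poincare_test_functions[OF D] by blast
  have bd2: "(LINT x|lborel. (\<phi> n x)\<^sup>2) \<le> C * B" for n
    by (rule order_trans[OF C(2)[OF \<phi>] mult_left_mono[OF bd less_imp_le[OF C(1)]]])
  obtain r where r: "strict_mono r" "\<And>M x. M > 0 \<Longrightarrow> convergent (\<lambda>n. cell_average M (\<phi> (r n)) x)"
    using convergent_cell_averages_subsequence[of \<phi> D "C * B", OF \<phi> bd2] by blast
  have "\<exists>N. \<forall>m\<ge>N. \<forall>n\<ge>N. (LINT x|lborel. (\<phi> (r m) x - \<phi> (r n) x)\<^sup>2) < e" if e: "e > 0" for e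
  proof (rule ccontr)
    assume "\<not> ?thesis"
    then have "\<forall>N. \<exists>m n. m \<ge> N \<and> n \<ge> N \<and> (LINT x|lborel. (\<phi> (r m) x - \<phi> (r n) x)\<^sup>2) \<ge> e"
      by (meson not_le)
    then obtain p q where pq: "\<And>N. p N \<ge> N" "\<And>N. q N \<ge> N"
      "\<And>N. (LINT x|lborel. (\<phi> (r (p N)) x - \<phi> (r (q N)) x)\<^sup>2) \<ge> e" by metis
    define f where "f = (\<lambda>N x. \<phi> (r (p N)) x - \<phi> (r (q N)) x)"
    have fT: "f N \<in> test_functions D" for N unfolding f_def by (intro test_functions_diff \<phi>)
    have grad_f: "(LINT x|lborel. (norm (grad (f N) x))\<^sup>2) \<le> 4 * B" for N
    proof -
      have i: "integrable lborel (\<lambda>x. (norm (grad (\<phi> n) x))\<^sup>2)" for n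
        using square_integrableD[OF test_square_integrable(2)[OF \<phi>]] .
      have "(LINT x|lborel. (norm (grad (f N) x))\<^sup>2) \<le>
          (LINT x|lborel. 2 * (norm (grad (\<phi> (r (p N))) x))\<^sup>2 + 2 * (norm (grad (\<phi> (r (q N))) x))\<^sup>2)"
      proof (rule integral_mono)
        show "integrable lborel (\<lambda>x. (norm (grad (f N) x))\<^sup>2)"
          using square_integrableD[OF test_square_integrable(2)[OF fT]] .
        show "(norm (grad (f N) x))\<^sup>2 \<le> 2 * (norm (grad (\<phi> (r (p N))) x))\<^sup>2 + 2 * (norm (grad (\<phi> (r (q N))) x))\<^sup>2" for x
          unfolding f_def grad_diff[OF test_C_k[OF \<phi>] test_C_k[OF \<phi>]]
          using norm_add_sq_le[of "grad (\<phi> (r (p N))) x" "- grad (\<phi> (r (q N))) x"] by simp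
      qed (use i in auto)
      also have "\<dots> = 2 * (LINT x|lborel. (norm (grad (\<phi> (r (p N))) x))\<^sup>2) + 2 * (LINT x|lborel. (norm (grad (\<phi> (r (q N))) x))\<^sup>2)"
        using i by simp
      also have "\<dots> \<le> 4 * B" using bd[of "r (p N)"] bd[of "r (q N)"] by simp
      finally show ?thesis .
    qed
    have f2: "(LINT x|lborel. (f N x)\<^sup>2) \<le> C * (4 * B)" for N
      by (rule order_trans[OF C(2)[OF fT] mult_left_mono[OF grad_f less_imp_le[OF C(1)]]])
    have lim: "(\<lambda>N. cell_average M (f N) x) \<longlonglongrightarrow> 0" if M: "M > 0" for M x
    proof -
      obtain l where l: "(\<lambda>n. cell_average M (\<phi> (r n)) x) \<longlonglongrightarrow> l"
        using r(2)[OF M] unfolding convergent_def by blast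
      have "filterlim p at_top sequentially" "filterlim q at_top sequentially"
        using pq by (auto intro!: filterlim_at_top_mono[OF filterlim_ident] always_eventually)
      then have "(\<lambda>N. cell_average M (\<phi> (r (p N))) x - cell_average M (\<phi> (r (q N))) x) \<longlonglongrightarrow> l - l"
        by (intro tendsto_diff filterlim_compose[OF l])
      then show ?thesis unfolding f_def by (simp add: cell_average_diff[OF M \<phi> \<phi>])
    qed
    \<comment> \<open>The constant of \<open>cell_average_split\<close> times the gradient bound.
      The absolute value keeps it nonnegative, and \<open>M > 2 * K / e\<close> brings
      \<open>K / (real M)\<^sup>2\<close> below \<open>e / 2\<close>.\<close>
    define K where "K = 2 * (2 ^ DIM('a) * DIM('a)) * (4 * \<bar>B\<bar>)"
    have K: "K \<ge> 0" unfolding K_def by simp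
    obtain M :: nat where M: "M > 2 * K / e" using reals_Archimedean2 by blast
    have "2 * K / e \<ge> 0" using K e by simp
    then have M0: "M > 0" using M by (cases "M = 0") auto
    have KM: "K / (real M)\<^sup>2 < e / 2"
    proof -
      have "K / (real M)\<^sup>2 \<le> K / real M"
        using K M0 by (intro divide_left_mono) (auto simp: power2_eq_square)
      also have "\<dots> < e / 2" using M M0 e by (simp add: field_simps)
      finally show ?thesis .
    qed
    note avg = cell_averages_tendsto_L2[of M D f, OF M0 D fT f2 lim[OF M0]]
    have "\<forall>\<^sub>F N in sequentially. (LINT x|lborel. (cell_average M (f N) x)\<^sup>2) < e / 4"
      using order_tendstoD(2)[OF avg(2), of "e/4"] e by simp
    then obtain N where N: "(LINT x|lborel. (cell_average M (f N) x)\<^sup>2) < e / 4"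
      by (auto simp: eventually_sequentially)
    have "e \<le> (LINT x|lborel. (f N x)\<^sup>2)" using pq(3)[of N] by (simp add: f_def)
    also have "\<dots> \<le> 2 * (2 ^ DIM('a) * DIM('a) / (real M)\<^sup>2) * (LINT x|lborel. (norm (grad (f N) x))\<^sup>2)
        + 2 * (LINT x|lborel. (cell_average M (f N) x)\<^sup>2)"
      by (rule cell_average_split[OF M0 fT avg(1)])
    also have "2 * (2 ^ DIM('a) * DIM('a) / (real M)\<^sup>2) * (LINT x|lborel. (norm (grad (f N) x))\<^sup>2)
        \<le> 2 * (2 ^ DIM('a) * DIM('a) / (real M)\<^sup>2) * (4 * \<bar>B\<bar>)"
      using grad_f[of N] by (intro mult_left_mono) auto
    also have "\<dots> = K / (real M)\<^sup>2" by (simp add: K_def)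
    finally show False using KM N by simp
  qed
  with r(1) show ?thesis by blast
qed

section \<open>The Sobolev space with zero boundary values\<close>

lemma test_partial_square_integrable:
  assumes "\<phi> \<in> test_functions D" "b \<in> Basis"
  shows "square_integrable (\<lambda>x. frechet_derivative \<phi> (at x) b)"
  using square_integrable_component[OF test_square_integrable(2)[OF assms(1)], of b] assms(2)
  by (simp add: grad_inner_Basis)

text \<open>Both candidates have equal integrals against test functions, so the fundamental lemma
  applies to each component of their difference.\<close>

lemma weak_gradient_unique:
  fixes g g' :: "'a::euclidean_space \<Rightarrow> 'a"
  assumes g: "square_integrable g" "is_weak_gradient u g"
    and g': "square_integrable g'" "is_weak_gradient u g'"
  shows "AE x in lborel. g x = g' x"
proof -
  have "AE x in lborel. (g x - g' x) \<bullet> b = 0" if b: "b \<in> Basis" for b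
  proof (rule AE_zero_if_orthogonal_to_test_functions)
    show "square_integrable (\<lambda>x. (g x - g' x) \<bullet> b)"
      by (intro square_integrable_component square_integrable_diff g g')
    fix \<phi> :: "'a \<Rightarrow> real" assume \<phi>: "\<phi> \<in> test_functions UNIV"
    have i: "integrable lborel (\<lambda>x. (g x \<bullet> b) * \<phi> x)" "integrable lborel (\<lambda>x. (g' x \<bullet> b) * \<phi> x)"
      by (rule square_integrable_mult[OF square_integrable_component test_square_integrable(1)[OF \<phi>]],
          rule g g')+
    have "(LINT x|lborel. u x * frechet_derivative \<phi> (at x) b) = - (LINT x|lborel. (g x \<bullet> b) * \<phi> x)"
      "(LINT x|lborel. u x * frechet_derivative \<phi> (at x) b) = - (LINT x|lborel. (g' x \<bullet> b) * \<phi> x)"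
      using g(2) g'(2) \<phi> b unfolding is_weak_gradient_def by blast+
    then have "(LINT x|lborel. (g x \<bullet> b) * \<phi> x) = (LINT x|lborel. (g' x \<bullet> b) * \<phi> x)" by linarith
    then show "(LINT x|lborel. (g x - g' x) \<bullet> b * \<phi> x) = 0"
      using i by (simp add: inner_diff_left left_diff_distrib)
  qed
  then have "AE x in lborel. \<forall>b\<in>Basis. (g x - g' x) \<bullet> b = 0"
    by (intro AE_finite_allI) auto
  then show ?thesis
  proof eventually_elim
    case (elim x)
    then have "g x - g' x = 0" by (simp add: euclidean_all_zero_iff)
    then show ?case by simp
  qed
qed

lemma weak_grad_spec:
  assumes "u \<in> H1"
  shows "square_integrable u" "square_integrable (weak_grad u)" "is_weak_gradient u (weak_grad u)"
proof -
  have "\<exists>g. square_integrable g \<and> is_weak_gradient u g" using assms by (simp add: H1_def)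
  then have "square_integrable (weak_grad u) \<and> is_weak_gradient u (weak_grad u)"
    unfolding weak_grad_def by (rule someI_ex)
  then show "square_integrable u" "square_integrable (weak_grad u)" "is_weak_gradient u (weak_grad u)"
    using assms by (auto simp: H1_def)
qed

text \<open>Uniqueness frees later arguments from the choice inside \<open>weak_grad\<close>: any
  exhibited weak gradient agrees with it almost everywhere.\<close>

lemma H1I:
  assumes "square_integrable u" "square_integrable g" "is_weak_gradient u g"
  shows "u \<in> H1" "AE x in lborel. weak_grad u x = g x"
proof -
  show "u \<in> H1" using assms by (auto simp: H1_def)
  then show "AE x in lborel. weak_grad u x = g x"
    using weak_gradient_unique[OF weak_grad_spec(2,3) assms(2,3)] by simp
qed

lemma weak_gradient_linear:
  assumes u: "square_integrable u" "square_integrable g" "is_weak_gradient u g"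
    and v: "square_integrable v" "square_integrable h" "is_weak_gradient v h"
  shows "is_weak_gradient (\<lambda>x. c * u x + d * v x) (\<lambda>x. c *\<^sub>R g x + d *\<^sub>R h x)"
  unfolding is_weak_gradient_def
proof (intro ballI)
  fix \<phi> :: "'a \<Rightarrow> real" and b :: 'a assume \<phi>: "\<phi> \<in> test_functions UNIV" and b: "b \<in> Basis"
  let ?p = "\<lambda>x. frechet_derivative \<phi> (at x) b"
  have i: "integrable lborel (\<lambda>x. u x * ?p x)" "integrable lborel (\<lambda>x. v x * ?p x)"
    "integrable lborel (\<lambda>x. (g x \<bullet> b) * \<phi> x)" "integrable lborel (\<lambda>x. (h x \<bullet> b) * \<phi> x)"
    by (rule square_integrable_mult[OF _ test_partial_square_integrable[OF \<phi> b]], rule u v)+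
       (rule square_integrable_mult[OF square_integrable_component test_square_integrable(1)[OF \<phi>]], rule u v)+
  have "(LINT x|lborel. (c * u x + d * v x) * ?p x) = (LINT x|lborel. c * (u x * ?p x) + d * (v x * ?p x))"
    by (simp add: algebra_simps)
  also have "\<dots> = c * (LINT x|lborel. u x * ?p x) + d * (LINT x|lborel. v x * ?p x)"
    using i by simp
  also have "\<dots> = - (c * (LINT x|lborel. (g x \<bullet> b) * \<phi> x) + d * (LINT x|lborel. (h x \<bullet> b) * \<phi> x))"
    using u(3) v(3) \<phi> b unfolding is_weak_gradient_def by simp
  also have "c * (LINT x|lborel. (g x \<bullet> b) * \<phi> x) + d * (LINT x|lborel. (h x \<bullet> b) * \<phi> x) =
      (LINT x|lborel. c * ((g x \<bullet> b) * \<phi> x) + d * ((h x \<bullet> b) * \<phi> x))"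
    using i by simp
  also have "\<dots> = (LINT x|lborel. ((c *\<^sub>R g x + d *\<^sub>R h x) \<bullet> b) * \<phi> x)"
    by (simp add: algebra_simps inner_add_left)
  finally show "(LINT x|lborel. (c * u x + d * v x) * ?p x) = - (LINT x|lborel. ((c *\<^sub>R g x + d *\<^sub>R h x) \<bullet> b) * \<phi> x)" .
qed

lemma H1_linear:
  assumes "u \<in> H1" "v \<in> H1"
  shows "(\<lambda>x. c * u x + d * v x) \<in> H1"
    and "AE x in lborel. weak_grad (\<lambda>x. c * u x + d * v x) x = c *\<^sub>R weak_grad u x + d *\<^sub>R weak_grad v x"
proof -
  note u = weak_grad_spec[OF assms(1)] and v = weak_grad_spec[OF assms(2)]
  have 1: "square_integrable (\<lambda>x. c * u x + d * v x)"
    using square_integrable_add[OF square_integrable_scale[OF u(1), of c] square_integrable_scale[OF v(1), of d]] by simp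
  have 2: "square_integrable (\<lambda>x. c *\<^sub>R weak_grad u x + d *\<^sub>R weak_grad v x)"
    by (intro square_integrable_add square_integrable_scale u v)
  note H1I[OF 1 2 weak_gradient_linear[OF u v]]
  then show "(\<lambda>x. c * u x + d * v x) \<in> H1"
    "AE x in lborel. weak_grad (\<lambda>x. c * u x + d * v x) x = c *\<^sub>R weak_grad u x + d *\<^sub>R weak_grad v x" by auto
qed

lemma test_H1:
  assumes "\<phi> \<in> test_functions D"
  shows "\<phi> \<in> H1" "AE x in lborel. weak_grad \<phi> x = grad \<phi> x"
  by (rule H1I[OF test_square_integrable[OF assms] test_weak_gradient[OF assms]])+

text \<open>A type of Sobolev functions, so that the two forms become total bilinear forms on a real vector
  space. Almost everywhere equal functions are not identified: both forms are only semidefinite.\<close>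

typedef (overloaded) 'a h1 = "H1 :: ('a::euclidean_space \<Rightarrow> real) set"
  morphisms fn of_fn
  using test_H1(1)[OF test_functions_zero] by blast

lemma fn_eqI: "(\<And>t. fn x t = fn y t) \<Longrightarrow> x = y"
  by (metis fn_inject ext)

lemma fn_H1: "fn x \<in> H1" by (rule fn)

instantiation h1 :: (euclidean_space) real_vector
begin

definition "0 = of_fn (\<lambda>t. 0)"
definition "x + y = of_fn (\<lambda>t. fn x t + fn y t)"
definition "x - y = of_fn (\<lambda>t. fn x t - fn y t)"
definition "- x = of_fn (\<lambda>t. - fn x t)"
definition "c *\<^sub>R x = of_fn (\<lambda>t. c * fn x t)"

lemma fn_zero: "fn 0 t = 0"
  unfolding zero_h1_def by (simp add: of_fn_inverse test_H1(1)[OF test_functions_zero])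

lemma fn_plus: "fn (x + y) t = fn x t + fn y t"
  unfolding plus_h1_def using H1_linear(1)[OF fn_H1[of x] fn_H1[of y], of 1 1]
  by (simp add: of_fn_inverse)

lemma fn_minus: "fn (x - y) t = fn x t - fn y t"
  unfolding minus_h1_def using H1_linear(1)[OF fn_H1[of x] fn_H1[of y], of 1 "-1"]
  by (simp add: of_fn_inverse)

lemma fn_uminus: "fn (- x) t = - fn x t"
  unfolding uminus_h1_def using H1_linear(1)[OF fn_H1[of x] fn_H1[of x], of "-1" 0]
  by (simp add: of_fn_inverse)

lemma fn_scaleR: "fn (c *\<^sub>R x) t = c * fn x t"
  unfolding scaleR_h1_def using H1_linear(1)[OF fn_H1[of x] fn_H1[of x], of c 0]
  by (simp add: of_fn_inverse)

instance
  by standard (auto intro!: fn_eqI simp: fn_zero fn_plus fn_minus fn_uminus fn_scaleR algebra_simps)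

end

lemmas fn_simps = fn_zero fn_plus fn_minus fn_uminus fn_scaleR

lemma fn_sum: "fn (\<Sum>i\<in>I. f i) t = (\<Sum>i\<in>I. fn (f i) t)"
  by (induction I rule: infinite_finite_induct) (auto simp: fn_simps)

abbreviation wgrad :: "'a::euclidean_space h1 \<Rightarrow> 'a \<Rightarrow> 'a" where
  "wgrad x \<equiv> weak_grad (fn x)"

lemma wgrad_plus: "AE t in lborel. wgrad (x + y) t = wgrad x t + wgrad y t"
proof -
  have "fn (x + y) = (\<lambda>t. 1 * fn x t + 1 * fn y t)" by (auto simp: fn_simps)
  then show ?thesis using H1_linear(2)[OF fn_H1[of x] fn_H1[of y], of 1 1] by simp
qed

lemma wgrad_scaleR: "AE t in lborel. wgrad (c *\<^sub>R x) t = c *\<^sub>R wgrad x t"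
proof -
  have "fn (c *\<^sub>R x) = (\<lambda>t. c * fn x t + 0 * fn x t)" by (auto simp: fn_simps)
  then show ?thesis using H1_linear(2)[OF fn_H1[of x] fn_H1[of x], of c 0] by simp
qed

lemma wgrad_minus: "AE t in lborel. wgrad (x - y) t = wgrad x t - wgrad y t"
proof -
  have "fn (x - y) = (\<lambda>t. 1 * fn x t + (-1) * fn y t)" by (auto simp: fn_simps)
  then show ?thesis using H1_linear(2)[OF fn_H1[of x] fn_H1[of y], of 1 "-1"] by simp
qed

lemma fn_square_integrable: "square_integrable (fn x)" and wgrad_square_integrable: "square_integrable (wgrad x)"
  using weak_grad_spec[OF fn_H1] by auto

lemma fn_measurable [measurable]: "fn x \<in> borel_measurable borel"
  and wgrad_measurable [measurable]: "wgrad x \<in> borel_measurable borel"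
  using fn_square_integrable wgrad_square_integrable by (auto intro: square_integrable_measurable)

section \<open>The energy and L2 forms on Sobolev functions\<close>

definition L2_form :: "'a::euclidean_space h1 \<Rightarrow> 'a h1 \<Rightarrow> real" where
  "L2_form x y = (LINT t|lborel. fn x t * fn y t)"

definition grad_form :: "'a::euclidean_space h1 \<Rightarrow> 'a h1 \<Rightarrow> real" where
  "grad_form x y = (LINT t|lborel. wgrad x t \<bullet> wgrad y t)"

interpretation F: form_pair grad_form L2_form
proof
  fix x y z :: "'a h1" and c :: real
  have i: "integrable lborel (\<lambda>t. fn x t * fn y t)" for x y :: "'a h1"
    by (intro square_integrable_mult fn_square_integrable)
  have j: "integrable lborel (\<lambda>t. wgrad x t \<bullet> wgrad y t)" for x y :: "'a h1"
    by (intro square_integrable_inner wgrad_square_integrable)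
  show "L2_form (x + y) z = L2_form x z + L2_form y z"
    using i by (simp add: L2_form_def fn_simps distrib_right)
  show "L2_form (c *\<^sub>R x) y = c * L2_form x y"
    by (simp add: L2_form_def fn_simps mult.assoc)
  show "L2_form x y = L2_form y x" by (simp add: L2_form_def mult.commute)
  show "0 \<le> L2_form x x" by (simp add: L2_form_def)
  have "grad_form (x + y) z = (LINT t|lborel. wgrad x t \<bullet> wgrad z t + wgrad y t \<bullet> wgrad z t)"
    unfolding grad_form_def using wgrad_plus[of x y]
    by (intro integral_cong_AE) (auto simp: inner_add_left)
  then show "grad_form (x + y) z = grad_form x z + grad_form y z"
    using j by (simp add: grad_form_def)
  have "grad_form (c *\<^sub>R x) y = (LINT t|lborel. c * (wgrad x t \<bullet> wgrad y t))"
    unfolding grad_form_def using wgrad_scaleR[of c x]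
    by (intro integral_cong_AE) auto
  then show "grad_form (c *\<^sub>R x) y = c * grad_form x y" by (simp add: grad_form_def)
  show "grad_form x y = grad_form y x" by (simp add: grad_form_def inner_commute)
  show "0 \<le> grad_form x x" by (simp add: grad_form_def)
qed

lemma L2_form_sq: "L2_form x x = (LINT t|lborel. (norm (fn x t))\<^sup>2)"
  by (simp add: L2_form_def power2_eq_square)

lemma grad_form_sq: "grad_form x x = (LINT t|lborel. (norm (wgrad x t))\<^sup>2)"
  by (simp add: grad_form_def power2_norm_eq_inner)

lemma L2_form_zero_iff: "L2_form x x = 0 \<longleftrightarrow> (AE t in lborel. fn x t = 0)"
proof
  assume "L2_form x x = 0"
  then show "AE t in lborel. fn x t = 0"
    unfolding L2_form_sq by (rule integral_sq_eq_0_AE[OF fn_square_integrable])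
next
  assume "AE t in lborel. fn x t = 0"
  then have "L2_form x x = (LINT t|lborel. 0 * fn x t)"
    unfolding L2_form_def by (intro integral_cong_AE) auto
  then show "L2_form x x = 0" by simp
qed

lemma L2_form_diff_sq: "L2_form (x - y) (x - y) = (LINT t|lborel. (norm (fn x t - fn y t))\<^sup>2)"
  unfolding L2_form_sq by (simp add: fn_simps)

lemma grad_form_diff_sq: "grad_form (x - y) (x - y) = (LINT t|lborel. (norm (wgrad x t - wgrad y t))\<^sup>2)"
  unfolding grad_form_sq using wgrad_minus[of x y] by (intro integral_cong_AE) auto

lemma H1_norm_fn: "H1_norm (fn x) = sqrt (L2_form x x + grad_form x x)"
  by (simp add: H1_norm_def L2_form_sq grad_form_sq)

definition h10 :: "'a::euclidean_space set \<Rightarrow> 'a h1 set" where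
  "h10 D = {x. fn x \<in> H10 D}"

lemma fn_of_test: "\<phi> \<in> test_functions D \<Longrightarrow> fn (of_fn \<phi>) = \<phi>"
  by (simp add: of_fn_inverse test_H1)

lemma h10_seq_iff:
  "x \<in> h10 D \<longleftrightarrow> (\<exists>\<phi>. (\<forall>k::nat. \<phi> k \<in> test_functions D) \<and>
    (\<lambda>k. L2_form (of_fn (\<phi> k) - x) (of_fn (\<phi> k) - x) + grad_form (of_fn (\<phi> k) - x) (of_fn (\<phi> k) - x)) \<longlonglongrightarrow> 0)"
proof -
  have "(\<lambda>k. H1_norm (\<lambda>t. \<phi> k t - fn x t)) \<longlonglongrightarrow> 0 \<longleftrightarrow>
    (\<lambda>k. L2_form (of_fn (\<phi> k) - x) (of_fn (\<phi> k) - x) + grad_form (of_fn (\<phi> k) - x) (of_fn (\<phi> k) - x)) \<longlonglongrightarrow> 0"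
    if \<phi>: "\<forall>k::nat. \<phi> k \<in> test_functions D" for \<phi>
  proof -
    define N where "N = (\<lambda>k. L2_form (of_fn (\<phi> k) - x) (of_fn (\<phi> k) - x) + grad_form (of_fn (\<phi> k) - x) (of_fn (\<phi> k) - x))"
    have N: "N k \<ge> 0" for k unfolding N_def by (intro add_nonneg_nonneg F.A.nonneg F.B.nonneg)
    have "(\<lambda>t. \<phi> k t - fn x t) = fn (of_fn (\<phi> k) - x)" for k
      using fn_of_test[of "\<phi> k" D] \<phi> by (simp add: fn_simps fun_eq_iff)
    then have *: "(\<lambda>k. H1_norm (\<lambda>t. \<phi> k t - fn x t)) = (\<lambda>k. sqrt (N k))"
      by (simp add: H1_norm_fn N_def)
    have "(\<lambda>k. sqrt (N k)) \<longlonglongrightarrow> 0 \<longleftrightarrow> N \<longlonglongrightarrow> 0"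
    proof
      assume "(\<lambda>k. sqrt (N k)) \<longlonglongrightarrow> 0"
      then have "(\<lambda>k. (sqrt (N k))\<^sup>2) \<longlonglongrightarrow> 0\<^sup>2" by (rule tendsto_power)
      then show "N \<longlonglongrightarrow> 0" using N by simp
    next
      assume "N \<longlonglongrightarrow> 0"
      from tendsto_real_sqrt[OF this] show "(\<lambda>k. sqrt (N k)) \<longlonglongrightarrow> 0" by simp
    qed
    then show ?thesis unfolding * N_def .
  qed
  then show ?thesis unfolding h10_def H10_def using fn_H1[of x] by auto
qed

text \<open>Trades sequences and the square root in \<open>H1_norm\<close> for a tolerance on
  squared norms, so that closure arguments reduce to \<open>quad_add_le\<close> and linear
  arithmetic.\<close>

lemma h10_iff:
  "x \<in> h10 D \<longleftrightarrow> (\<forall>e>0. \<exists>\<phi>\<in>test_functions D.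
     L2_form (of_fn \<phi> - x) (of_fn \<phi> - x) + grad_form (of_fn \<phi> - x) (of_fn \<phi> - x) < e)"
  (is "_ \<longleftrightarrow> (\<forall>e>0. \<exists>\<phi>\<in>_. ?N \<phi> < e)")
proof
  assume "x \<in> h10 D"
  then obtain \<phi> where \<phi>: "\<forall>k::nat. \<phi> k \<in> test_functions D" "(\<lambda>k. ?N (\<phi> k)) \<longlonglongrightarrow> 0"
    unfolding h10_seq_iff by blast
  show "\<forall>e>0. \<exists>\<phi>\<in>test_functions D. ?N \<phi> < e"
  proof (intro allI impI)
    fix e :: real assume "e > 0"
    then have "\<forall>\<^sub>F k in sequentially. ?N (\<phi> k) < e" using \<phi>(2) by (rule order_tendstoD(2)[rotated])
    then show "\<exists>\<phi>\<in>test_functions D. ?N \<phi> < e" using \<phi>(1) by (auto simp: eventually_sequentially)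
  qed
next
  assume *: "\<forall>e>0. \<exists>\<phi>\<in>test_functions D. ?N \<phi> < e"
  have "\<exists>\<phi>\<in>test_functions D. ?N \<phi> < 1 / real (Suc k)" for k using * by simp
  then obtain \<phi> where \<phi>: "\<And>k. \<phi> k \<in> test_functions D" "\<And>k. ?N (\<phi> k) < 1 / real (Suc k)" by metis
  have "(\<lambda>k. ?N (\<phi> k)) \<longlonglongrightarrow> 0"
  proof (rule tendsto_sandwich[OF _ _ tendsto_const LIMSEQ_Suc[OF lim_1_over_n]])
    show "\<forall>\<^sub>F k in sequentially. 0 \<le> ?N (\<phi> k)"
      by (intro always_eventually allI add_nonneg_nonneg F.A.nonneg F.B.nonneg)
    show "\<forall>\<^sub>F k in sequentially. ?N (\<phi> k) \<le> 1 / real (Suc k)"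
      using \<phi>(2) by (intro always_eventually allI less_imp_le)
  qed
  then show "x \<in> h10 D" unfolding h10_seq_iff using \<phi>(1) by blast
qed

lemma test_h10: "\<phi> \<in> test_functions D \<Longrightarrow> of_fn \<phi> \<in> h10 D"
  unfolding h10_iff by (auto intro!: bexI[of _ \<phi>])

lemma of_fn_linear:
  assumes "\<phi> \<in> test_functions D" "\<psi> \<in> test_functions D"
  shows "of_fn (\<lambda>t. \<phi> t + \<psi> t) = of_fn \<phi> + of_fn \<psi>" "of_fn (\<lambda>t. \<phi> t - \<psi> t) = of_fn \<phi> - of_fn \<psi>"
    "of_fn (\<lambda>t. c * \<phi> t) = c *\<^sub>R of_fn \<phi>"
proof -
  note fns = fn_of_test[OF assms(1)] fn_of_test[OF assms(2)]
  show "of_fn (\<lambda>t. \<phi> t + \<psi> t) = of_fn \<phi> + of_fn \<psi>"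
    by (rule fn_eqI) (simp only: fn_simps fns fn_of_test[OF test_functions_add[OF assms]])
  show "of_fn (\<lambda>t. \<phi> t - \<psi> t) = of_fn \<phi> - of_fn \<psi>"
    by (rule fn_eqI) (simp only: fn_simps fns fn_of_test[OF test_functions_diff[OF assms]])
  show "of_fn (\<lambda>t. c * \<phi> t) = c *\<^sub>R of_fn \<phi>"
    by (rule fn_eqI) (simp only: fn_simps fns fn_of_test[OF test_functions_cmult[OF assms(1)]])
qed

lemma subspace_h10: "subspace (h10 D)"
  unfolding subspace_def
proof (intro conjI ballI allI)
  have "of_fn (\<lambda>t. 0) \<in> h10 D" by (rule test_h10[OF test_functions_zero])
  then show "0 \<in> h10 D" by (simp add: zero_h1_def)
next
  fix x y :: "'a h1" assume xy: "x \<in> h10 D" "y \<in> h10 D"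
  show "x + y \<in> h10 D"
    unfolding h10_iff
  proof (intro allI impI)
    fix e :: real assume e: "e > 0"
    then obtain \<phi> \<psi> where \<phi>: "\<phi> \<in> test_functions D"
      "L2_form (of_fn \<phi> - x) (of_fn \<phi> - x) + grad_form (of_fn \<phi> - x) (of_fn \<phi> - x) < e/4"
      and \<psi>: "\<psi> \<in> test_functions D"
      "L2_form (of_fn \<psi> - y) (of_fn \<psi> - y) + grad_form (of_fn \<psi> - y) (of_fn \<psi> - y) < e/4"
      using xy unfolding h10_iff by (meson divide_pos_pos zero_less_numeral)
    have eq: "of_fn (\<lambda>t. \<phi> t + \<psi> t) - (x + y) = (of_fn \<phi> - x) + (of_fn \<psi> - y)"
      using of_fn_linear(1)[OF \<phi>(1) \<psi>(1)] by simp
    have "L2_form ((of_fn \<phi> - x) + (of_fn \<psi> - y)) ((of_fn \<phi> - x) + (of_fn \<psi> - y))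
      + grad_form ((of_fn \<phi> - x) + (of_fn \<psi> - y)) ((of_fn \<phi> - x) + (of_fn \<psi> - y)) < e"
      using F.A.quad_add_le[of "of_fn \<phi> - x" "of_fn \<psi> - y"] F.B.quad_add_le[of "of_fn \<phi> - x" "of_fn \<psi> - y"] \<phi>(2) \<psi>(2)
      by linarith
    then show "\<exists>\<phi>\<in>test_functions D. L2_form (of_fn \<phi> - (x + y)) (of_fn \<phi> - (x + y))
       + grad_form (of_fn \<phi> - (x + y)) (of_fn \<phi> - (x + y)) < e"
      using test_functions_add[OF \<phi>(1) \<psi>(1)] eq by metis
  qed
next
  fix c :: real and x :: "'a h1" assume x: "x \<in> h10 D"
  show "c *\<^sub>R x \<in> h10 D"
    unfolding h10_iff
  proof (intro allI impI)
    fix e :: real assume e: "e > 0"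
    have "e / (c\<^sup>2 + 1) > 0" using e by (simp add: add_nonneg_pos)
    then obtain \<phi> where \<phi>: "\<phi> \<in> test_functions D"
      "L2_form (of_fn \<phi> - x) (of_fn \<phi> - x) + grad_form (of_fn \<phi> - x) (of_fn \<phi> - x) < e / (c\<^sup>2 + 1)"
      using x unfolding h10_iff by blast
    let ?d = "of_fn \<phi> - x"
    have eq: "of_fn (\<lambda>t. c * \<phi> t) - c *\<^sub>R x = c *\<^sub>R ?d"
      using of_fn_linear(3)[OF \<phi>(1) \<phi>(1)] by (simp add: scaleR_right_diff_distrib)
    have "L2_form (c *\<^sub>R ?d) (c *\<^sub>R ?d) + grad_form (c *\<^sub>R ?d) (c *\<^sub>R ?d) = c\<^sup>2 * (L2_form ?d ?d + grad_form ?d ?d)"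
      by (simp only: F.A.scale_left F.A.scale_right F.B.scale_left F.B.scale_right power2_eq_square distrib_left mult.assoc)
    also have "\<dots> \<le> (c\<^sup>2 + 1) * (L2_form ?d ?d + grad_form ?d ?d)"
      using F.A.nonneg[of ?d] F.B.nonneg[of ?d] by (intro mult_right_mono) auto
    also have "\<dots> < e"
    proof -
      have "c\<^sup>2 + 1 > 0" by (simp add: add_nonneg_pos)
      from pos_less_divide_eq[OF this] \<phi>(2) show ?thesis by (simp only: mult.commute)
    qed
    finally show "\<exists>\<phi>\<in>test_functions D. L2_form (of_fn \<phi> - c *\<^sub>R x) (of_fn \<phi> - c *\<^sub>R x)
       + grad_form (of_fn \<phi> - c *\<^sub>R x) (of_fn \<phi> - c *\<^sub>R x) < e"
      using test_functions_cmult[OF \<phi>(1), of c] eq by metis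
  qed
qed

lemma h10_mono: assumes "D \<subseteq> D'" shows "h10 D \<subseteq> h10 D'"
proof
  fix x assume "x \<in> h10 D"
  then show "x \<in> h10 D'" unfolding h10_iff using test_functions_mono[OF assms] by (meson subsetD)
qed

lemma L2_form_test: "\<phi> \<in> test_functions D \<Longrightarrow> L2_form (of_fn \<phi>) (of_fn \<phi>) = (LINT t|lborel. (\<phi> t)\<^sup>2)"
  by (simp add: L2_form_sq fn_of_test)

lemma grad_form_test: "\<phi> \<in> test_functions D \<Longrightarrow> grad_form (of_fn \<phi>) (of_fn \<phi>) = (LINT t|lborel. (norm (grad \<phi> t))\<^sup>2)"
proof -
  assume \<phi>: "\<phi> \<in> test_functions D"
  have [measurable]: "grad \<phi> \<in> borel_measurable borel"
    using test_square_integrable(2)[OF \<phi>] by (rule square_integrable_measurable)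
  show ?thesis unfolding grad_form_sq using test_H1(2)[OF \<phi>] wgrad_measurable[of "of_fn \<phi>"]
    by (intro integral_cong_AE) (auto simp: fn_of_test[OF \<phi>])
qed

lemma h10_poincare:
  assumes "bounded D" shows "\<exists>C. F.form_poincare (h10 D) C"
proof -
  obtain C where C: "C > 0" "\<And>\<phi>. \<phi> \<in> test_functions D \<Longrightarrow> (LINT x|lborel. (\<phi> x)\<^sup>2) \<le> C * (LINT x|lborel. (norm (grad \<phi> x))\<^sup>2)"
    using poincare_test_functions[OF assms] by blast
  have "L2_form x x \<le> C * grad_form x x" if x: "x \<in> h10 D" for x
  proof -
    obtain \<phi> where \<phi>: "\<And>k::nat. \<phi> k \<in> test_functions D"
      "(\<lambda>k. L2_form (of_fn (\<phi> k) - x) (of_fn (\<phi> k) - x) + grad_form (of_fn (\<phi> k) - x) (of_fn (\<phi> k) - x)) \<longlonglongrightarrow> 0"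
      using x unfolding h10_seq_iff by blast
    have "(\<lambda>k. L2_form (of_fn (\<phi> k) - x) (of_fn (\<phi> k) - x)) \<longlonglongrightarrow> 0"
      by (rule tendsto_sandwich[OF _ _ tendsto_const \<phi>(2)])
         (auto intro!: always_eventually simp: F.A.nonneg F.B.nonneg)
    moreover have "(\<lambda>k. grad_form (of_fn (\<phi> k) - x) (of_fn (\<phi> k) - x)) \<longlonglongrightarrow> 0"
      by (rule tendsto_sandwich[OF _ _ tendsto_const \<phi>(2)])
         (auto intro!: always_eventually simp: F.A.nonneg F.B.nonneg)
    ultimately have "(\<lambda>k. L2_form (of_fn (\<phi> k)) (of_fn (\<phi> k))) \<longlonglongrightarrow> L2_form x x"
      "(\<lambda>k. C * grad_form (of_fn (\<phi> k)) (of_fn (\<phi> k))) \<longlonglongrightarrow> C * grad_form x x"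
      by (auto intro!: tendsto_mult_left F.A.tendsto_quad F.B.tendsto_quad)
    then show ?thesis
      by (rule LIMSEQ_le) (use C(2)[OF \<phi>(1)] in \<open>auto simp: L2_form_test[OF \<phi>(1)] grad_form_test[OF \<phi>(1)]\<close>)
  qed
  with C(1) show ?thesis unfolding F.form_poincare_def by blast
qed

text \<open>The weighted bound of an inner product by
  \<open>s * (norm y)\<^sup>2 + (norm x)\<^sup>2 / s\<close> stands in for Cauchy-Schwarz:
  \<open>s\<close> is fixed first to make the share of \<open>h\<close> small, then \<open>n\<close>
  is taken large.\<close>

lemma integral_inner_L2_limit:
  fixes g :: "nat \<Rightarrow> 'a::euclidean_space \<Rightarrow> 'b::euclidean_space"
  assumes g: "\<And>n. square_integrable (g n)" "square_integrable G" and h: "square_integrable h"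
    and lim: "(\<lambda>n. LINT x|lborel. (norm (g n x - G x))\<^sup>2) \<longlonglongrightarrow> 0"
  shows "(\<lambda>n. LINT x|lborel. g n x \<bullet> h x) \<longlonglongrightarrow> (LINT x|lborel. G x \<bullet> h x)"
proof -
  define H where "H = (LINT x|lborel. (norm (h x))\<^sup>2)"
  have H: "H \<ge> 0" unfolding H_def by simp
  have d: "integrable lborel (\<lambda>x. (norm (g n x - G x))\<^sup>2)" for n
    by (intro square_integrableD square_integrable_diff g)
  have est: "\<bar>LINT x|lborel. (g n x - G x) \<bullet> h x\<bar> \<le> s * H + (LINT x|lborel. (norm (g n x - G x))\<^sup>2) / s" if s: "s > 0" for n s
  proof -
    have "\<bar>LINT x|lborel. (g n x - G x) \<bullet> h x\<bar> \<le> (LINT x|lborel. s * (norm (h x))\<^sup>2 + (norm (g n x - G x))\<^sup>2 / s)"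
    proof (rule order_trans[OF integral_abs_bound integral_mono'])
      show "integrable lborel (\<lambda>x. s * (norm (h x))\<^sup>2 + (norm (g n x - G x))\<^sup>2 / s)"
        using d square_integrableD[OF h] by auto
      fix x
      let ?a = "norm (g n x - G x)" and ?b = "norm (h x)"
      have "\<bar>(g n x - G x) \<bullet> h x\<bar> \<le> ?a * ?b" by (rule Cauchy_Schwarz_ineq2)
      also have "?a * ?b \<le> s * ?b\<^sup>2 + ?a\<^sup>2 / s"
      proof -
        have "0 \<le> (s * ?b - ?a)\<^sup>2 + s * (?a * ?b)" using s by simp
        then have "s * (?a * ?b) \<le> s * (s * ?b\<^sup>2 + ?a\<^sup>2 / s)"
          using s by (simp add: power2_eq_square algebra_simps)
        then show ?thesis using s by simp
      qed
      finally show "\<bar>(g n x - G x) \<bullet> h x\<bar> \<le> s * ?b\<^sup>2 + ?a\<^sup>2 / s" .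
    qed (use s in auto)
    then show ?thesis using d[of n] square_integrableD[OF h] by (simp add: H_def)
  qed
  have "(\<lambda>n. (LINT x|lborel. (g n x - G x) \<bullet> h x)) \<longlonglongrightarrow> 0"
  proof (rule LIMSEQ_I)
    fix e :: real assume e: "e > 0"
    define s where "s = e / (2 * (H + 1))"
    have s: "s > 0" "s * H < e / 2 + 0" using e H by (auto simp: s_def field_simps)
    obtain M where M: "\<And>n. n \<ge> M \<Longrightarrow> (LINT x|lborel. (norm (g n x - G x))\<^sup>2) < s * (e / 2)"
      using order_tendstoD(2)[OF lim, of "s * (e / 2)"] s e by (auto simp: eventually_sequentially)
    have "\<bar>LINT x|lborel. (g n x - G x) \<bullet> h x\<bar> < e" if "n \<ge> M" for n
    proof -
      have "(LINT x|lborel. (norm (g n x - G x))\<^sup>2) / s < e / 2"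
        using M[OF that] s by (simp add: field_simps)
      then show ?thesis using est[OF s(1), of n] s(2) by linarith
    qed
    then show "\<exists>M. \<forall>n\<ge>M. norm ((LINT x|lborel. (g n x - G x) \<bullet> h x) - 0) < e" by auto
  qed
  moreover have "(LINT x|lborel. (g n x - G x) \<bullet> h x) = (LINT x|lborel. g n x \<bullet> h x) - (LINT x|lborel. G x \<bullet> h x)" for n
    using square_integrable_inner[OF g(1) h] square_integrable_inner[OF g(2) h] by (simp add: inner_diff_left)
  ultimately show ?thesis by (simp add: LIM_zero_iff)
qed

text \<open>Gradients are L2-Cauchy by hypothesis, the functions by Poincare. Passing to the limit
  in the identity defining weak gradients links the two limits, and test functions close to late
  members of the sequence place the limit in \<open>h10 D\<close>.\<close>

lemma h10_complete:
  fixes D :: "'a::euclidean_space set"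
  assumes "bounded D" shows "F.form_complete (h10 D)"
  unfolding F.form_complete_def
proof (intro allI impI, elim conjE)
  fix x assume x: "\<forall>n::nat. x n \<in> h10 D"
    and c: "\<forall>e>0. \<exists>M. \<forall>m\<ge>M. \<forall>n\<ge>M. grad_form (x m - x n) (x m - x n) < e"
  obtain C where C: "C > 0" "\<And>x. x \<in> h10 D \<Longrightarrow> L2_form x x \<le> C * grad_form x x"
    using h10_poincare[OF assms] unfolding F.form_poincare_def by blast
  have "\<exists>M. \<forall>m\<ge>M. \<forall>n\<ge>M. (LINT t|lborel. (norm (wgrad (x m) t - wgrad (x n) t))\<^sup>2) < e" if "e > 0" for e
    using c that by (simp add: grad_form_diff_sq)
  then obtain g where g: "square_integrable g" "(\<lambda>n. LINT t|lborel. (norm (wgrad (x n) t - g t))\<^sup>2) \<longlonglongrightarrow> 0"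
    using L2_complete[of "\<lambda>n. wgrad (x n)", OF wgrad_square_integrable] by blast
  have "\<exists>M. \<forall>m\<ge>M. \<forall>n\<ge>M. (LINT t|lborel. (norm (fn (x m) t - fn (x n) t))\<^sup>2) < e" if e: "e > 0" for e
  proof -
    obtain M where M: "\<forall>m\<ge>M. \<forall>n\<ge>M. grad_form (x m - x n) (x m - x n) < e / C"
      using c e C(1) by (meson divide_pos_pos)
    have "(LINT t|lborel. (norm (fn (x m) t - fn (x n) t))\<^sup>2) < e" if "m \<ge> M" "n \<ge> M" for m n
    proof -
      have "L2_form (x m - x n) (x m - x n) \<le> C * grad_form (x m - x n) (x m - x n)"
        using x by (intro C(2) subspace_diff[OF subspace_h10]) auto
      also have "\<dots> < e" using M that C(1) by (simp add: field_simps)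
      finally show ?thesis by (simp add: L2_form_diff_sq)
    qed
    then show ?thesis by blast
  qed
  then obtain u where u: "square_integrable u" "(\<lambda>n. LINT t|lborel. (norm (fn (x n) t - u t))\<^sup>2) \<longlonglongrightarrow> 0"
    using L2_complete[of "\<lambda>n. fn (x n)", OF fn_square_integrable] by blast
  have wg: "is_weak_gradient u g"
    unfolding is_weak_gradient_def
  proof (intro ballI)
    fix \<phi> :: "'a \<Rightarrow> real" and b :: 'a assume \<phi>: "\<phi> \<in> test_functions UNIV" and b: "b \<in> Basis"
    let ?p = "\<lambda>t. frechet_derivative \<phi> (at t) b"
    have "(\<lambda>n. LINT t|lborel. fn (x n) t \<bullet> ?p t) \<longlonglongrightarrow> (LINT t|lborel. u t \<bullet> ?p t)"
      by (rule integral_inner_L2_limit[OF fn_square_integrable u(1) test_partial_square_integrable[OF \<phi> b] u(2)])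
    moreover have "(\<lambda>n. LINT t|lborel. wgrad (x n) t \<bullet> (\<phi> t *\<^sub>R b)) \<longlonglongrightarrow> (LINT t|lborel. g t \<bullet> (\<phi> t *\<^sub>R b))"
    proof (rule integral_inner_L2_limit[OF wgrad_square_integrable g(1) _ g(2)])
      show "square_integrable (\<lambda>t. \<phi> t *\<^sub>R b)"
        using test_square_integrable(1)[OF \<phi>] b unfolding square_integrable_def
        by (auto intro!: borel_measurable_scaleR)
    qed
    moreover have "(LINT t|lborel. fn (x n) t \<bullet> ?p t) = - (LINT t|lborel. wgrad (x n) t \<bullet> (\<phi> t *\<^sub>R b))" for n
      using weak_grad_spec(3)[OF fn_H1[of "x n"]] \<phi> b unfolding is_weak_gradient_def by (simp add: mult.commute)
    ultimately have "(\<lambda>n. - (LINT t|lborel. wgrad (x n) t \<bullet> (\<phi> t *\<^sub>R b))) \<longlonglongrightarrow> (LINT t|lborel. u t \<bullet> ?p t)"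
      "(\<lambda>n. - (LINT t|lborel. wgrad (x n) t \<bullet> (\<phi> t *\<^sub>R b))) \<longlonglongrightarrow> - (LINT t|lborel. g t \<bullet> (\<phi> t *\<^sub>R b))"
      by (simp_all add: tendsto_minus)
    then have "(LINT t|lborel. u t \<bullet> ?p t) = - (LINT t|lborel. g t \<bullet> (\<phi> t *\<^sub>R b))" by (rule LIMSEQ_unique)
    then show "(LINT t|lborel. u t * ?p t) = - (LINT t|lborel. (g t \<bullet> b) * \<phi> t)" by (simp add: mult.commute)
  qed
  note uH = H1I[OF u(1) g(1) wg]
  define y where "y = of_fn u"
  have fy: "fn y = u" unfolding y_def using uH(1) by (rule of_fn_inverse)
  have L: "(\<lambda>n. L2_form (x n - y) (x n - y)) \<longlonglongrightarrow> 0" using u(2) by (simp add: L2_form_diff_sq fy)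
  have G: "(\<lambda>n. grad_form (x n - y) (x n - y)) \<longlonglongrightarrow> 0"
  proof -
    have [measurable]: "g \<in> borel_measurable borel" using g(1) by (rule square_integrable_measurable)
    have "AE t in lborel. wgrad y t = g t" using uH(2) fy by simp
    then have "(LINT t|lborel. (norm (wgrad (x n) t - wgrad y t))\<^sup>2) = (LINT t|lborel. (norm (wgrad (x n) t - g t))\<^sup>2)" for n
      by (intro integral_cong_AE) auto
    then show ?thesis using g(2) by (simp add: grad_form_diff_sq)
  qed
  have "y \<in> h10 D"
    unfolding h10_iff
  proof (intro allI impI)
    fix e :: real assume e: "e > 0"
    have "\<forall>\<^sub>F n in sequentially. L2_form (x n - y) (x n - y) + grad_form (x n - y) (x n - y) < e / 4"
      using tendsto_add[OF L G] e by (intro order_tendstoD(2)) auto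
    then obtain n where n: "L2_form (x n - y) (x n - y) + grad_form (x n - y) (x n - y) < e / 4"
      by (auto simp: eventually_sequentially)
    obtain \<phi> where \<phi>: "\<phi> \<in> test_functions D"
      "L2_form (of_fn \<phi> - x n) (of_fn \<phi> - x n) + grad_form (of_fn \<phi> - x n) (of_fn \<phi> - x n) < e / 4"
      using x e unfolding h10_iff by (meson divide_pos_pos zero_less_numeral)
    have eq: "of_fn \<phi> - y = (of_fn \<phi> - x n) + (x n - y)" by simp
    have "L2_form (of_fn \<phi> - y) (of_fn \<phi> - y) + grad_form (of_fn \<phi> - y) (of_fn \<phi> - y) < e"
      unfolding eq
      using F.A.quad_add_le[of "of_fn \<phi> - x n" "x n - y"] F.B.quad_add_le[of "of_fn \<phi> - x n" "x n - y"] \<phi>(2) n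
      by linarith
    then show "\<exists>\<phi>\<in>test_functions D. L2_form (of_fn \<phi> - y) (of_fn \<phi> - y) + grad_form (of_fn \<phi> - y) (of_fn \<phi> - y) < e"
      using \<phi>(1) by blast
  qed
  with G show "\<exists>y\<in>h10 D. (\<lambda>n. grad_form (x n - y) (x n - y)) \<longlonglongrightarrow> 0" by blast
qed

text \<open>Each \<open>x n\<close> is replaced by a test function at squared distance below
  \<open>1 / real (Suc n)\<close>, which reduces the claim to Rellich for test functions.\<close>

lemma h10_compact:
  assumes "bounded D" shows "F.form_compact (h10 D)"
  unfolding F.form_compact_def
proof (intro allI impI)
  fix x B assume x: "\<forall>n::nat. x n \<in> h10 D \<and> grad_form (x n) (x n) \<le> B"
  have "\<exists>\<phi>\<in>test_functions D. L2_form (of_fn \<phi> - x n) (of_fn \<phi> - x n) + grad_form (of_fn \<phi> - x n) (of_fn \<phi> - x n) < 1 / real (Suc n)" for n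
  proof -
    have "x n \<in> h10 D" using x by blast
    then show ?thesis unfolding h10_iff by simp
  qed
  then obtain \<phi> where \<phi>: "\<And>n. \<phi> n \<in> test_functions D"
    "\<And>n. L2_form (of_fn (\<phi> n) - x n) (of_fn (\<phi> n) - x n) + grad_form (of_fn (\<phi> n) - x n) (of_fn (\<phi> n) - x n) < 1 / real (Suc n)"
    by metis
  have gb: "(LINT t|lborel. (norm (grad (\<phi> n) t))\<^sup>2) \<le> 2 * B + 2" for n
  proof -
    have "1 / real (Suc n) \<le> 1" by simp
    then have "grad_form (of_fn (\<phi> n) - x n) (of_fn (\<phi> n) - x n) \<le> 1"
      using \<phi>(2)[of n] F.B.nonneg[of "of_fn (\<phi> n) - x n"] by linarith
    moreover have "grad_form (x n) (x n) \<le> B" using x by blast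
    moreover have "of_fn (\<phi> n) = (of_fn (\<phi> n) - x n) + x n" by simp
    ultimately have "grad_form (of_fn (\<phi> n)) (of_fn (\<phi> n)) \<le> 2 * B + 2"
      using F.A.quad_add_le[of "of_fn (\<phi> n) - x n" "x n"] by simp
    then show ?thesis by (simp add: grad_form_test[OF \<phi>(1)])
  qed
  from rellich_test_functions[OF assms \<phi>(1) gb]
  obtain r :: "nat \<Rightarrow> nat" where r0: "strict_mono r \<and>
    (\<forall>e>0. \<exists>N. \<forall>m\<ge>N. \<forall>n\<ge>N. (LINT t|lborel. (\<phi> (r m) t - \<phi> (r n) t)\<^sup>2) < e)" ..
  then have r: "strict_mono r"
    "\<And>e. e > 0 \<Longrightarrow> \<exists>N. \<forall>m\<ge>N. \<forall>n\<ge>N. (LINT t|lborel. (\<phi> (r m) t - \<phi> (r n) t)\<^sup>2) < e"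
    by simp_all
  have "\<exists>M. \<forall>m\<ge>M. \<forall>n\<ge>M. L2_form (x (r m) - x (r n)) (x (r m) - x (r n)) < e" if e: "e > 0" for e
  proof -
    \<comment> \<open>Two uses of \<open>quad_add_le\<close> on three differences cost
      \<open>2 + 4 + 4\<close> times \<open>e / 12\<close>.\<close>
    obtain N1 where N1: "\<forall>m\<ge>N1. \<forall>n\<ge>N1. (LINT t|lborel. (\<phi> (r m) t - \<phi> (r n) t)\<^sup>2) < e / 12"
      using r(2)[of "e / 12"] e by auto
    obtain N2 where N2: "1 / real (Suc N2) < e / 12" using nat_approx_posE[of "e / 12"] e by auto
    have "L2_form (x (r m) - x (r n)) (x (r m) - x (r n)) < e" if mn: "m \<ge> max N1 N2" "n \<ge> max N1 N2" for m n
    proof -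
      define p where "p = (\<lambda>k. of_fn (\<phi> (r k)))"
      have near: "L2_form (p k - x (r k)) (p k - x (r k)) < e / 12" if "k \<ge> N2" for k
      proof -
        have "r k \<ge> N2" using seq_suble[OF r(1), of k] that by simp
        then have "1 / real (Suc (r k)) \<le> 1 / real (Suc N2)" by (simp add: field_simps)
        then show ?thesis using \<phi>(2)[of "r k"] F.A.nonneg[of "p k - x (r k)"] N2 unfolding p_def by linarith
      qed
      have pp: "L2_form (p m - p n) (p m - p n) < e / 12"
        using N1 mn by (simp add: L2_form_diff_sq p_def fn_of_test[OF \<phi>(1)])
      have eq: "x (r m) - x (r n) = (x (r m) - p m) + ((p m - p n) + (p n - x (r n)))" by simp
      have "L2_form (x (r m) - x (r n)) (x (r m) - x (r n)) \<le> 2 * L2_form (x (r m) - p m) (x (r m) - p m)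
          + 2 * L2_form ((p m - p n) + (p n - x (r n))) ((p m - p n) + (p n - x (r n)))"
        unfolding eq by (rule F.B.quad_add_le)
      moreover have "L2_form ((p m - p n) + (p n - x (r n))) ((p m - p n) + (p n - x (r n)))
          \<le> 2 * L2_form (p m - p n) (p m - p n) + 2 * L2_form (p n - x (r n)) (p n - x (r n))"
        by (rule F.B.quad_add_le)
      ultimately show ?thesis
        using near[of m] near[of n] pp mn e F.B.quad_diff_commute[of "x (r m)" "p m"] by simp
    qed
    then show ?thesis by blast
  qed
  then show "\<exists>r::nat \<Rightarrow> nat. strict_mono r \<and> (\<forall>e>0. \<exists>M. \<forall>m\<ge>M. \<forall>n\<ge>M. L2_form (x (r m) - x (r n)) (x (r m) - x (r n)) < e)" using r(1) by (intro exI[of _ r]) simp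
qed

section \<open>The Dirichlet spectrum and capacities\<close>

lemmas h10_approx = h10_iff[THEN iffD1, rule_format]

text \<open>The restriction of \<open>f\<close> to \<open>S\<close> is no longer, in L2, than the
  distance from \<open>f\<close> to any \<open>h\<close> vanishing on \<open>S\<close>.\<close>

lemma AE_zero_on_if_approximated:
  fixes f :: "'a::euclidean_space \<Rightarrow> 'b::euclidean_space"
  assumes f: "square_integrable f" and [measurable]: "S \<in> sets borel"
    and approx: "\<And>e. e > 0 \<Longrightarrow> \<exists>h. square_integrable h \<and> (AE t in lborel. t \<in> S \<longrightarrow> h t = 0) \<and>
      (LINT t|lborel. (norm (h t - f t))\<^sup>2) < e"
  shows "AE t in lborel. t \<in> S \<longrightarrow> f t = 0"
proof -
  have [measurable]: "f \<in> borel_measurable borel" using f by (rule square_integrable_measurable)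
  define g where "g = (\<lambda>t. (indicator S t :: real) *\<^sub>R f t)"
  have [measurable]: "g \<in> borel_measurable borel" unfolding g_def by measurable
  have "integrable lborel (\<lambda>t. (norm (g t))\<^sup>2)"
    by (rule Bochner_Integration.integrable_bound[OF square_integrableD[OF f]])
       (auto intro!: AE_I2 simp: g_def indicator_def)
  then have g: "square_integrable g" unfolding square_integrable_def by simp
  have "(LINT t|lborel. (norm (g t))\<^sup>2) < e" if e: "e > 0" for e
  proof -
    obtain h where h: "square_integrable h" "AE t in lborel. t \<in> S \<longrightarrow> h t = 0"
      "(LINT t|lborel. (norm (h t - f t))\<^sup>2) < e" using approx[OF e] by blast
    have "(LINT t|lborel. (norm (g t))\<^sup>2) \<le> (LINT t|lborel. (norm (h t - f t))\<^sup>2)"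
    proof (rule integral_mono_AE)
      show "integrable lborel (\<lambda>t. (norm (h t - f t))\<^sup>2)" by (intro square_integrableD square_integrable_diff h f)
      show "AE t in lborel. (norm (g t))\<^sup>2 \<le> (norm (h t - f t))\<^sup>2"
        using h(2) by eventually_elim (auto simp: g_def indicator_def)
    qed (rule square_integrableD[OF g])
    then show ?thesis using h(3) by simp
  qed
  then have "(LINT t|lborel. (norm (g t))\<^sup>2) \<le> 0" by (meson not_le less_irrefl)
  then have "(LINT t|lborel. (norm (g t))\<^sup>2) = 0" by (intro antisym Bochner_Integration.integral_nonneg) auto
  then have "AE t in lborel. g t = 0" by (rule integral_sq_eq_0_AE[OF g])
  then show ?thesis by eventually_elim (auto simp: g_def)
qed

text \<open>Bridges the integrals over \<open>D\<close> in the definitions and the forms over the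
  whole space. Test functions and their gradients vanish outside \<open>D\<close>, and L2 limits
  inherit this.\<close>

lemma h10_zero_outside:
  fixes D :: "'a::euclidean_space set"
  assumes x: "x \<in> h10 D" and D: "D \<in> sets borel"
  shows "AE t in lborel. t \<notin> D \<longrightarrow> fn x t = 0" "AE t in lborel. t \<notin> D \<longrightarrow> wgrad x t = 0"
proof -
  have S: "- D \<in> sets borel" using D by (simp add: Compl_in_sets_lebesgue)
  have ex: "\<exists>\<phi>\<in>test_functions D. L2_form (of_fn \<phi> - x) (of_fn \<phi> - x) < e \<and> grad_form (of_fn \<phi> - x) (of_fn \<phi> - x) < e"
    if e: "e > 0" for e
  proof -
    obtain \<phi> where \<phi>: "\<phi> \<in> test_functions D"
      "L2_form (of_fn \<phi> - x) (of_fn \<phi> - x) + grad_form (of_fn \<phi> - x) (of_fn \<phi> - x) < e"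
      using x e unfolding h10_iff by blast
    then show ?thesis
      using F.A.nonneg[of "of_fn \<phi> - x"] F.B.nonneg[of "of_fn \<phi> - x"] by (intro bexI[of _ \<phi>] conjI) auto
  qed
  have "AE t in lborel. t \<in> - D \<longrightarrow> fn x t = 0"
  proof (rule AE_zero_on_if_approximated[OF fn_square_integrable S])
    fix e :: real assume "e > 0"
    then obtain \<phi> where \<phi>: "\<phi> \<in> test_functions D" "L2_form (of_fn \<phi> - x) (of_fn \<phi> - x) < e" using ex by blast
    then show "\<exists>h. square_integrable h \<and> (AE t in lborel. t \<in> - D \<longrightarrow> h t = 0) \<and> (LINT t|lborel. (norm (h t - fn x t))\<^sup>2) < e"
      using test_vanishes_outside(1)[OF \<phi>(1)]
      by (intro exI[of _ \<phi>] conjI test_square_integrable(1)[OF \<phi>(1)] AE_I2) (auto simp: L2_form_diff_sq fn_of_test)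
  qed
  then show "AE t in lborel. t \<notin> D \<longrightarrow> fn x t = 0" by simp
  have "AE t in lborel. t \<in> - D \<longrightarrow> wgrad x t = 0"
  proof (rule AE_zero_on_if_approximated[OF wgrad_square_integrable S])
    fix e :: real assume "e > 0"
    then obtain \<phi> where \<phi>: "\<phi> \<in> test_functions D" "grad_form (of_fn \<phi> - x) (of_fn \<phi> - x) < e" using ex by blast
    have "AE t in lborel. t \<in> - D \<longrightarrow> wgrad (of_fn \<phi>) t = 0"
      using test_H1(2)[OF \<phi>(1)]
      by eventually_elim (auto simp: fn_of_test[OF \<phi>(1)] test_vanishes_outside(2)[OF \<phi>(1)])
    then show "\<exists>h. square_integrable h \<and> (AE t in lborel. t \<in> - D \<longrightarrow> h t = 0) \<and> (LINT t|lborel. (norm (h t - wgrad x t))\<^sup>2) < e"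
      using \<phi>(2) by (intro exI[of _ "wgrad (of_fn \<phi>)"] conjI wgrad_square_integrable) (auto simp: grad_form_diff_sq)
  qed
  then show "AE t in lborel. t \<notin> D \<longrightarrow> wgrad x t = 0" by simp
qed

lemma set_forms:
  assumes x: "x \<in> h10 D" and D[measurable]: "D \<in> sets borel"
  shows "(LINT t:D|lborel. wgrad x t \<bullet> wgrad y t) = grad_form x y"
    "(LINT t:D|lborel. fn x t * fn y t) = L2_form x y"
proof -
  have "AE t in lborel. indicat_real D t *\<^sub>R (wgrad x t \<bullet> wgrad y t) = wgrad x t \<bullet> wgrad y t"
    using h10_zero_outside(2)[OF x D] by eventually_elim (auto simp: indicator_def)
  then show "(LINT t:D|lborel. wgrad x t \<bullet> wgrad y t) = grad_form x y"
    unfolding set_lebesgue_integral_def grad_form_def by (intro integral_cong_AE) auto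
  have "AE t in lborel. indicat_real D t *\<^sub>R (fn x t * fn y t) = fn x t * fn y t"
    using h10_zero_outside(1)[OF x D] by eventually_elim (auto simp: indicator_def)
  then show "(LINT t:D|lborel. fn x t * fn y t) = L2_form x y"
    unfolding set_lebesgue_integral_def L2_form_def by (intro integral_cong_AE) auto
qed

section \<open>Multiplicities and the enumeration of the spectrum\<close>

lemma H10_fn: assumes "v \<in> H10 D" shows "of_fn v \<in> h10 D \<and> fn (of_fn v) = v"
proof -
  have "v \<in> H1" using assms by (simp add: H10_def)
  then have "fn (of_fn v) = v" by (rule of_fn_inverse)
  then show ?thesis using assms by (simp add: h10_def)
qed

lemma fn_mem_H10: "fn x \<in> H10 D \<longleftrightarrow> x \<in> h10 D" by (simp add: h10_def)

lemma dirichlet_eigenspace_iff: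
  assumes D: "D \<in> sets borel"
  shows "fn x \<in> dirichlet_eigenspace D \<mu> \<longleftrightarrow> x \<in> h10 D \<and> (\<forall>v\<in>h10 D. grad_form x v = \<mu> * L2_form x v)"
proof -
  have "(\<forall>v\<in>H10 D. (LINT t:D|lborel. wgrad x t \<bullet> weak_grad v t) = \<mu> * (LINT t:D|lborel. fn x t * v t))
      \<longleftrightarrow> (\<forall>v\<in>h10 D. grad_form x v = \<mu> * L2_form x v)" if x: "x \<in> h10 D"
  proof
    assume *: "\<forall>v\<in>H10 D. (LINT t:D|lborel. wgrad x t \<bullet> weak_grad v t) = \<mu> * (LINT t:D|lborel. fn x t * v t)"
    show "\<forall>v\<in>h10 D. grad_form x v = \<mu> * L2_form x v"
    proof
      fix v assume "v \<in> h10 D"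
      then show "grad_form x v = \<mu> * L2_form x v"
        using bspec[OF *, of "fn v"] by (simp add: fn_mem_H10 set_forms[OF x D])
    qed
  next
    assume *: "\<forall>v\<in>h10 D. grad_form x v = \<mu> * L2_form x v"
    show "\<forall>v\<in>H10 D. (LINT t:D|lborel. wgrad x t \<bullet> weak_grad v t) = \<mu> * (LINT t:D|lborel. fn x t * v t)"
    proof
      fix v assume "v \<in> H10 D"
      then have v: "of_fn v \<in> h10 D" "fn (of_fn v) = v" using H10_fn by auto
      show "(LINT t:D|lborel. wgrad x t \<bullet> weak_grad v t) = \<mu> * (LINT t:D|lborel. fn x t * v t)"
        using bspec[OF * v(1)] set_forms[OF x D, of "of_fn v"] by (simp add: v(2))
    qed
  qed
  then show ?thesis unfolding dirichlet_eigenspace_def by (auto simp: fn_mem_H10)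
qed

lemma dirichlet_eigenspace_fn:
  assumes "u \<in> dirichlet_eigenspace D \<mu>" obtains x where "fn x = u" "x \<in> h10 D"
proof -
  have "u \<in> H10 D" using assms by (simp add: dirichlet_eigenspace_def)
  then show ?thesis using that[of "of_fn u"] H10_fn by blast
qed

text \<open>Linear algebra modulo null sets: more than \<open>m\<close> functions expanded in
  \<open>m\<close> spanning ones have a nontrivial combination that vanishes almost
  everywhere.\<close>

lemma dirichlet_multiplicity_le:
  assumes "dirichlet_multiplicity D \<mu> m" "dirichlet_multiplicity D \<mu> m'"
  shows "m' \<le> m"
proof (rule ccontr)
  assume "\<not> m' \<le> m"
  obtain e where e: "\<forall>u\<in>dirichlet_eigenspace D \<mu>. \<exists>c. AE x in lborel. u x = (\<Sum>i<m. c i * e i x)"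
    using assms(1) unfolding dirichlet_multiplicity_def by blast
  obtain f where f: "\<And>i. i < m' \<Longrightarrow> f i \<in> dirichlet_eigenspace D \<mu>"
    "\<And>c. (AE x in lborel. (\<Sum>i<m'. c i * f i x) = 0) \<Longrightarrow> (\<forall>i<m'. c i = 0)"
    using assms(2) unfolding dirichlet_multiplicity_def by blast
  have "\<forall>j. \<exists>c. j < m' \<longrightarrow> (AE x in lborel. f j x = (\<Sum>i<m. c i * e i x))" using e f(1) by blast
  then obtain A where A: "\<And>j. j < m' \<Longrightarrow> AE x in lborel. f j x = (\<Sum>i<m. A j i * e i x)" by metis
  obtain c where c: "\<exists>j\<in>{..<m'}. c j \<noteq> 0" "\<forall>i\<in>{..<m}. (\<Sum>j<m'. c j * A j i) = 0"
    using exists_nontrivial_kernel[of "{..<m}" "{..<m'}" "\<lambda>i j. A j i"] \<open>\<not> m' \<le> m\<close> by auto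
  have "AE x in lborel. \<forall>j\<in>{..<m'}. f j x = (\<Sum>i<m. A j i * e i x)"
    using A by (intro AE_finite_allI) auto
  then have "AE x in lborel. (\<Sum>j<m'. c j * f j x) = 0"
  proof eventually_elim
    case (elim x)
    then have "(\<Sum>j<m'. c j * f j x) = (\<Sum>j<m'. \<Sum>i<m. c j * A j i * e i x)"
      by (simp add: sum_distrib_left mult.assoc)
    also have "\<dots> = (\<Sum>i<m. \<Sum>j<m'. c j * A j i * e i x)" by (rule sum.swap)
    also have "\<dots> = (\<Sum>i<m. (\<Sum>j<m'. c j * A j i) * e i x)" by (simp add: sum_distrib_right)
    also have "\<dots> = 0" using c(2) by (intro sum.neutral) auto
    finally show ?case .
  qed
  with f(2) c(1) show False by blast
qed

lemma dirichlet_multiplicity_unique: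
  "dirichlet_multiplicity D \<mu> m \<Longrightarrow> dirichlet_multiplicity D \<mu> m' \<Longrightarrow> m = m'"
  using dirichlet_multiplicity_le by (blast intro: antisym)

text \<open>The \<open>e k\<close> in the fibre of \<open>\<mu>\<close> form the basis, renumbered
  by \<open>\<sigma>\<close>: orthonormality gives independence,
  \<open>eigensystem_eigenspace_span\<close> gives spanning. An empty fibre covers the values that
  are not eigenvalues.\<close>

lemma eigensystem_multiplicity:
  assumes D: "D \<in> sets borel" "bounded D" and es: "F.eigensystem (h10 D) e l"
  shows "dirichlet_multiplicity D \<mu> (card {k. l k = \<mu>})"
proof -
  let ?I = "{k. l k = \<mu>}"
  have cp: "F.form_compact (h10 D)" by (rule h10_compact[OF D(2)])
  have fin: "finite ?I" by (rule F.eigensystem_finite_fibre[OF es cp])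
  obtain \<sigma> where \<sigma>: "bij_betw \<sigma> {..<card ?I} ?I"
    using ex_bij_betw_nat_finite[OF fin] by (auto simp: atLeast0LessThan)
  have \<sigma>l: "i < card ?I \<Longrightarrow> l (\<sigma> i) = \<mu>" for i using \<sigma> by (auto simp: bij_betw_def)
  have comb: "fn (\<Sum>i<card ?I. c i *\<^sub>R e (\<sigma> i)) t = (\<Sum>i<card ?I. c i * fn (e (\<sigma> i)) t)" for c t
    by (simp add: fn_sum fn_simps)
  show ?thesis
    unfolding dirichlet_multiplicity_def
  proof (intro exI[of _ "\<lambda>i. fn (e (\<sigma> i))"] conjI allI impI ballI)
    fix i assume "i < card ?I"
    then show "fn (e (\<sigma> i)) \<in> dirichlet_eigenspace D \<mu>"
      using F.eigensystem_eig[OF es, of _ "\<sigma> i"] F.eigensystem_mem[OF es] \<sigma>l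
      by (simp add: dirichlet_eigenspace_iff[OF D(1)])
  next
    fix c i assume ae: "AE x in lborel. (\<Sum>i<card ?I. c i * fn (e (\<sigma> i)) x) = 0" and i: "i < card ?I"
    define x where "x = (\<Sum>i<card ?I. c i *\<^sub>R e (\<sigma> i))"
    have x0: "L2_form x x = 0" unfolding L2_form_zero_iff x_def comb by (rule ae)
    have "L2_form x (e (\<sigma> i)) = 0"
      using F.B.Cauchy_Schwarz[of x "e (\<sigma> i)"] x0 by simp
    moreover have "L2_form x (e (\<sigma> i)) = (\<Sum>j<card ?I. if j = i then c i else 0)"
      unfolding x_def F.B.sum_left F.B.scale_left
    proof (intro sum.cong refl)
      fix j assume j: "j \<in> {..<card ?I}"
      then have "\<sigma> j = \<sigma> i \<longleftrightarrow> j = i" using \<sigma> i by (auto simp: bij_betw_def inj_on_def)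
      then show "c j * L2_form (e (\<sigma> j)) (e (\<sigma> i)) = (if j = i then c i else 0)"
        by (simp add: F.eigensystem_orth[OF es])
    qed
    ultimately show "c i = 0" using i by simp
  next
    fix u assume "u \<in> dirichlet_eigenspace D \<mu>"
    then obtain x where u: "u = fn x" and x: "x \<in> h10 D" "\<And>v. v \<in> h10 D \<Longrightarrow> grad_form x v = \<mu> * L2_form x v"
      using dirichlet_eigenspace_fn dirichlet_eigenspace_iff[OF D(1)] by metis
    let ?y = "x - (\<Sum>k\<in>?I. L2_form x (e k) *\<^sub>R e k)"
    have "L2_form ?y ?y = 0" by (rule F.eigensystem_eigenspace_span[OF es subspace_h10 cp x])
    then have "AE t in lborel. fn ?y t = 0" by (simp add: L2_form_zero_iff)
    moreover have "(\<Sum>k\<in>?I. L2_form x (e k) *\<^sub>R e k) = (\<Sum>i<card ?I. L2_form x (e (\<sigma> i)) *\<^sub>R e (\<sigma> i))"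
      by (rule sum.reindex_bij_betw[OF \<sigma>, symmetric])
    ultimately have "AE t in lborel. u t = (\<Sum>i<card ?I. L2_form x (e (\<sigma> i)) * fn (e (\<sigma> i)) t)"
      by (simp add: u fn_simps fn_sum)
    then show "\<exists>c. AE t in lborel. u t = (\<Sum>i<card ?I. c i * fn (e (\<sigma> i)) t)"
      by (intro exI[of _ "\<lambda>i. L2_form x (e (\<sigma> i))"])
  qed
qed

text \<open>At the first index of disagreement take the smaller value. In the other sequence
  monotonicity allows it only at earlier indices, where both agree, so its fibre there is strictly
  smaller.\<close>

lemma mono_sequences_eq_if_card_fibres_eq:
  fixes l l' :: "nat \<Rightarrow> real"
  assumes "mono l" "mono l'" "\<And>\<mu>. finite {k. l k = \<mu>}" "\<And>\<mu>. finite {k. l' k = \<mu>}"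
    and card: "\<And>\<mu>. card {k. l k = \<mu>} = card {k. l' k = \<mu>}"
  shows "l = l'"
proof (rule ext, rule ccontr)
  fix k assume "l k \<noteq> l' k"
  define k0 where "k0 = (LEAST k. l k \<noteq> l' k)"
  have k0: "l k0 \<noteq> l' k0" "\<And>i. i < k0 \<Longrightarrow> l i = l' i"
    using LeastI[of "\<lambda>k. l k \<noteq> l' k", OF \<open>l k \<noteq> l' k\<close>] not_less_Least[of _ "\<lambda>k. l k \<noteq> l' k"]
    unfolding k0_def by blast+
  have no: False if m: "mono m" "mono m'" "\<And>\<mu>. finite {k. m k = \<mu>}" "\<And>\<mu>. card {k. m k = \<mu>} = card {k. m' k = \<mu>}"
    and lt: "m k0 < m' k0" and eq: "\<And>i. i < k0 \<Longrightarrow> m i = m' i" for m m' :: "nat \<Rightarrow> real"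
  proof -
    have "{k. m' k = m k0} \<subset> {k. m k = m k0}"
    proof (rule psubsetI)
      show "{k. m' k = m k0} \<subseteq> {k. m k = m k0}"
      proof
        fix i assume i: "i \<in> {k. m' k = m k0}"
        then have "\<not> k0 \<le> i" using lt monoD[OF m(2), of k0 i] by auto
        then show "i \<in> {k. m k = m k0}" using eq[of i] i by simp
      qed
      show "{k. m' k = m k0} \<noteq> {k. m k = m k0}" using lt by force
    qed
    then have "card {k. m' k = m k0} < card {k. m k = m k0}" by (intro psubset_card_mono m(3))
    then show False using m(4) by simp
  qed
  show False
  proof (cases "l k0 < l' k0")
    case True
    then show False using k0(2) by (rule no[OF assms(1,2,3) card])
  next
    case False
    then have "l' k0 < l k0" using k0(1) by simp
    then show False using k0(2)[symmetric] by (rule no[OF assms(2,1,4) card[symmetric]])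
  qed
qed

text \<open>Resolves the definite description: multiplicities fix the fibre sizes, and these fix a
  monotone sequence.\<close>

lemma dirichlet_eigenvalue_eq:
  assumes D: "D \<in> sets borel" "bounded D" and es: "F.eigensystem (h10 D) e l"
  shows "dirichlet_eigenvalue D N = l (N - 1)"
proof -
  have mono: "mono l" using es unfolding F.eigensystem_def by blast
  have fin: "finite {k. l k = \<mu>}" for \<mu> by (rule F.eigensystem_finite_fibre[OF es h10_compact[OF D(2)]])
  have enum: "enumerates_dirichlet_spectrum D l"
    unfolding enumerates_dirichlet_spectrum_def using mono fin eigensystem_multiplicity[OF D es] by blast
  have "l' = l" if "enumerates_dirichlet_spectrum D l'" for l'
  proof (rule mono_sequences_eq_if_card_fibres_eq)
    show "card {k. l' k = \<mu>} = card {k. l k = \<mu>}" for \<mu>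
      using that eigensystem_multiplicity[OF D es] unfolding enumerates_dirichlet_spectrum_def
      by (blast intro: dirichlet_multiplicity_unique)
  qed (use that mono fin in \<open>auto simp: enumerates_dirichlet_spectrum_def\<close>)
  then have "(THE l. enumerates_dirichlet_spectrum D l) = l" using enum by (intro the_equality)
  then show ?thesis by (simp add: dirichlet_eigenvalue_def)
qed

text \<open>Among combinations of \<open>k + 1\<close> bumps with disjoint supports in
  \<open>D\<close> a nontrivial one is orthogonal to \<open>k\<close> given vectors, and
  disjointness makes its squared norm a positive sum of weighted squares.\<close>

lemma h10_infinite_rank:
  fixes D :: "'a::euclidean_space set"
  assumes "open D" "D \<noteq> {}" shows "F.infinite_rank (h10 D)"
  unfolding F.infinite_rank_def
proof (intro allI)
  fix k and e :: "nat \<Rightarrow> 'a h1"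
  obtain c r where r: "r > 0" "ball c r \<subseteq> D" using assms by (meson ex_in_conv openE)
  obtain b :: 'a where b: "b \<in> Basis" using nonempty_Basis by blast
  \<comment> \<open>Bumps of radius \<open>s / 2\<close> sit at spacing \<open>s\<close> along one
    axis; the divisor \<open>k + 2\<close> keeps the last one, centred at distance
    \<open>k * s\<close>, inside the ball of radius \<open>r\<close>.\<close>
  define s where "s = r / real (k + 2)"
  have s: "s > 0" "real (k + 2) * s = r" using r(1) by (simp_all add: s_def)
  define p where "p = (\<lambda>j::nat. c + (real j * s) *\<^sub>R b)"
  have dist_p: "dist (p i) (p j) = \<bar>real i - real j\<bar> * s" for i j
  proof -
    have "p i - p j = ((real i - real j) * s) *\<^sub>R b" by (simp add: p_def algebra_simps)
    then show ?thesis using b s(1) by (simp add: dist_norm abs_mult)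
  qed
  have "\<exists>\<eta> V. \<eta> \<in> test_functions (ball (p j) (s / 2)) \<and> open V \<and> p j \<in> V \<and> (\<forall>x\<in>V. \<eta> x = 1)" for j
    using smooth_cutoff[of "{p j}" "ball (p j) (s / 2)"] s(1) by (metis compact_sing open_ball centre_in_ball half_gt_zero insert_subset empty_subsetI)
  then obtain \<eta> V where \<eta>: "\<And>j. \<eta> j \<in> test_functions (ball (p j) (s / 2))"
    "\<And>j. open (V j)" "\<And>j. p j \<in> V j" "\<And>j x. x \<in> V j \<Longrightarrow> \<eta> j x = 1" by metis
  define f where "f = (\<lambda>j. of_fn (\<eta> j))"
  have fn_f: "fn (f j) = \<eta> j" for j unfolding f_def by (rule fn_of_test[OF \<eta>(1)])
  have fD: "f j \<in> h10 D" if j: "j \<le> k" for j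
  proof -
    have "ball (p j) (s / 2) \<subseteq> ball c r"
    proof
      fix x assume "x \<in> ball (p j) (s / 2)"
      then have "dist (p j) x < s / 2" by simp
      moreover have "dist c (p j) = real j * s" using dist_p[of 0 j] by (simp add: p_def)
      ultimately have "dist c x < real j * s + s / 2" using dist_triangle[of c x "p j"] by linarith
      also have "\<dots> \<le> real (k + 2) * s"
      proof -
        have "real j * s \<le> real k * s" using j s(1) by (intro mult_right_mono) auto
        moreover have "real (k + 2) * s = real k * s + 2 * s" by (simp add: distrib_right)
        ultimately show ?thesis using s(1) by linarith
      qed
      finally show "x \<in> ball c r" using s(2) by simp
    qed
    then have "\<eta> j \<in> test_functions D" using \<eta>(1) r(2) test_functions_mono by blast
    then show ?thesis unfolding f_def by (rule test_h10)
  qed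
  have f_pos: "L2_form (f j) (f j) > 0" for j
  proof (rule ccontr)
    assume "\<not> ?thesis"
    then have "L2_form (f j) (f j) = 0" using F.B.nonneg[of "f j"] by simp
    then have ae: "AE x in lborel. \<eta> j x = 0" by (simp add: L2_form_zero_iff fn_f)
    obtain d where d: "d > 0" "ball (p j) d \<subseteq> V j" using \<eta>(2,3) by (meson openE)
    have "AE x in lborel. x \<notin> ball (p j) d" using ae by eventually_elim (use d(2) \<eta>(4) in force)
    then have "emeasure lborel (ball (p j) d) = 0" by (subst (asm) AE_iff_measurable[of "ball (p j) d"]) auto
    then have "measure lborel (ball (p j) d) = 0" by (simp add: measure_def)
    then show False using content_ball_pos[OF d(1), of "p j"] by simp
  qed
  have f_orth: "L2_form (f i) (f j) = 0" if "i \<noteq> j" for i j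
  proof -
    have "\<eta> i x * \<eta> j x = 0" for x
    proof (rule ccontr)
      assume "\<not> ?thesis"
      then have "x \<in> ball (p i) (s / 2)" "x \<in> ball (p j) (s / 2)"
        using test_vanishes_outside(1)[OF \<eta>(1)] by (metis mult_zero_left, metis mult_zero_right)
      then have "dist (p i) (p j) < s" using dist_triangle_half_r by (metis dist_commute mem_ball dist_triangle_half_l)
      moreover have "\<bar>real i - real j\<bar> \<ge> 1" using that by linarith
      then have "1 * s \<le> \<bar>real i - real j\<bar> * s" using s(1) by (intro mult_right_mono) auto
      ultimately show False unfolding dist_p by simp
    qed
    then have "(\<lambda>x. \<eta> i x * \<eta> j x) = (\<lambda>x. 0)" by blast
    then show ?thesis unfolding L2_form_def fn_f by (simp only:) simp
  qed
  obtain a where a: "\<exists>j\<in>{..k}. a j \<noteq> 0" "\<forall>i\<in>{..<k}. (\<Sum>j\<le>k. a j * L2_form (f j) (e i)) = 0"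
    using exists_nontrivial_kernel[of "{..<k}" "{..k}" "\<lambda>i j. L2_form (f j) (e i)"] by auto
  define x where "x = (\<Sum>j\<le>k. a j *\<^sub>R f j)"
  have "x \<in> h10 D" unfolding x_def
    using fD subspace_h10 by (intro subspace_sum subspace_scale) auto
  moreover have "\<forall>i<k. L2_form x (e i) = 0" using a(2) by (simp add: x_def F.B.sum_left F.B.scale_left)
  moreover have "L2_form x x > 0"
  proof -
    have "L2_form x x = (\<Sum>i\<le>k. \<Sum>j\<le>k. a i * (a j * L2_form (f i) (f j)))"
      by (simp add: x_def F.B.sum_left F.B.sum_right F.B.scale_left F.B.scale_right sum_distrib_left)
        (auto intro!: sum.cong simp: F.B.sym)
    also have "\<dots> = (\<Sum>i\<le>k. \<Sum>j\<le>k. if j = i then (a i)\<^sup>2 * L2_form (f i) (f i) else 0)"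
      by (intro sum.cong refl) (auto simp: f_orth power2_eq_square)
    also have "\<dots> = (\<Sum>i\<le>k. (a i)\<^sup>2 * L2_form (f i) (f i))" by simp
    also have "\<dots> > 0"
    proof -
      obtain j where j: "j \<le> k" "a j \<noteq> 0" using a(1) by auto
      then have "0 < (a j)\<^sup>2 * L2_form (f j) (f j)" using f_pos by simp
      then show ?thesis using j f_pos by (intro sum_pos2[of _ j]) (auto intro!: mult_nonneg_nonneg less_imp_le[OF f_pos])
    qed
    finally show ?thesis .
  qed
  ultimately show "\<exists>x\<in>h10 D. (\<forall>i<k. L2_form x (e i) = 0) \<and> 0 < L2_form x x" by blast
qed

lemma h10_eigensystem_exists:
  assumes "open D" "D \<noteq> {}" "bounded D"
  shows "\<exists>e l. F.eigensystem (h10 D) e l"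
proof -
  obtain C where "F.form_poincare (h10 D) C" using h10_poincare[OF assms(3)] by blast
  then show ?thesis
    by (rule F.eigensystem_exists[OF subspace_h10 h10_complete[OF assms(3)] h10_compact[OF assms(3)]
        _ h10_infinite_rank[OF assms(1,2)]])
qed

section \<open>Capacities and density off a set of capacity zero\<close>

lemma u_capacity_eq_form_capacity:
  assumes \<Omega>: "\<Omega> \<in> sets borel"
  shows "u_capacity \<Omega> K (fn x) = F.form_capacity (h10 \<Omega>) (h10 (\<Omega> - K)) x"
proof -
  have fe: "(LINT t:\<Omega>|lborel. (norm (wgrad y t))\<^sup>2) = grad_form y y" if "y \<in> h10 \<Omega>" for y
    using set_forms(1)[OF that \<Omega>, of y] by (simp add: power2_norm_eq_inner)
  have minus: "(\<lambda>t. fn y t - fn x t) = fn (y - x)" for y by (auto simp: fn_simps)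
  have "{LINT t:\<Omega>|lborel. (norm (weak_grad f t))\<^sup>2 | f. f \<in> H10 \<Omega> \<and> (\<lambda>t. f t - fn x t) \<in> H10 (\<Omega> - K)}
      = {grad_form f f | f. f \<in> h10 \<Omega> \<and> f - x \<in> h10 (\<Omega> - K)}" (is "?L = ?R")
  proof (intro equalityI subsetI)
    fix z assume "z \<in> ?L"
    then obtain f where f: "z = (LINT t:\<Omega>|lborel. (norm (weak_grad f t))\<^sup>2)" "f \<in> H10 \<Omega>"
      "(\<lambda>t. f t - fn x t) \<in> H10 (\<Omega> - K)" by blast
    then have y: "of_fn f \<in> h10 \<Omega>" "fn (of_fn f) = f" using H10_fn by auto
    have "of_fn f - x \<in> h10 (\<Omega> - K)" using f(3) minus[of "of_fn f"] by (simp add: y(2) h10_def)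
    then show "z \<in> ?R" using y f(1) fe[OF y(1)] by auto
  next
    fix z assume "z \<in> ?R"
    then obtain y where y: "z = grad_form y y" "y \<in> h10 \<Omega>" "y - x \<in> h10 (\<Omega> - K)" by blast
    then show "z \<in> ?L" using fe[OF y(2)] minus[of y] by (auto simp: h10_def intro!: exI[of _ "fn y"])
  qed
  then show ?thesis unfolding u_capacity_def F.form_capacity_def by simp
qed

text \<open>Zero capacity yields \<open>y\<close> of small energy that differs from the fixed cutoff
  by an element of \<open>h10 (\<Omega> - K)\<close>. Replacing this difference by a test function
  \<open>\<phi>\<close>, which vanishes near \<open>K\<close>, makes the competitor smooth and equal
  to 1 near \<open>K\<close> while its energy stays small.\<close>

lemma capacity_zero_cutoff:
  fixes \<Omega> :: "'a::euclidean_space set"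
  assumes \<Omega>: "open \<Omega>" and K: "compact K" "K \<subseteq> \<Omega>" and cap: "condenser_capacity \<Omega> K = 0" and e: "e > 0"
  obtains h U where "h \<in> test_functions \<Omega>" "open U" "K \<subseteq> U" "\<And>x. x \<in> U \<Longrightarrow> h x = 1"
    "(LINT x|lborel. (norm (grad h x))\<^sup>2) < e"
proof -
  define \<eta> where "\<eta> = (SOME \<eta>. \<eta> \<in> test_functions \<Omega> \<and> (\<exists>U. open U \<and> K \<subseteq> U \<and> (\<forall>x\<in>U. \<eta> x = 1)))"
  have "\<exists>\<eta>. \<eta> \<in> test_functions \<Omega> \<and> (\<exists>U. open U \<and> K \<subseteq> U \<and> (\<forall>x\<in>U. \<eta> x = 1))"
    using smooth_cutoff[OF K(1) \<Omega> K(2)] by metis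
  then have "\<eta> \<in> test_functions \<Omega> \<and> (\<exists>U. open U \<and> K \<subseteq> U \<and> (\<forall>x\<in>U. \<eta> x = 1))"
    unfolding \<eta>_def by (rule someI_ex)
  then obtain U where \<eta>: "\<eta> \<in> test_functions \<Omega>" and U: "open U" "K \<subseteq> U" "\<And>x. x \<in> U \<Longrightarrow> \<eta> x = 1" by blast
  define z where "z = of_fn \<eta>"
  have fz: "fn z = \<eta>" unfolding z_def by (rule fn_of_test[OF \<eta>])
  have "F.form_capacity (h10 \<Omega>) (h10 (\<Omega> - K)) z = 0"
    using u_capacity_eq_form_capacity[of \<Omega> K z] \<Omega> cap unfolding condenser_capacity_def by (simp add: fz \<eta>_def)
  then have lt: "Inf {grad_form f f |f. f \<in> h10 \<Omega> \<and> f - z \<in> h10 (\<Omega> - K)} < e / 4"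
    using e by (simp add: F.form_capacity_def)
  have "z \<in> h10 \<Omega> \<and> z - z \<in> h10 (\<Omega> - K)"
    using test_h10[OF \<eta>] subspace_0[OF subspace_h10] by (simp add: z_def)
  then have ne: "{grad_form f f |f. f \<in> h10 \<Omega> \<and> f - z \<in> h10 (\<Omega> - K)} \<noteq> {}" by blast
  obtain y where y: "y \<in> h10 \<Omega>" "y - z \<in> h10 (\<Omega> - K)" "grad_form y y < e / 4"
    using cInf_lessD[OF ne lt] by blast
  have e4: "e / 4 > 0" using e by simp
  obtain \<phi> where \<phi>: "\<phi> \<in> test_functions (\<Omega> - K)"
    "L2_form (of_fn \<phi> - (y - z)) (of_fn \<phi> - (y - z)) + grad_form (of_fn \<phi> - (y - z)) (of_fn \<phi> - (y - z)) < e / 4"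
    using h10_approx[OF y(2) e4] by blast
  have \<phi>\<Omega>: "\<phi> \<in> test_functions \<Omega>" using \<phi>(1) test_functions_mono[of "\<Omega> - K" \<Omega>] by blast
  define h where "h = (\<lambda>t. \<eta> t + \<phi> t)"
  have h: "h \<in> test_functions \<Omega>" unfolding h_def by (rule test_functions_add[OF \<eta> \<phi>\<Omega>])
  have "of_fn h = (of_fn \<phi> - (y - z)) + y"
    unfolding h_def of_fn_linear(1)[OF \<eta> \<phi>\<Omega>] z_def by simp
  then have "grad_form (of_fn h) (of_fn h) \<le> 2 * grad_form (of_fn \<phi> - (y - z)) (of_fn \<phi> - (y - z)) + 2 * grad_form y y"
    using F.A.quad_add_le[of "of_fn \<phi> - (y - z)" y] by simp
  then have "grad_form (of_fn h) (of_fn h) < e"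
    using \<phi>(2) y(3) F.B.nonneg[of "of_fn \<phi> - (y - z)"] by linarith
  then have "(LINT x|lborel. (norm (grad h x))\<^sup>2) < e" by (simp add: grad_form_test[OF h])
  moreover have "K \<subseteq> U \<inter> - closure {x. \<phi> x \<noteq> 0}" using U(2) \<phi>(1) by (auto simp: test_functions_def)
  moreover have "open (U \<inter> - closure {x. \<phi> x \<noteq> 0})" using U(1) by (intro open_Int) auto
  moreover have "h x = 1" if "x \<in> U \<inter> - closure {x. \<phi> x \<noteq> 0}" for x
    using that U(3) test_support(1)[OF \<phi>(1), of x] by (simp add: h_def)
  ultimately show ?thesis using that h by blast
qed

text \<open>A test function \<open>\<psi>\<close> near \<open>x\<close> is multiplied by
  \<open>1 - h\<close>, where \<open>h\<close> is 1 near \<open>K\<close> and has small energy. In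
  the gradient of the error, the product of \<open>\<psi>\<close> and \<open>h\<close>, one term is
  controlled by the energy of \<open>h\<close> and the other by its L2 norm, hence by Poincare again
  by its energy.\<close>

lemma test_functions_dense_off_null_capacity:
  fixes \<Omega> :: "'a::euclidean_space set"
  assumes \<Omega>: "open \<Omega>" "bounded \<Omega>" and K: "compact K" "K \<subseteq> \<Omega>" and cap: "condenser_capacity \<Omega> K = 0"
    and x: "x \<in> h10 \<Omega>" and e: "e > 0"
  shows "\<exists>\<phi>\<in>test_functions (\<Omega> - K). grad_form (of_fn \<phi> - x) (of_fn \<phi> - x) < e"
proof -
  have e4: "e / 4 > 0" using e by simp
  obtain \<psi> where \<psi>: "\<psi> \<in> test_functions \<Omega>"
    "L2_form (of_fn \<psi> - x) (of_fn \<psi> - x) + grad_form (of_fn \<psi> - x) (of_fn \<psi> - x) < e / 4"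
    using h10_approx[OF x e4] by blast
  obtain B where B: "B > 0" "\<And>x. \<bar>\<psi> x\<bar> \<le> B" "\<And>x. norm (grad \<psi> x) \<le> B" using test_bounded[OF \<psi>(1)] by metis
  obtain C where C: "C > 0" "\<And>\<phi>. \<phi> \<in> test_functions \<Omega> \<Longrightarrow> (LINT x|lborel. (\<phi> x)\<^sup>2) \<le> C * (LINT x|lborel. (norm (grad \<phi> x))\<^sup>2)"
    using poincare_test_functions[OF \<Omega>(2)] by blast
  \<comment> \<open>The energy of the error is at most \<open>M\<close> times that of
    \<open>h\<close>; the summand \<open>C\<close> is the Poincare share.\<close>
  define M where "M = 2 * B\<^sup>2 * (1 + C)"
  have M: "M > 0" using B(1) C(1) by (simp add: M_def)
  obtain h U where h: "h \<in> test_functions \<Omega>" "open U" "K \<subseteq> U" "\<And>x. x \<in> U \<Longrightarrow> h x = 1"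
    "(LINT x|lborel. (norm (grad h x))\<^sup>2) < e / (4 * M)"
    using capacity_zero_cutoff[OF \<Omega>(1) K cap, of "e / (4 * M)"] e M by auto
  define p where "p = (\<lambda>t. \<psi> t * h t)"
  have p: "p \<in> test_functions \<Omega>" unfolding p_def
    using h(1) by (intro test_functions_mult[OF \<psi>(1)]) (simp add: test_functions_def)
  have "(LINT t|lborel. (norm (grad p t))\<^sup>2) \<le> (LINT t|lborel. 2 * B\<^sup>2 * (norm (grad h t))\<^sup>2 + 2 * B\<^sup>2 * (h t)\<^sup>2)"
  proof (rule integral_mono)
    show "integrable lborel (\<lambda>t. (norm (grad p t))\<^sup>2)" by (rule square_integrableD[OF test_square_integrable(2)[OF p]])
    show "integrable lborel (\<lambda>t. 2 * B\<^sup>2 * (norm (grad h t))\<^sup>2 + 2 * B\<^sup>2 * (h t)\<^sup>2)"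
      using square_integrableD[OF test_square_integrable(2)[OF h(1)]] square_integrableD[OF test_square_integrable(1)[OF h(1)]]
      by simp
    fix t
    have 1: "(norm (\<psi> t *\<^sub>R grad h t))\<^sup>2 \<le> B\<^sup>2 * (norm (grad h t))\<^sup>2"
      using power_mono[OF B(2)[of t], of 2] by (auto simp: power_mult_distrib intro!: mult_right_mono)
    have 2: "(norm (h t *\<^sub>R grad \<psi> t))\<^sup>2 \<le> B\<^sup>2 * (h t)\<^sup>2"
      using mult_right_mono[OF power_mono[OF B(3)[of t], of 2] zero_le_power2[of "h t"]]
      by (simp add: power_mult_distrib mult.commute)
    have gp: "grad p t = \<psi> t *\<^sub>R grad h t + h t *\<^sub>R grad \<psi> t"
      unfolding p_def by (rule grad_mult[OF test_C_k[OF \<psi>(1)] test_C_k[OF h(1)]])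
    show "(norm (grad p t))\<^sup>2 \<le> 2 * B\<^sup>2 * (norm (grad h t))\<^sup>2 + 2 * B\<^sup>2 * (h t)\<^sup>2"
      using norm_add_sq_le[of "\<psi> t *\<^sub>R grad h t" "h t *\<^sub>R grad \<psi> t"] 1 2
      unfolding gp mult.assoc by linarith
  qed
  also have "\<dots> = 2 * B\<^sup>2 * (LINT t|lborel. (norm (grad h t))\<^sup>2) + 2 * B\<^sup>2 * (LINT t|lborel. (h t)\<^sup>2)"
    using square_integrableD[OF test_square_integrable(2)[OF h(1)]] square_integrableD[OF test_square_integrable(1)[OF h(1)]]
    by simp
  also have "\<dots> \<le> 2 * B\<^sup>2 * (LINT t|lborel. (norm (grad h t))\<^sup>2) + 2 * B\<^sup>2 * (C * (LINT t|lborel. (norm (grad h t))\<^sup>2))"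
    using C(2)[OF h(1)] by (intro add_mono mult_left_mono) auto
  also have "\<dots> = M * (LINT t|lborel. (norm (grad h t))\<^sup>2)" by (simp add: M_def algebra_simps)
  also have "\<dots> < e / 4" using h(5) M by (simp add: field_simps)
  finally have gp: "grad_form (of_fn p) (of_fn p) < e / 4" by (simp add: grad_form_test[OF p])
  define \<phi> where "\<phi> = (\<lambda>t. \<psi> t - p t)"
  have "\<phi> \<in> test_functions \<Omega>" unfolding \<phi>_def by (rule test_functions_diff[OF \<psi>(1) p])
  have \<phi>: "\<phi> \<in> test_functions (\<Omega> - K)"
  proof (rule test_functionsI)
    show "smooth \<phi>" using \<open>\<phi> \<in> test_functions \<Omega>\<close> by (simp add: test_functions_def)
    \<comment> \<open>\<open>\<phi>\<close> vanishes where \<open>h\<close> is 1, so the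
      neighbourhood \<open>U\<close> of \<open>K\<close> can be removed from the support of
      \<open>\<psi>\<close>.\<close>
    show "compact (closure {x. \<psi> x \<noteq> 0} - U)"
      using \<psi>(1) h(2) by (intro compact_diff) (auto simp: test_functions_def)
    show "closure {x. \<psi> x \<noteq> 0} - U \<subseteq> \<Omega> - K" using \<psi>(1) h(3) by (auto simp: test_functions_def)
    fix t assume "\<phi> t \<noteq> 0"
    then have "\<psi> t \<noteq> 0" "h t \<noteq> 1" by (auto simp: \<phi>_def p_def)
    then show "t \<in> closure {x. \<psi> x \<noteq> 0} - U" using closure_subset[of "{x. \<psi> x \<noteq> 0}"] h(4) by auto
  qed
  have "of_fn \<phi> - x = (of_fn \<psi> - x) + (- 1) *\<^sub>R of_fn p"
    unfolding \<phi>_def of_fn_linear(2)[OF \<psi>(1) p] by simp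
  then have "grad_form (of_fn \<phi> - x) (of_fn \<phi> - x) \<le> 2 * grad_form (of_fn \<psi> - x) (of_fn \<psi> - x)
      + 2 * grad_form ((- 1) *\<^sub>R of_fn p) ((- 1) *\<^sub>R of_fn p)"
    using F.A.quad_add_le[of "of_fn \<psi> - x" "(- 1) *\<^sub>R of_fn p"] by (simp only:)
  moreover have "grad_form ((- 1) *\<^sub>R of_fn p) ((- 1) *\<^sub>R of_fn p) = grad_form (of_fn p) (of_fn p)"
    by (simp only: F.A.scale_left F.A.scale_right)
  ultimately have "grad_form (of_fn \<phi> - x) (of_fn \<phi> - x) < e"
    using gp \<psi>(2) F.B.nonneg[of "of_fn \<psi> - x"] by linarith
  with \<phi> show ?thesis by blast
qed

theorem theorem1p4:
  fixes \<Omega> :: "(real ^ 'n) set"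
    and N :: nat
    and u :: "real ^ 'n \<Rightarrow> real"
    and K :: "real \<Rightarrow> (real ^ 'n) set"
    and K0 :: "(real ^ 'n) set"
  assumes "open \<Omega>" and "bounded \<Omega>" and "connected \<Omega>"
    and "N \<ge> 1"
    and "dirichlet_multiplicity \<Omega> (dirichlet_eigenvalue \<Omega> N) 1"
    and "u \<in> dirichlet_eigenspace \<Omega> (dirichlet_eigenvalue \<Omega> N)"
    and "(LINT x:\<Omega>|lborel. (u x)\<^sup>2) = 1"
    and "\<And>\<epsilon>. \<epsilon> > 0 \<Longrightarrow> compact (K \<epsilon>) \<and> K \<epsilon> \<subseteq> \<Omega>"
    and "compact K0" and "K0 \<subseteq> \<Omega>"
    and "concentrating \<Omega> K K0"
    and "condenser_capacity \<Omega> K0 = 0"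
  shows "(\<lambda>\<epsilon>. dirichlet_eigenvalue (\<Omega> - K \<epsilon>) N
              - (dirichlet_eigenvalue \<Omega> N + u_capacity \<Omega> (K \<epsilon>) u))
         \<in> o[at_right 0](\<lambda>\<epsilon>. u_capacity \<Omega> (K \<epsilon>) u)"
proof -
  have \<Omega>b: "\<Omega> \<in> sets borel" using assms(1) by simp
  \<comment> \<open>The normalization of \<open>u\<close> rules out the empty set.\<close>
  have ne: "\<Omega> \<noteq> {}"
  proof
    assume "\<Omega> = {}"
    then show False using assms(7) by (simp add: set_lebesgue_integral_def)
  qed
  have sub: "open (\<Omega> - K \<epsilon>) \<and> \<Omega> - K \<epsilon> \<noteq> {} \<and> bounded (\<Omega> - K \<epsilon>)" if "\<epsilon> > 0" for \<epsilon>
  proof -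
    have "compact (K \<epsilon>)" "K \<epsilon> \<subseteq> \<Omega>" using assms(8)[OF that] by auto
    \<comment> \<open>Otherwise \<open>K \<epsilon>\<close> would be nonempty, open and closed,
      hence the whole space, which is unbounded.\<close>
    moreover have "\<Omega> - K \<epsilon> \<noteq> {}"
    proof
      assume "\<Omega> - K \<epsilon> = {}"
      then have "\<Omega> = K \<epsilon>" using \<open>K \<epsilon> \<subseteq> \<Omega>\<close> by blast
      then have "open (K \<epsilon>)" "closed (K \<epsilon>)" "K \<epsilon> \<noteq> {}" "bounded (K \<epsilon>)"
        using assms(1,2) ne \<open>compact (K \<epsilon>)\<close> by (auto intro: compact_imp_closed)
      then show False using clopen[of "K \<epsilon>"] not_bounded_UNIV by auto
    qed
    ultimately show ?thesis
      using assms(1,2) by (auto intro!: open_Diff compact_imp_closed intro: bounded_subset)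
  qed
  obtain e l where es: "F.eigensystem (h10 \<Omega>) e l"
    using h10_eigensystem_exists[OF assms(1) ne assms(2)] by blast
  have "\<forall>\<epsilon>. \<exists>e l. \<epsilon> > 0 \<longrightarrow> F.eigensystem (h10 (\<Omega> - K \<epsilon>)) e l"
    using h10_eigensystem_exists sub by metis
  then obtain e' l' where es': "\<And>\<epsilon>. \<epsilon> > 0 \<Longrightarrow> F.eigensystem (h10 (\<Omega> - K \<epsilon>)) (e' \<epsilon>) (l' \<epsilon>)" by metis
  obtain C where C: "F.form_poincare (h10 \<Omega>) C" using h10_poincare[OF assms(2)] by blast
  \<comment> \<open>\<open>dirichlet_eigenvalue\<close> counts from 1, an eigensystem from
    0.\<close>
  define j where "j = N - 1"
  have eig_j: "dirichlet_eigenvalue \<Omega> N = l j"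
    unfolding j_def by (rule dirichlet_eigenvalue_eq[OF \<Omega>b assms(2) es])
  have eig_sub: "dirichlet_eigenvalue (\<Omega> - K \<epsilon>) N = l' \<epsilon> j" if "\<epsilon> > 0" for \<epsilon>
    unfolding j_def using sub[OF that] es'[OF that] by (intro dirichlet_eigenvalue_eq) auto
  \<comment> \<open>The multiplicity equals the number of indices carrying the value
    \<open>l j\<close>, so multiplicity one leaves \<open>j\<close> alone.\<close>
  have simple: "k = j" if "l k = l j" for k
  proof -
    have "dirichlet_multiplicity \<Omega> (l j) (card {k. l k = l j})"
      by (rule eigensystem_multiplicity[OF \<Omega>b assms(2) es])
    then have "card {k. l k = l j} = 1"
      using assms(5) unfolding eig_j by (rule dirichlet_multiplicity_unique)
    then obtain i where "{k. l k = l j} = {i}" by (auto simp: card_1_singleton_iff)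
    moreover have "k \<in> {k. l k = l j}" "j \<in> {k. l k = l j}" using that by auto
    ultimately show ?thesis by simp
  qed
  obtain x where x: "fn x = u" "x \<in> h10 \<Omega>" using dirichlet_eigenspace_fn[OF assms(6)] by blast
  have eig: "grad_form x v = l j * L2_form x v" if "v \<in> h10 \<Omega>" for v
    using assms(6) that dirichlet_eigenspace_iff[OF \<Omega>b, of x "l j"] unfolding eig_j x(1) by blast
  have norm: "L2_form x x = 1"
    using set_forms(2)[OF x(2) \<Omega>b, of x] assms(7) by (simp add: x(1) power2_eq_square)
  have dense: "\<forall>\<^sub>F \<epsilon> in at_right 0. \<exists>f\<in>h10 (\<Omega> - K \<epsilon>). grad_form (f - y) (f - y) < \<eta>"
    if y: "y \<in> h10 \<Omega>" and \<eta>: "\<eta> > 0" for y \<eta>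
  proof -
    obtain \<phi> where \<phi>: "\<phi> \<in> test_functions (\<Omega> - K0)" "grad_form (of_fn \<phi> - y) (of_fn \<phi> - y) < \<eta>"
      using test_functions_dense_off_null_capacity[OF assms(1,2,9,10,12) y \<eta>] by blast
    \<comment> \<open>The complement of the support is a neighbourhood of \<open>K0\<close>. Once it
      contains \<open>K \<epsilon>\<close>, the same \<open>\<phi>\<close> is a test function on
      \<open>\<Omega> - K \<epsilon>\<close>.\<close>
    let ?U = "\<Omega> - closure {t. \<phi> t \<noteq> 0}"
    have supp: "smooth \<phi>" "compact (closure {t. \<phi> t \<noteq> 0})" "closure {t. \<phi> t \<noteq> 0} \<subseteq> \<Omega> - K0"
      using \<phi>(1) by (simp_all only: test_functions_def mem_Collect_eq)
    have "open ?U" using assms(1) by (intro open_Diff closed_closure)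
    moreover have "?U \<subseteq> \<Omega>" "K0 \<subseteq> ?U" using supp(3) assms(10) by blast+
    ultimately have "\<exists>\<delta>>0. \<forall>\<epsilon>. 0 < \<epsilon> \<and> \<epsilon> < \<delta> \<longrightarrow> K \<epsilon> \<subseteq> ?U"
      using assms(11)[unfolded concentrating_def, rule_format, of ?U] by (simp only: simp_thms)
    then obtain \<delta> where \<delta>: "\<delta> > 0" "\<And>\<epsilon>. 0 < \<epsilon> \<Longrightarrow> \<epsilon> < \<delta> \<Longrightarrow> K \<epsilon> \<subseteq> ?U"
      by metis
    have "\<exists>f\<in>h10 (\<Omega> - K \<epsilon>). grad_form (f - y) (f - y) < \<eta>" if "0 < \<epsilon>" "\<epsilon> < \<delta>" for \<epsilon>
    proof -
      have "closure {t. \<phi> t \<noteq> 0} \<subseteq> \<Omega> - K \<epsilon>" using supp(3) \<delta>(2)[OF that] by blast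
      then have "\<phi> \<in> test_functions (\<Omega> - K \<epsilon>)"
        unfolding test_functions_def mem_Collect_eq by (intro conjI supp)
      then show ?thesis using test_h10 \<phi>(2) by blast
    qed
    then show ?thesis unfolding eventually_at_right_field using \<delta>(1) by blast
  qed
  have T: "\<forall>\<^sub>F \<epsilon> in at_right 0. subspace (h10 (\<Omega> - K \<epsilon>)) \<and> h10 (\<Omega> - K \<epsilon>) \<subseteq> h10 \<Omega> \<and>
      F.form_complete (h10 (\<Omega> - K \<epsilon>)) \<and> F.eigensystem (h10 (\<Omega> - K \<epsilon>)) (e' \<epsilon>) (l' \<epsilon>)"
    using eventually_at_right_less[of 0]
    by eventually_elim (use sub in \<open>auto intro!: conjI subspace_h10 h10_complete h10_mono es'\<close>)
  have cap: "F.form_capacity (h10 \<Omega>) (h10 (\<Omega> - K \<epsilon>)) x = u_capacity \<Omega> (K \<epsilon>) u" for \<epsilon>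
    using u_capacity_eq_form_capacity[OF \<Omega>b, of "K \<epsilon>" x] by (simp add: x(1))
  have "(\<lambda>\<epsilon>. l' \<epsilon> j - (l j + F.form_capacity (h10 \<Omega>) (h10 (\<Omega> - K \<epsilon>)) x))
      \<in> o[at_right 0](\<lambda>\<epsilon>. F.form_capacity (h10 \<Omega>) (h10 (\<Omega> - K \<epsilon>)) x)"
    by (rule F.eigenvalue_asymptotics[OF subspace_h10 h10_compact[OF assms(2)] C es T dense simple x(2) eig norm])
  \<comment> \<open>The sequences \<open>l' \<epsilon>\<close> are eigenvalues only for positive
    \<open>\<epsilon>\<close>, so the two remainders are identified eventually to the right of
    0.\<close>
  also have "?this \<longleftrightarrow> ?thesis"
    unfolding cap eig_j
    by (intro landau_o.small.in_cong eventually_mono[OF eventually_at_right_less[of 0]]) (simp add: eig_sub)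
  finally show ?thesis .
qed

end
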